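(* There exist functions $s_1,s_2\in L_{2,loc}(\mathbb{R}_+)$ and a number $\varepsilon>0$ such that: (1) the minimal operator corresponding to $s_1$ is semi-bounded and has extensions with compact resolvents, while the minimal operator corresponding to $(1+\varepsilon)s_1$ is not semi-bounded; (2) the minimal operator corresponding to $s_2$ is semi-bounded and has extensions with compact resolvents, while the minimal operator corresponding to $(1+\varepsilon)s_2$ is semi-bounded but does not have extensions with compact resolvents.
   Context: $\mathbb{R}_+=[0,+\infty)$; the subscript "loc" means the property holds on every segment $[0,R]$. Minimal operator corresponding to $s\in L_{2,loc}(\mathbb{R}_+)$: for $y\in AC_{loc}(\mathbb{R}_+)$ put $y^{[1]}=y'-sy$, and if $y^{[1]}\in AC_{loc}(\mathbb{R}_+)$ put $l(y)=-(y^{[1]})'-sy^{[1]}-s^2y$ (a regularization of $-y''+s'y$). Let $$\mathscr{D}_0=\{y\in L_2(\mathbb{R}_+): y,y^{[1]}\in AC_{loc}(\mathbb{R}_+),\ l(y)\in L_2(\mathbb{R}_+),\ y(0)=y^{[1]}(0)=0,\ \operatorname{supp}y\text{ compact}\}.$$ The minimal operator $L_0$ acts in $L_2(\mathbb{R}_+)$ by $L_0y=l(y)$ on the domain $\mathscr{D}_0$. "$L_0$ has extensions with compact resolvents" means that there is a linear operator $L$ in $L_2(\mathbb{R}_+)$ extending $L_0$ with non-empty resolvent set and with $(L-\lambda)^{-1}$ compact for $\lambda$ in the resolvent set. $L_0$ is semi-bounded if there is $z_0\in\mathbb{R}$ such that $(L_0y,y)\in[z_0,+\infty)$ for all $y\in\mathscr{D}_0$,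 $\|y\|=1$. *)

theory Defs
  imports "HOL-Analysis.Analysis"
begin

section \<open>The complex Hilbert space of square-integrable functions on the half-line\<close>

abbreviation half_line :: "real measure" where
  "half_line \<equiv> lebesgue_on {0..}"

definition square_integrable :: "(real \<Rightarrow> complex) \<Rightarrow> bool" where
  "square_integrable f \<longleftrightarrow>
     f \<in> borel_measurable half_line \<and> integrable half_line (\<lambda>x. (cmod (f x))\<^sup>2)"

lemma square_integrable_measurable [measurable_dest]:
  "square_integrable f \<Longrightarrow> f \<in> borel_measurable half_line"
  by (simp add: square_integrable_def)

lemma square_integrable_mult_cnj:
  assumes "square_integrable f" "square_integrable g"
  shows "integrable half_line (\<lambda>x. f x * cnj (g x))"
proof (rule Bochner_Integration.integrable_bound)
  show "integrable half_line (\<lambda>x. (cmod (f x))\<^sup>2 + (cmod (g x))\<^sup>2)"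
    using assms by (simp add: square_integrable_def)
  have [measurable]: "cnj \<in> borel_measurable borel"
    by (intro borel_measurable_continuous_onI continuous_intros)
  have [measurable]: "f \<in> borel_measurable half_line" "g \<in> borel_measurable half_line"
    using assms by (auto simp: square_integrable_def)
  show "(\<lambda>x. f x * cnj (g x)) \<in> borel_measurable half_line"
    by measurable
  have "cmod (f x) * cmod (g x) \<le> (cmod (f x))\<^sup>2 + (cmod (g x))\<^sup>2" for x
    using sum_squares_bound[of "cmod (f x)" "cmod (g x)"]
      mult_nonneg_nonneg[OF norm_ge_zero[of "f x"] norm_ge_zero[of "g x"]]
    by linarith
  then show "AE x in half_line.
      norm (f x * cnj (g x)) \<le> norm ((cmod (f x))\<^sup>2 + (cmod (g x))\<^sup>2)"
    by (auto simp: norm_mult)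
qed

lemma square_integrable_zero: "square_integrable (\<lambda>x. 0)"
  by (simp add: square_integrable_def)

lemma square_integrable_add:
  assumes "square_integrable f" "square_integrable g"
  shows "square_integrable (\<lambda>x. f x + g x)"
proof -
  have [measurable]: "f \<in> borel_measurable half_line" "g \<in> borel_measurable half_line"
    using assms by (auto simp: square_integrable_def)
  have "integrable half_line (\<lambda>x. (cmod (f x + g x))\<^sup>2)"
  proof (rule Bochner_Integration.integrable_bound)
    show "integrable half_line (\<lambda>x. 2 * (cmod (f x))\<^sup>2 + 2 * (cmod (g x))\<^sup>2)"
      using assms by (simp add: square_integrable_def)
    have "(cmod (f x + g x))\<^sup>2 \<le> 2 * (cmod (f x))\<^sup>2 + 2 * (cmod (g x))\<^sup>2" for x
    proof -
      have "(cmod (f x + g x))\<^sup>2 \<le> (cmod (f x) + cmod (g x))\<^sup>2"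
        by (simp add: norm_triangle_ineq power_mono)
      also have "\<dots> \<le> 2 * (cmod (f x))\<^sup>2 + 2 * (cmod (g x))\<^sup>2"
        using sum_squares_bound[of "cmod (f x)" "cmod (g x)"] by (simp add: power2_sum)
      finally show ?thesis .
    qed
    then show "AE x in half_line. norm ((cmod (f x + g x))\<^sup>2)
        \<le> norm (2 * (cmod (f x))\<^sup>2 + 2 * (cmod (g x))\<^sup>2)"
      by auto
  qed measurable
  then show ?thesis
    by (simp add: square_integrable_def)
qed

lemma square_integrable_cmult:
  assumes "square_integrable f"
  shows "square_integrable (\<lambda>x. c * f x)"
  using assms by (auto simp: square_integrable_def norm_mult power_mult_distrib)

quotient_type ltwo = "real \<Rightarrow> complex" / partial:
  "\<lambda>f g. square_integrable f \<and> square_integrable g \<and> (AE x in half_line. f x = g x)"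
proof (rule part_equivpI)
  show "\<exists>f. square_integrable f \<and> square_integrable f \<and> (AE x in half_line. f x = f x)"
    using square_integrable_zero by auto
  show "symp (\<lambda>f g. square_integrable f \<and> square_integrable g \<and> (AE x in half_line. f x = g x))"
    by (rule sympI) (auto elim: eventually_mono)
  show "transp (\<lambda>f g. square_integrable f \<and> square_integrable g \<and> (AE x in half_line. f x = g x))"
  proof (rule transpI, intro conjI; (elim conjE)?)
    fix f g h :: "real \<Rightarrow> complex"
    assume "AE x in half_line. f x = g x" "AE x in half_line. g x = h x"
    then show "AE x in half_line. f x = h x"
      by eventually_elim simp
  qed
qed

instantiation ltwo :: real_vector
begin

lift_definition zero_ltwo :: ltwo is "\<lambda>x. 0"
  by (simp add: square_integrable_zero)

lift_definition plus_ltwo :: "ltwo \<Rightarrow> ltwo \<Rightarrow> ltwo" is "\<lambda>f g x. f x + g x"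
  by (auto intro: square_integrable_add elim: eventually_elim2)

lift_definition uminus_ltwo :: "ltwo \<Rightarrow> ltwo" is "\<lambda>f x. - f x"
  using square_integrable_cmult[where c = "-1"] by (auto elim: eventually_mono)

definition minus_ltwo :: "ltwo \<Rightarrow> ltwo \<Rightarrow> ltwo" where
  "minus_ltwo f g = f + (- g)"

lift_definition scaleR_ltwo :: "real \<Rightarrow> ltwo \<Rightarrow> ltwo" is "\<lambda>r f x. of_real r * f x"
  by (auto intro: square_integrable_cmult elim: eventually_mono)

instance
proof
  fix a b :: real and f g h :: ltwo
  show "f + g + h = f + (g + h)"
    by transfer (auto intro!: square_integrable_add simp: add.assoc)
  show "f + g = g + f"
    by transfer (auto intro!: square_integrable_add simp: add.commute)
  show "0 + f = f"
    by transfer auto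
  show "- f + f = 0"
    by transfer (auto simp: square_integrable_zero)
  show "f - g = f + - g"
    by (simp add: minus_ltwo_def)
  show "a *\<^sub>R (f + g) = a *\<^sub>R f + a *\<^sub>R g"
    by transfer (auto intro!: square_integrable_add square_integrable_cmult
        simp: distrib_left)
  show "(a + b) *\<^sub>R f = a *\<^sub>R f + b *\<^sub>R f"
    by transfer (auto intro!: square_integrable_add square_integrable_cmult
        simp: distrib_right)
  show "a *\<^sub>R b *\<^sub>R f = (a * b) *\<^sub>R f"
    by transfer (use square_integrable_cmult in \<open>auto simp: mult.assoc\<close>)
  show "1 *\<^sub>R f = f"
    by transfer auto
qed

end

lift_definition cscale :: "complex \<Rightarrow> ltwo \<Rightarrow> ltwo" (infixr \<open>*\<^sub>c\<close> 75) is "\<lambda>c f x. c * f x"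
  by (auto intro: square_integrable_cmult elim: eventually_mono)

lift_definition cinner :: "ltwo \<Rightarrow> ltwo \<Rightarrow> complex" is
  "\<lambda>f g. \<integral>x. f x * cnj (g x) \<partial>half_line"
proof (elim conjE)
  fix f f' g g' :: "real \<Rightarrow> complex"
  assume *: "square_integrable f" "square_integrable f'" "square_integrable g"
    "square_integrable g'"
    "AE x in half_line. f x = f' x" "AE x in half_line. g x = g' x"
  then show "(\<integral>x. f x * cnj (g x) \<partial>half_line) = (\<integral>x. f' x * cnj (g' x) \<partial>half_line)"
    by (intro integral_cong_AE borel_measurable_integrable square_integrable_mult_cnj)
      (auto elim: eventually_elim2)
qed

lemma cinner_commute: "cinner f g = cnj (cinner g f)"
  by transfer (simp add: mult.commute flip: Bochner_Integration.integral_cnj)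

lemma cinner_add_left: "cinner (f + g) h = cinner f h + cinner g h"
  by transfer (simp add: distrib_right square_integrable_mult_cnj)

lemma cinner_scale_left: "cinner (c *\<^sub>c f) g = c * cinner f g"
  by transfer (simp add: mult.assoc)

lemma scaleR_eq_cscale: "r *\<^sub>R f = of_real r *\<^sub>c f" for f :: ltwo
  by transfer (simp add: square_integrable_cmult)

lemma cinner_self_nonneg: "0 \<le> Re (cinner f f)"
proof transfer
  fix f assume f: "square_integrable f \<and> square_integrable f \<and> (AE x in half_line. f x = f x)"
  have "Re (\<integral>x. f x * cnj (f x) \<partial>half_line) = (\<integral>x. Re (f x * cnj (f x)) \<partial>half_line)"
    by (intro integral_Re[symmetric] square_integrable_mult_cnj) (use f in auto)
  also have "\<dots> = (\<integral>x. (cmod (f x))\<^sup>2 \<partial>half_line)"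
    by (simp add: complex_mult_cnj cmod_power2)
  finally show "0 \<le> Re (\<integral>x. f x * cnj (f x) \<partial>half_line)"
    by simp
qed

lemma cinner_self_eq_0_iff: "Re (cinner f f) = 0 \<longleftrightarrow> f = 0"
proof transfer
  fix f assume f: "square_integrable f \<and> square_integrable f \<and> (AE x in half_line. f x = f x)"
  have "Re (\<integral>x. f x * cnj (f x) \<partial>half_line) = (\<integral>x. Re (f x * cnj (f x)) \<partial>half_line)"
    by (intro integral_Re[symmetric] square_integrable_mult_cnj) (use f in auto)
  also have "\<dots> = (\<integral>x. (cmod (f x))\<^sup>2 \<partial>half_line)"
    by (simp add: complex_mult_cnj cmod_power2)
  finally have "Re (\<integral>x. f x * cnj (f x) \<partial>half_line) = 0 \<longleftrightarrow> (AE x in half_line. (cmod (f x))\<^sup>2 = 0)"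
    using f integral_nonneg_eq_0_iff_AE[of half_line "\<lambda>x. (cmod (f x))\<^sup>2"]
    by (simp add: square_integrable_def)
  then show "Re (\<integral>x. f x * cnj (f x) \<partial>half_line) = 0 \<longleftrightarrow>
      square_integrable f \<and> square_integrable (\<lambda>x. 0) \<and> (AE x in half_line. f x = 0)"
    using f by (simp add: square_integrable_zero)
qed

instantiation ltwo :: real_inner
begin

definition inner_ltwo :: "ltwo \<Rightarrow> ltwo \<Rightarrow> real" where
  "inner_ltwo f g = Re (cinner f g)"

definition norm_ltwo :: "ltwo \<Rightarrow> real" where
  "norm_ltwo f = sqrt (inner f f)"

definition dist_ltwo :: "ltwo \<Rightarrow> ltwo \<Rightarrow> real" where
  "dist_ltwo f g = norm (f - g)"

definition sgn_ltwo :: "ltwo \<Rightarrow> ltwo" where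
  "sgn_ltwo f = f /\<^sub>R norm f"

definition uniformity_ltwo :: "(ltwo \<times> ltwo) filter" where
  "uniformity_ltwo = (INF e\<in>{0<..}. principal {(f, g). dist f g < e})"

definition open_ltwo :: "ltwo set \<Rightarrow> bool" where
  "open_ltwo U \<longleftrightarrow> (\<forall>f\<in>U. \<forall>\<^sub>F (f', g) in uniformity. f' = f \<longrightarrow> g \<in> U)"

instance
proof
  fix r :: real and f g h :: ltwo
  show "inner f g = inner g f"
    using cinner_commute[of f g] by (simp add: inner_ltwo_def)
  show "inner (f + g) h = inner f h + inner g h"
    by (simp add: inner_ltwo_def cinner_add_left)
  show "inner (r *\<^sub>R f) g = r * inner f g"
    by (simp add: inner_ltwo_def scaleR_eq_cscale cinner_scale_left)
  show "0 \<le> inner f f"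
    by (simp add: inner_ltwo_def cinner_self_nonneg)
  show "inner f f = 0 \<longleftrightarrow> f = 0"
    by (simp add: inner_ltwo_def cinner_self_eq_0_iff)
qed (simp_all add: norm_ltwo_def dist_ltwo_def sgn_ltwo_def uniformity_ltwo_def open_ltwo_def)

end

section \<open>Unbounded linear operators\<close>

text \<open>An operator is identified with its graph, so that an extension is a superset.\<close>

definition linear_operator :: "(ltwo \<times> ltwo) set \<Rightarrow> bool" where
  "linear_operator L \<longleftrightarrow> single_valued L \<and> (0, 0) \<in> L \<and>
     (\<forall>f g f' g'. (f, g) \<in> L \<longrightarrow> (f', g') \<in> L \<longrightarrow> (f + f', g + g') \<in> L) \<and>
     (\<forall>c f g. (f, g) \<in> L \<longrightarrow> (c *\<^sub>c f, c *\<^sub>c g) \<in> L)"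

text \<open>The equation \<open>(L - z) f = h\<close> reads \<open>(f, h + z f) \<in> L\<close>.\<close>

definition resolvent :: "(ltwo \<times> ltwo) set \<Rightarrow> complex \<Rightarrow> ltwo \<Rightarrow> ltwo" where
  "resolvent L z h = (THE f. (f, h + z *\<^sub>c f) \<in> L)"

definition resolvent_set :: "(ltwo \<times> ltwo) set \<Rightarrow> complex set" where
  "resolvent_set L =
     {z. (\<forall>h. \<exists>!f. (f, h + z *\<^sub>c f) \<in> L) \<and> bounded_linear (resolvent L z)}"

definition compact_operator :: "(ltwo \<Rightarrow> ltwo) \<Rightarrow> bool" where
  "compact_operator T \<longleftrightarrow>
     bounded_linear T \<and> (\<forall>B. bounded B \<longrightarrow> compact (closure (T ` B)))"

definition has_extension_with_compact_resolvent :: "(ltwo \<times> ltwo) set \<Rightarrow> bool" where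
  "has_extension_with_compact_resolvent L0 \<longleftrightarrow>
     (\<exists>L. linear_operator L \<and> L0 \<subseteq> L \<and> resolvent_set L \<noteq> {} \<and>
        (\<forall>z\<in>resolvent_set L. compact_operator (resolvent L z)))"

text \<open>The quadratic form is complex-valued a priori; its being real is part of the definition.\<close>

definition semi_bounded :: "(ltwo \<times> ltwo) set \<Rightarrow> bool" where
  "semi_bounded L0 \<longleftrightarrow>
     (\<exists>z0::real. \<forall>(f, g)\<in>L0. norm f = 1 \<longrightarrow> cinner g f \<in> complex_of_real ` {z0..})"

section \<open>The minimal operator\<close>

definition L2_loc :: "(real \<Rightarrow> real) set" where
  "L2_loc = {s. \<forall>R>0. s \<in> borel_measurable (lebesgue_on {0..R}) \<and>
                     integrable (lebesgue_on {0..R}) (\<lambda>x. (s x)\<^sup>2)}"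

text \<open>In the following definition, \<open>D\<close> ranges over the finite families of non-overlapping
  compact intervals in \<open>I\<close>.\<close>

definition absolutely_continuous_on :: "real set \<Rightarrow> (real \<Rightarrow> complex) \<Rightarrow> bool" where
  "absolutely_continuous_on I f \<longleftrightarrow>
     (\<forall>\<epsilon>>0. \<exists>\<delta>>0. \<forall>D. D division_of \<Union>D \<and> \<Union>D \<subseteq> I \<and> (\<Sum>K\<in>D. Sup K - Inf K) < \<delta> \<longrightarrow>
        (\<Sum>K\<in>D. cmod (f (Sup K) - f (Inf K))) < \<epsilon>)"

definition AC_loc :: "(real \<Rightarrow> complex) set" where
  "AC_loc = {f. \<forall>R>0. absolutely_continuous_on {0..R} f}"

text \<open>\<open>y' - s y\<close> is defined almost everywhere only; that it lies in \<open>AC_loc\<close> means that it has a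
  representative \<open>u\<close> there. This \<open>u\<close> is unique on the half-line, being continuous.\<close>

definition is_quasi_derivative ::
    "(real \<Rightarrow> real) \<Rightarrow> (real \<Rightarrow> complex) \<Rightarrow> (real \<Rightarrow> complex) \<Rightarrow> bool" where
  "is_quasi_derivative s y u \<longleftrightarrow> y \<in> AC_loc \<and> u \<in> AC_loc \<and>
     (AE x in half_line. y differentiable (at x) \<and>
        u x = vector_derivative y (at x) - of_real (s x) * y x)"

text \<open>\<open>g\<close> is a representative of \<open>l(y)\<close>, where \<open>u\<close> is the quasi-derivative of \<open>y\<close>.\<close>

definition is_quasi_expression :: "(real \<Rightarrow> real) \<Rightarrow> (real \<Rightarrow> complex) \<Rightarrow> (real \<Rightarrow> complex) \<Rightarrow>
    (real \<Rightarrow> complex) \<Rightarrow> bool" where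
  "is_quasi_expression s y u g \<longleftrightarrow> is_quasi_derivative s y u \<and>
     (AE x in half_line. u differentiable (at x) \<and>
        g x = - vector_derivative u (at x) - of_real (s x) * u x - of_real ((s x)\<^sup>2) * y x)"

text \<open>Here \<^term>\<open>abs_ltwo\<close> is the quotient map sending a square-integrable function to its class.\<close>

definition minimal_operator :: "(real \<Rightarrow> real) \<Rightarrow> (ltwo \<times> ltwo) set" where
  "minimal_operator s = {(abs_ltwo y, abs_ltwo g) | y u g.
     is_quasi_expression s y u g \<and> square_integrable y \<and> square_integrable g \<and>
     y 0 = 0 \<and> u 0 = 0 \<and> compact (closure {x. 0 \<le> x \<and> y x \<noteq> 0})}"

end

theory Submission
  imports Defs "HOL-Complex_Analysis.Great_Picard"
begin

text \<open>
  The examples are multiples of a single function \<open>s\<close>. Let \<open>Z\<close> be the bounded zigzag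
  \<open>Z x = arccos (cos ((x + 1)\<^sup>3))\<close>. Its slope \<open>r\<close> jumps between \<open>3 (x + 1)\<^sup>2\<close> and its
  negative, so that \<open>r\<^sup>2 = 9 (x + 1)\<^sup>4\<close> tends to infinity although \<open>r\<close> has a bounded primitive.
  Put \<open>s = r + \<integral> r\<^sup>2\<close>, so that formally \<open>s' = r' + r\<^sup>2\<close>. The potential \<open>t s'\<close> is
  \<open>(t r)' + (t r)\<^sup>2 + t (1 - t) r\<^sup>2\<close>, and completing the square gives, for \<open>y\<close> in the domain of
  the minimal operator \<open>L\<^sub>0\<close> of \<open>t s\<close>,
  \<open>(L\<^sub>0 y, y) = \<integral> \<bar>y' - t r y\<bar>\<^sup>2 + t (1 - t) \<integral> r\<^sup>2 \<bar>y\<bar>\<^sup>2\<close>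
  (\<open>energy_identity\<close>). The coefficient \<open>t (1 - t)\<close> changes sign at \<open>t = 1\<close>, and there are three
  regimes.

  For \<open>0 < t < 1\<close> the form is positive and controls \<open>\<integral> \<bar>y'\<bar>\<^sup>2\<close> and \<open>\<integral> (x + 1)\<^sup>4 \<bar>y\<bar>\<^sup>2\<close>.
  Form-bounded sets are therefore equicontinuous, decay like \<open>1 / (x + 1)\<close>, and are relatively
  compact in \<open>L\<^sub>2\<close> (\<open>form_bounded_sequence_compact\<close>). Hence the Friedrichs extension, built by
  minimising the energy, has compact resolvent (\<open>compact_extension_less_1\<close>).

  For \<open>t \<ge> 1\<close> one tests with \<open>y = exp (t Z) b(\<Psi>)\<close>, where \<open>\<Psi>' = exp (- 2 t Z)\<close> and \<open>b\<close> is a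
  smooth bump. Then \<open>y' - t r y = exp (- t Z) b'(\<Psi>)\<close>: the large slope \<open>r\<close> disappears from the
  first integral, and as \<open>Z\<close> is bounded this integral stays bounded when the bump is translated
  to infinity. If \<open>t = 1\<close>, the form is still nonnegative, but the translates are orthogonal, bounded away from zero and have bounded
  images under \<open>L\<^sub>0\<close>, so that no extension has compact resolvent
  (\<open>no_compact_extension_eq_1\<close>). If \<open>t > 1\<close>, the second integral drives the energy of the
  translates to minus infinity (\<open>not_semi_bounded_gt_1\<close>).

  The theorem takes \<open>\<epsilon> = 1\<close>, \<open>s\<^sub>1 = 3/4 s\<close> and \<open>s\<^sub>2 = 1/2 s\<close>: doubling moves \<open>t\<close> from \<open>3/4\<close> to
  \<open>3/2\<close> and from \<open>1/2\<close> to \<open>1\<close>.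
\<close>

section \<open>Extending a coercive symmetric operator\<close>

lemma cinner_add_right: "cinner f (g + h) = cinner f g + cinner f h"
  by (metis cinner_add_left cinner_commute complex_cnj_add)

lemma cinner_scale_right: "cinner f (c *\<^sub>c g) = cnj c * cinner f g"
  by (metis cinner_commute cinner_scale_left complex_cnj_mult)

lemma norm_cscale: "norm (c *\<^sub>c f) = cmod c * norm f"
proof -
  have "cinner (c *\<^sub>c f) (c *\<^sub>c f) = of_real ((cmod c)\<^sup>2) * cinner f f"
    by (simp only: cinner_scale_left cinner_scale_right complex_norm_square mult_ac)
  then show ?thesis
    by (simp add: norm_ltwo_def inner_ltwo_def real_sqrt_mult)
qed

lemma cscale_add_right: "c *\<^sub>c (f + g) = c *\<^sub>c f + c *\<^sub>c g"
  by transfer (auto intro!: square_integrable_add square_integrable_cmult simp: distrib_left)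

lemma cscale_minus_right: "c *\<^sub>c (f - g) = c *\<^sub>c f - c *\<^sub>c g"
  by (metis add_diff_cancel cscale_add_right diff_add_cancel)

lemma cscale_zero: "0 *\<^sub>c f = 0"
  using scaleR_eq_cscale[of 0 f] by simp

lemma cscale_cscale: "a *\<^sub>c b *\<^sub>c f = (a * b) *\<^sub>c f"
  by transfer (auto intro!: square_integrable_cmult simp: mult.assoc)

lemma cscale_one: "1 *\<^sub>c f = f"
  using scaleR_eq_cscale[of 1 f] by simp

lemma inner_cscale_left: "inner (c *\<^sub>c f) g = inner f (cnj c *\<^sub>c g)"
  by (simp add: inner_ltwo_def cinner_scale_left cinner_scale_right)

lemma bounded_linear_cscale: "bounded_linear (cscale c)"
  by (rule bounded_linear_intro[where K = "cmod c"])
    (auto simp: cscale_add_right norm_cscale scaleR_eq_cscale cscale_cscale mult.commute)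

lemma quadratic_nonneg_imp_discriminant:
  fixes p q d :: real
  assumes "\<And>t. 0 \<le> t\<^sup>2 * q + 2 * t * p + d" "0 \<le> q" "0 \<le> d"
  shows "p\<^sup>2 \<le> d * q"
proof (cases "q = 0")
  case True
  have "p = 0"
  proof (rule ccontr)
    assume "p \<noteq> 0"
    then show False
      using assms(1)[of "- (d + 1) / (2 * p)"] assms(3) True by (simp add: field_simps)
  qed
  then show ?thesis
    using True by simp
next
  case False
  then have "q > 0"
    using assms(2) by simp
  then show ?thesis
    using assms(1)[of "- p / q"] by (simp add: field_simps power2_eq_square)
qed

text \<open>A pair \<open>(f, h)\<close> belongs to the extension if \<open>f\<close> is a limit of elements of the domain that
  solve \<open>L\<^sub>0 y = h\<close> approximately: the inequality says that the residual \<open>g n - h\<close> tends to zero in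
  the norm dual to the form norm. This describes the Friedrichs extension without completing the
  domain in the form norm.\<close>

definition friedrichs_extension :: "(ltwo \<times> ltwo) set \<Rightarrow> (ltwo \<times> ltwo) set" where
  "friedrichs_extension G =
     {(f, h). \<exists>y g d. (\<forall>n::nat. (y n, g n) \<in> G) \<and> y \<longlonglongrightarrow> f \<and> d \<longlonglongrightarrow> 0 \<and>
        (\<forall>n v k. (v, k) \<in> G \<longrightarrow> (inner (g n - h) v)\<^sup>2 \<le> d n * inner k v)}"

lemma friedrichs_extensionI:
  assumes "\<And>n::nat. (y n, g n) \<in> G" "y \<longlonglongrightarrow> f" "d \<longlonglongrightarrow> 0"
    and "\<And>n v k. (v, k) \<in> G \<Longrightarrow> (inner (g n - h) v)\<^sup>2 \<le> d n * inner k v"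
  shows "(f, h) \<in> friedrichs_extension G"
  unfolding friedrichs_extension_def mem_Collect_eq case_prod_conv
  by (intro exI[of _ y] exI[of _ g] exI[of _ d] conjI allI impI assms)

text \<open>The graph \<open>G\<close> of a densely defined operator with real form bounded below by \<open>c\<close>. The
  compactness hypothesis serves twice: it produces the limits that completeness would
  otherwise provide, and it makes the resolvent compact.\<close>

locale coercive_operator =
  fixes G :: "(ltwo \<times> ltwo) set" and c :: real
  assumes zero: "(0, 0) \<in> G"
    and add: "(f, g) \<in> G \<Longrightarrow> (f', g') \<in> G \<Longrightarrow> (f + f', g + g') \<in> G"
    and scale: "(f, g) \<in> G \<Longrightarrow> (a *\<^sub>c f, a *\<^sub>c g) \<in> G"
    and form_real: "(f, g) \<in> G \<Longrightarrow> Im (cinner g f) = 0"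
    and c_pos: "c > 0"
    and coercive: "(f, g) \<in> G \<Longrightarrow> c * (norm f)\<^sup>2 \<le> inner g f"
    and form_compact: "\<lbrakk>\<And>n::nat. (ys n, gs n) \<in> G; \<And>n. inner (gs n) (ys n) \<le> C\<rbrakk>
      \<Longrightarrow> \<exists>k l. strict_mono k \<and> (\<lambda>n::nat. ys (k n)) \<longlonglongrightarrow> l"
    and dense: "(\<And>v k. (v, k) \<in> G \<Longrightarrow> inner h v = 0) \<Longrightarrow> h = 0"
begin

abbreviation "L \<equiv> friedrichs_extension G"

lemma scaleR: "(f, g) \<in> G \<Longrightarrow> (r *\<^sub>R f, r *\<^sub>R g) \<in> G"
  using scale by (simp add: scaleR_eq_cscale)

lemma form_nonneg: "(f, g) \<in> G \<Longrightarrow> 0 \<le> inner g f"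
  using coercive[of f g] c_pos by (meson mult_nonneg_nonneg order_trans less_imp_le zero_le_power2)

text \<open>Polarization: a sesquilinear form with real diagonal is Hermitian.\<close>

lemma form_sym:
  assumes "(f, g) \<in> G" "(v, k) \<in> G"
  shows "inner g v = inner k f"
proof -
  have "(\<i> *\<^sub>c f + v, \<i> *\<^sub>c g + k) \<in> G"
    using assms add scale by blast
  from form_real[OF this] form_real[OF assms(1)] form_real[OF assms(2)]
  show ?thesis
    by (simp add: cinner_add_left cinner_add_right cinner_scale_left cinner_scale_right inner_ltwo_def)
qed

text \<open>Testing the residual against the approximate solution itself bounds its energy.\<close>

lemma form_upper_bound:
  assumes "(y, g) \<in> G" "(inner (g - h) y)\<^sup>2 \<le> d * inner g y"
  shows "inner g y \<le> 2 * norm h * norm y + \<bar>d\<bar>"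
proof -
  let ?q = "inner g y"
  have q: "0 \<le> ?q"
    using form_nonneg assms by blast
  have "(inner (g - h) y)\<^sup>2 \<le> \<bar>d\<bar> * ?q"
    by (rule order_trans[OF assms(2)]) (intro mult_right_mono q abs_ge_self)
  also have "\<dots> \<le> ((\<bar>d\<bar> + ?q) / 2)\<^sup>2"
    using sum_squares_bound[of "\<bar>d\<bar>" ?q] by (simp add: power_divide power2_sum)
  finally have "inner (g - h) y \<le> (\<bar>d\<bar> + ?q) / 2"
    by (rule power2_le_imp_le) (simp add: q)
  moreover have "inner h y \<le> norm h * norm y"
    by (rule norm_cauchy_schwarz)
  ultimately show ?thesis
    by (simp add: inner_diff_left)
qed

lemma extension_bound:
  assumes "(f, h) \<in> L"
  shows "norm f \<le> 2 / c * norm h"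
proof -
  obtain y g d where G: "\<And>n. (y n, g n) \<in> G" and y: "y \<longlonglongrightarrow> f" and d: "d \<longlonglongrightarrow> 0"
    and app: "\<And>n v k. (v, k) \<in> G \<Longrightarrow> (inner (g n - h) v)\<^sup>2 \<le> d n * inner k v"
    using assms by (auto simp: friedrichs_extension_def)
  have "c * (norm (y n))\<^sup>2 \<le> 2 * norm h * norm (y n) + \<bar>d n\<bar>" for n
    using coercive[OF G, of n] form_upper_bound[OF G app[OF G], of n] by linarith
  moreover have "(\<lambda>n. c * (norm (y n))\<^sup>2) \<longlonglongrightarrow> c * (norm f)\<^sup>2"
    by (intro tendsto_intros y)
  moreover have "(\<lambda>n. 2 * norm h * norm (y n) + \<bar>d n\<bar>) \<longlonglongrightarrow> 2 * norm h * norm f + \<bar>0\<bar>"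
    by (intro tendsto_intros y d)
  ultimately have "c * (norm f)\<^sup>2 \<le> 2 * norm h * norm f + \<bar>0\<bar>"
    by (meson LIMSEQ_le)
  then have "norm f * (c * norm f - 2 * norm h) \<le> 0"
    by (simp add: power2_eq_square algebra_simps)
  then have "norm f = 0 \<or> c * norm f \<le> 2 * norm h"
    by (auto simp: mult_le_0_iff)
  then show ?thesis
    using c_pos by (auto simp: field_simps)
qed

text \<open>In the limit an approximate solution is a weak solution. Together with density this makes the
  extension single-valued.\<close>

lemma extension_weak:
  assumes "(f, h) \<in> L" "(v, k) \<in> G"
  shows "inner h v = inner f k"
proof -
  obtain y g d where G: "\<And>n. (y n, g n) \<in> G" and y: "y \<longlonglongrightarrow> f" and d: "d \<longlonglongrightarrow> 0"
    and app: "\<And>n v k. (v, k) \<in> G \<Longrightarrow> (inner (g n - h) v)\<^sup>2 \<le> d n * inner k v"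
    using assms by (auto simp: friedrichs_extension_def)
  have "(\<lambda>n. (inner (g n - h) v)\<^sup>2) \<longlonglongrightarrow> 0"
  proof (rule tendsto_sandwich[of "\<lambda>_. 0"])
    show "(\<lambda>n. d n * inner k v) \<longlonglongrightarrow> 0"
      using tendsto_mult_right[OF d, of "inner k v"] by simp
  qed (use app[OF assms(2)] in \<open>auto intro!: always_eventually\<close>)
  then have "(\<lambda>n. inner (g n - h) v) \<longlonglongrightarrow> 0"
    by simp
  moreover have "inner (g n - h) v = inner (y n) k - inner h v" for n
    using form_sym[OF G assms(2), of n] by (simp add: inner_diff_left inner_commute[of "y n"])
  ultimately have "(\<lambda>n. inner (y n) k - inner h v) \<longlonglongrightarrow> 0"
    by simp
  moreover have "(\<lambda>n. inner (y n) k - inner h v) \<longlonglongrightarrow> inner f k - inner h v"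
    by (intro tendsto_intros y)
  ultimately show ?thesis
    using LIMSEQ_unique by fastforce
qed

lemma extension_add:
  assumes "(f, h) \<in> L" "(f', h') \<in> L"
  shows "(f + f', h + h') \<in> L"
proof -
  obtain y g d where 1: "\<And>n. (y n, g n) \<in> G" "y \<longlonglongrightarrow> f" "d \<longlonglongrightarrow> 0"
    "\<And>n v k. (v, k) \<in> G \<Longrightarrow> (inner (g n - h) v)\<^sup>2 \<le> d n * inner k v"
    using assms(1) by (auto simp: friedrichs_extension_def)
  obtain y' g' d' where 2: "\<And>n. (y' n, g' n) \<in> G" "y' \<longlonglongrightarrow> f'" "d' \<longlonglongrightarrow> 0"
    "\<And>n v k. (v, k) \<in> G \<Longrightarrow> (inner (g' n - h') v)\<^sup>2 \<le> d' n * inner k v"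
    using assms(2) by (auto simp: friedrichs_extension_def)
  have "(inner (g n + g' n - (h + h')) v)\<^sup>2 \<le> (2 * d n + 2 * d' n) * inner k v"
    if "(v, k) \<in> G" for n v k
  proof -
    have "(inner (g n + g' n - (h + h')) v)\<^sup>2 = (inner (g n - h) v + inner (g' n - h') v)\<^sup>2"
      by (simp add: inner_diff_left inner_add_left algebra_simps)
    also have "\<dots> \<le> 2 * (inner (g n - h) v)\<^sup>2 + 2 * (inner (g' n - h') v)\<^sup>2"
      using sum_squares_bound[of "inner (g n - h) v" "inner (g' n - h') v"]
      by (simp add: power2_sum)
    also have "\<dots> \<le> 2 * (d n * inner k v) + 2 * (d' n * inner k v)"
      using 1(4)[OF that, of n] 2(4)[OF that, of n] by simp
    finally show ?thesis
      by (simp add: algebra_simps)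
  qed
  note bound = this
  show ?thesis
  proof (rule friedrichs_extensionI[OF add[OF 1(1) 2(1)] _ _ bound])
    show "(\<lambda>n. y n + y' n) \<longlonglongrightarrow> f + f'"
      by (intro tendsto_intros 1 2)
    have "(\<lambda>n. 2 * d n + 2 * d' n) \<longlonglongrightarrow> 2 * 0 + 2 * 0"
      by (intro tendsto_intros 1 2)
    then show "(\<lambda>n. 2 * d n + 2 * d' n) \<longlonglongrightarrow> 0"
      by simp
  qed
qed

lemma extension_scale:
  assumes "(f, h) \<in> L"
  shows "(a *\<^sub>c f, a *\<^sub>c h) \<in> L"
proof -
  obtain y g d where 1: "\<And>n. (y n, g n) \<in> G" "y \<longlonglongrightarrow> f" "d \<longlonglongrightarrow> 0"
    "\<And>n v k. (v, k) \<in> G \<Longrightarrow> (inner (g n - h) v)\<^sup>2 \<le> d n * inner k v"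
    using assms by (auto simp: friedrichs_extension_def)
  have "(inner (a *\<^sub>c g n - a *\<^sub>c h) v)\<^sup>2 \<le> ((cmod a)\<^sup>2 * d n) * inner k v" if "(v, k) \<in> G" for n v k
  proof -
    have "(inner (a *\<^sub>c g n - a *\<^sub>c h) v)\<^sup>2 = (inner (g n - h) (cnj a *\<^sub>c v))\<^sup>2"
      by (simp only: cscale_minus_right[symmetric] inner_cscale_left)
    also have "\<dots> \<le> d n * inner (cnj a *\<^sub>c k) (cnj a *\<^sub>c v)"
      using 1(4)[OF scale[OF that]] .
    also have "inner (cnj a *\<^sub>c k) (cnj a *\<^sub>c v) = (cmod a)\<^sup>2 * inner k v"
    proof -
      have "cinner (cnj a *\<^sub>c k) (cnj a *\<^sub>c v) = of_real ((cmod a)\<^sup>2) * cinner k v"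
        by (simp only: cinner_scale_left cinner_scale_right complex_norm_square mult_ac complex_cnj_cnj)
      then show ?thesis
        by (simp add: inner_ltwo_def)
    qed
    finally show ?thesis
      by (simp add: mult_ac)
  qed
  note bound = this
  show ?thesis
  proof (rule friedrichs_extensionI[OF scale[OF 1(1)] _ _ bound])
    show "(\<lambda>n. a *\<^sub>c y n) \<longlonglongrightarrow> a *\<^sub>c f"
      by (rule bounded_linear.tendsto[OF bounded_linear_cscale 1(2)])
    show "(\<lambda>n. (cmod a)\<^sup>2 * d n) \<longlonglongrightarrow> 0"
      using tendsto_mult_left[OF 1(3), of "(cmod a)\<^sup>2"] by simp
  qed
qed

lemma extension_diff: "(f, h) \<in> L \<Longrightarrow> (f', h') \<in> L \<Longrightarrow> (f - f', h - h') \<in> L"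
  using extension_add[of f h "- f'" "- h'"] extension_scale[of f' h' "-1"]
    scaleR_eq_cscale[of "-1" f'] scaleR_eq_cscale[of "-1" h'] by simp

lemma extension_extends: "G \<subseteq> L"
proof safe
  fix f g assume "(f, g) \<in> G"
  then show "(f, g) \<in> L"
    by (rule friedrichs_extensionI[where d = "\<lambda>n. 0"]) simp_all
qed

lemma extension_linear_operator: "linear_operator L"
proof -
  have "h = h'" if "(f, h) \<in> L" "(f, h') \<in> L" for f h h'
  proof -
    have "(0, h - h') \<in> L"
      using extension_diff[OF that] by simp
    then have "h - h' = 0"
      by (intro dense) (use extension_weak in fastforce)
    then show ?thesis
      by simp
  qed
  then show ?thesis
    unfolding linear_operator_def single_valued_def
  proof (intro conjI allI impI)
    show "(0, 0) \<in> L"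
      using extension_extends zero by blast
  qed (auto intro: extension_add extension_scale)
qed

lemma extension_inj: "(f, h) \<in> L \<Longrightarrow> (f', h) \<in> L \<Longrightarrow> f = f'"
  using extension_bound[OF extension_diff, of f h f' h] by simp

text \<open>The solution is found by minimising \<open>J y = (L\<^sub>0 y, y) - 2 Re (h, y)\<close>. If \<open>y\<close> is minimal up to
  \<open>\<delta>\<close>, then \<open>t\<^sup>2 (L\<^sub>0 v, v) + 2 t Re (L\<^sub>0 y - h, v) + \<delta>\<close> is nonnegative for all real \<open>t\<close>, and its
  discriminant is exactly the residual estimate that defines the extension. A minimising sequence
  is form-bounded, so compactness provides its limit.\<close>

lemma extension_surj: "\<exists>f. (f, h) \<in> L"
proof -
  define J where "J = (\<lambda>(y, g). inner g y - 2 * inner h y)"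
  have J_ge: "c / 2 * (norm y)\<^sup>2 - 2 / c * (norm h)\<^sup>2 \<le> J (y, g)" if "(y, g) \<in> G" for y g
  proof -
    have "0 \<le> (c * norm y - 2 * norm h)\<^sup>2 / (2 * c)"
      using c_pos by simp
    also have "\<dots> = c / 2 * (norm y)\<^sup>2 + 2 / c * (norm h)\<^sup>2 - 2 * (norm h * norm y)"
      using c_pos by (simp add: power2_eq_square field_simps)
    finally have "2 * (norm h * norm y) \<le> c / 2 * (norm y)\<^sup>2 + 2 / c * (norm h)\<^sup>2"
      by simp
    then show ?thesis
      using coercive[OF that] norm_cauchy_schwarz[of h y] by (simp add: J_def)
  qed
  have bdd: "bdd_below (J ` G)"
  proof (rule bdd_belowI2)
    fix p assume "p \<in> G"
    moreover have "0 \<le> c / 2 * (norm (fst p))\<^sup>2"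
      using c_pos by simp
    ultimately show "- (2 / c * (norm h)\<^sup>2) \<le> J p"
      using J_ge[of "fst p" "snd p"] by simp
  qed
  define m where "m = Inf (J ` G)"
  have m: "m \<le> J p" if "p \<in> G" for p
    unfolding m_def by (rule cINF_lower[OF bdd that])
  have "\<exists>p\<in>G. J p < m + inverse (real (Suc n))" for n
    using cInf_lessD[of "J ` G" "m + inverse (real (Suc n))"] zero by (auto simp: m_def)
  then obtain p where p: "\<And>n. p n \<in> G" "\<And>n. J (p n) < m + inverse (real (Suc n))"
    by metis
  define y g where "y = fst \<circ> p" and "g = snd \<circ> p"
  have G: "(y n, g n) \<in> G" and Jn: "J (y n, g n) < m + inverse (real (Suc n))" for n
    using p[of n] by (auto simp: y_def g_def)
  have app: "(inner (g n - h) v)\<^sup>2 \<le> inverse (real (Suc n)) * inner k v" if "(v, k) \<in> G" for n v k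
  proof (rule quadratic_nonneg_imp_discriminant)
    fix t :: real
    have "m \<le> J (y n + t *\<^sub>R v, g n + t *\<^sub>R k)"
      by (intro m add G scaleR that)
    also have "\<dots> = J (y n, g n) + 2 * t * inner (g n - h) v + t\<^sup>2 * inner k v"
      using form_sym[OF G that, of n]
      by (simp add: J_def inner_add_left inner_add_right inner_diff_left algebra_simps power2_eq_square)
    finally show "0 \<le> t\<^sup>2 * inner k v + 2 * t * inner (g n - h) v + inverse (real (Suc n))"
      using Jn[of n] by linarith
  qed (use form_nonneg[OF that] in auto)
  define B where "B = 2 / c * (m + 1 + 2 / c * (norm h)\<^sup>2)"
  have J1: "J (y n, g n) \<le> m + 1" for n
  proof -
    have "inverse (real (Suc n)) \<le> 1"
      by (simp add: inverse_le_1_iff)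
    then show ?thesis
      using Jn[of n] by linarith
  qed
  have "c / 2 * (norm (y n))\<^sup>2 \<le> m + 1 + 2 / c * (norm h)\<^sup>2" for n
    using J1[of n] J_ge[OF G, of n] by linarith
  then have yB: "(norm (y n))\<^sup>2 \<le> B" for n
    unfolding B_def using c_pos by (simp add: field_simps)
  have "inner (g n) (y n) \<le> m + 1 + 2 * norm h * sqrt B" for n
  proof -
    have "norm (y n) \<le> sqrt B"
      using real_le_rsqrt[OF yB] .
    then have "inner h (y n) \<le> norm h * sqrt B"
      using norm_cauchy_schwarz[of h "y n"] mult_left_mono[of "norm (y n)" "sqrt B" "norm h"] by simp
    then show ?thesis
      using J1[of n] by (simp add: J_def)
  qed
  then obtain k f where k: "strict_mono k" "(\<lambda>n. y (k n)) \<longlonglongrightarrow> f"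
    using form_compact[of y g, OF G] by blast
  have "(\<lambda>n. inverse (real (Suc (k n)))) \<longlonglongrightarrow> 0"
    using LIMSEQ_subseq_LIMSEQ[OF LIMSEQ_inverse_real_of_nat k(1)] by (simp add: o_def)
  then have "(f, h) \<in> L"
    by (rule friedrichs_extensionI[OF G k(2) _ app])
  then show ?thesis ..
qed

lemma resolvent_0: "(resolvent L 0 h, h) \<in> L" and resolvent_0_eqI: "(f, h) \<in> L \<Longrightarrow> resolvent L 0 h = f"
proof -
  have "\<exists>!f. (f, h) \<in> L"
    using extension_surj extension_inj by blast
  then show "(resolvent L 0 h, h) \<in> L"
    unfolding resolvent_def by (simp add: cscale_zero) (rule theI')
  then show "resolvent L 0 h = f" if "(f, h) \<in> L"
    using extension_inj that by blast
qed

lemma bounded_linear_resolvent_0: "bounded_linear (resolvent L 0)"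
proof (rule bounded_linear_intro)
  show "resolvent L 0 (h + h') = resolvent L 0 h + resolvent L 0 h'" for h h'
    by (intro resolvent_0_eqI extension_add resolvent_0)
  show "resolvent L 0 (r *\<^sub>R h) = r *\<^sub>R resolvent L 0 h" for r h
    using extension_scale[OF resolvent_0] by (intro resolvent_0_eqI) (simp add: scaleR_eq_cscale)
  show "norm (resolvent L 0 h) \<le> norm h * (2 / c)" for h
    using extension_bound[OF resolvent_0, of h] by (simp add: mult.commute)
qed

lemma zero_in_resolvent_set: "0 \<in> resolvent_set L"
  using bounded_linear_resolvent_0 extension_surj extension_inj
  unfolding resolvent_set_def by (auto simp: cscale_zero)

lemma compact_closure_form_ball: "compact (closure {y. \<exists>g. (y, g) \<in> G \<and> inner g y \<le> C})"
  (is "compact (closure ?S)")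
  unfolding compact_def
proof (intro allI impI)
  fix x :: "nat \<Rightarrow> ltwo" assume x: "\<forall>n. x n \<in> closure ?S"
  have "\<exists>y g. (y, g) \<in> G \<and> inner g y \<le> C \<and> dist y (x n) < inverse (real (Suc n))" for n
  proof -
    have "x n \<in> closure ?S" "0 < inverse (real (Suc n))"
      using x by simp_all
    then show ?thesis
      unfolding closure_approachable by blast
  qed
  then obtain y g where y: "\<And>n. (y n, g n) \<in> G" "\<And>n. inner (g n) (y n) \<le> C"
      "\<And>n. dist (y n) (x n) < inverse (real (Suc n))"
    by metis
  then obtain k f where k: "strict_mono k" "(\<lambda>n. y (k n)) \<longlonglongrightarrow> f"
    using form_compact[of y g C, OF y(1,2)] by blast
  have "(\<lambda>n. y n - x n) \<longlonglongrightarrow> 0"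
    using y(3) by (intro Lim_null_comparison[OF _ LIMSEQ_inverse_real_of_nat] always_eventually)
      (auto simp: dist_norm intro: less_imp_le)
  then have "(\<lambda>n. y (k n) - x (k n)) \<longlonglongrightarrow> 0"
    using LIMSEQ_subseq_LIMSEQ[OF _ k(1), of "\<lambda>n. y n - x n" 0] by (simp add: o_def)
  from tendsto_diff[OF k(2) this] have lim: "(x \<circ> k) \<longlonglongrightarrow> f"
    by (simp add: o_def)
  moreover have "f \<in> closure ?S"
    by (rule closed_sequentially[OF closed_closure _ lim]) (use x in simp)
  ultimately show "\<exists>l\<in>closure ?S. \<exists>r. strict_mono r \<and> (x \<circ> r) \<longlonglongrightarrow> l"
    using k(1) by blast
qed

text \<open>Solutions for right-hand sides in a ball are limits of domain elements in a fixed form ball.\<close>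

lemma compact_operator_resolvent_0: "compact_operator (resolvent L 0)"
  unfolding compact_operator_def
proof (intro conjI allI impI bounded_linear_resolvent_0)
  fix B :: "ltwo set" assume "bounded B"
  then obtain M where M: "\<And>h. h \<in> B \<Longrightarrow> norm h \<le> M"
    by (auto simp: bounded_iff)
  \<comment> \<open>The summand 1 leaves room for norms that exceed their limit slightly.\<close>
  define N where "N = 2 / c * M + 1"
  define S where "S = {y. \<exists>g. (y, g) \<in> G \<and> inner g y \<le> 2 * M * N + 1}"
  have "resolvent L 0 h \<in> closure S" if "h \<in> B" for h
  proof -
    let ?f = "resolvent L 0 h"
    obtain y g d where G: "\<And>n. (y n, g n) \<in> G" and y: "y \<longlonglongrightarrow> ?f" and d: "d \<longlonglongrightarrow> 0"
      and app: "\<And>n v k. (v, k) \<in> G \<Longrightarrow> (inner (g n - h) v)\<^sup>2 \<le> d n * inner k v"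
      using resolvent_0[of h] by (auto simp: friedrichs_extension_def)
    have M0: "0 \<le> M"
      using M[OF that] norm_ge_zero order_trans by blast
    have "norm ?f < N"
      using extension_bound[OF resolvent_0, of h] mult_left_mono[OF M[OF that], of "2 / c"] c_pos
      by (simp add: N_def)
    then have "eventually (\<lambda>n. norm (y n) < N) sequentially"
      using order_tendstoD(2)[OF tendsto_norm[OF y]] by blast
    moreover have "eventually (\<lambda>n. \<bar>d n\<bar> < 1) sequentially"
      using order_tendstoD(2)[OF tendsto_rabs[OF d], of 1] by simp
    ultimately have "eventually (\<lambda>n. y n \<in> S) sequentially"
    proof eventually_elim
      case (elim n)
      have "norm h * norm (y n) \<le> M * N"
        using elim M[OF that] M0 by (intro mult_mono) auto
      then have "inner (g n) (y n) \<le> 2 * M * N + 1"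
        using form_upper_bound[OF G app[OF G], of n] elim by linarith
      then show ?case
        using G unfolding S_def by blast
    qed
    moreover from this have "eventually (\<lambda>n. y n \<in> closure S) sequentially"
      by (rule eventually_mono) (use closure_subset in auto)
    ultimately show ?thesis
      using Lim_in_closed_set[OF closed_closure _ _ y] by simp
  qed
  then have "closure (resolvent L 0 ` B) \<subseteq> closure S"
    by (intro closure_minimal) auto
  moreover have "compact (closure S \<inter> closure (resolvent L 0 ` B))"
    using compact_closure_form_ball[of "2 * M * N + 1"] unfolding S_def by (rule compact_Int_closed) simp
  ultimately show "compact (closure (resolvent L 0 ` B))"
    by (simp add: inf_absorb2)
qed

text \<open>By the resolvent identity, every other resolvent is \<open>resolvent L 0\<close> composed with a
  bounded operator.\<close>

theorem has_extension: "has_extension_with_compact_resolvent G"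
  unfolding has_extension_with_compact_resolvent_def
proof (intro exI[of _ L] conjI ballI extension_linear_operator extension_extends)
  show "resolvent_set L \<noteq> {}"
    using zero_in_resolvent_set by blast
  fix z assume z: "z \<in> resolvent_set L"
  let ?R = "resolvent L z"
  have bl: "bounded_linear ?R"
    using z by (simp add: resolvent_set_def)
  have "\<exists>!f. (f, h + z *\<^sub>c f) \<in> L" for h
    using z by (simp add: resolvent_set_def)
  then have R: "(?R h, h + z *\<^sub>c ?R h) \<in> L" for h
    unfolding resolvent_def by (rule theI')
  have R_eq: "?R h = resolvent L 0 (h + z *\<^sub>c ?R h)" for h
    using resolvent_0_eqI[OF R] by simp
  show "compact_operator ?R"
    unfolding compact_operator_def
  proof (intro conjI allI impI bl)
    fix B :: "ltwo set" assume B: "bounded B"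
    let ?S = "\<lambda>h. h + z *\<^sub>c ?R h"
    have "bounded_linear ?S"
      by (intro bounded_linear_add bounded_linear_ident
          bounded_linear_compose[OF bounded_linear_cscale bl])
    then have "bounded (?S ` B)"
      using B bounded_linear_image by blast
    moreover have "?R ` B = resolvent L 0 ` ?S ` B"
      unfolding image_image using R_eq by (intro image_cong) auto
    ultimately show "compact (closure (?R ` B))"
      using compact_operator_resolvent_0 by (simp add: compact_operator_def)
  qed
qed

end

text \<open>For any extension \<open>L\<close> and \<open>z\<close> in its resolvent set, \<open>y n\<close> is the image under the resolvent
  of \<open>g n - z y n\<close>. A bounded sequence with separated images contradicts compactness.\<close>

lemma no_extension_with_compact_resolvent:
  assumes G: "\<And>n::nat. (y n, g n) \<in> G"
    and bdd: "\<And>n. norm (y n) \<le> M" "\<And>n. norm (g n) \<le> M"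
    and sep: "\<And>m n. m \<noteq> n \<Longrightarrow> \<delta> \<le> dist (y m) (y n)" "\<delta> > 0"
  shows "\<not> has_extension_with_compact_resolvent G"
proof
  assume "has_extension_with_compact_resolvent G"
  then obtain L z where L: "G \<subseteq> L" "z \<in> resolvent_set L" "compact_operator (resolvent L z)"
    unfolding has_extension_with_compact_resolvent_def by blast
  define h where "h n = g n - z *\<^sub>c y n" for n
  have "resolvent L z (h n) = y n" for n
  proof -
    have "\<exists>!f. (f, h n + z *\<^sub>c f) \<in> L"
      using L(2) by (simp add: resolvent_set_def)
    moreover have "(y n, h n + z *\<^sub>c y n) \<in> L"
      using G L(1) by (auto simp: h_def)
    ultimately show ?thesis
      unfolding resolvent_def by (rule the1_equality)
  qed
  then have y: "y n \<in> resolvent L z ` range h" for n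
    by (intro image_eqI[of _ _ "h n"]) simp_all
  have "norm (h n) \<le> M + cmod z * M" for n
    using norm_triangle_ineq4[of "g n" "z *\<^sub>c y n"] bdd(2)[of n]
      mult_left_mono[OF bdd(1), of "cmod z" n] by (simp add: h_def norm_cscale)
  then have "bounded (range h)"
    by (auto simp: bounded_iff)
  then have "compact (closure (resolvent L z ` range h))"
    using L(3) by (simp add: compact_operator_def)
  moreover have "\<forall>n. y n \<in> closure (resolvent L z ` range h)"
    using y closure_subset by blast
  ultimately obtain l k where k: "strict_mono (k :: nat \<Rightarrow> nat)" "(y \<circ> k) \<longlonglongrightarrow> l"
    unfolding compact_def by metis
  then have "Cauchy (y \<circ> k)"
    using LIMSEQ_imp_Cauchy by blast
  then obtain N where "\<And>m n. m \<ge> N \<Longrightarrow> n \<ge> N \<Longrightarrow> dist ((y \<circ> k) m) ((y \<circ> k) n) < \<delta>"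
    using sep(2) metric_CauchyD by blast
  from this[of N "Suc N"] sep(1)[of "k N" "k (Suc N)"] show False
    using strict_mono_eq[OF k(1), of N "Suc N"] by auto
qed

section \<open>Absolutely continuous functions\<close>

lemma division_subinterval:
  fixes D :: "real set set"
  assumes "D division_of \<Union>D" "\<Union>D \<subseteq> {a..b}" "K \<in> D"
  obtains c d where "K = {c..d}" "a \<le> c" "c \<le> d" "d \<le> b" "Inf K = c" "Sup K = d"
proof -
  obtain c d where K: "K = cbox c d" "K \<noteq> {}"
    using assms division_ofD(3,4) by metis
  then have cd: "c \<le> d"
    by simp
  have "{c..d} \<subseteq> {a..b}"
    using assms K by (metis Union_upper box_real(2) order_trans)
  then show ?thesis
    using that[of c d] K cd by simp
qed

lemma absolutely_continuous_onE:
  assumes "absolutely_continuous_on I f" "\<epsilon> > 0"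
  obtains \<delta> where "\<delta> > 0" "\<And>D. D division_of \<Union>D \<Longrightarrow> \<Union>D \<subseteq> I \<Longrightarrow>
      (\<Sum>K\<in>D. Sup K - Inf K) < \<delta> \<Longrightarrow> (\<Sum>K\<in>D. cmod (f (Sup K) - f (Inf K))) < \<epsilon>"
proof -
  have "\<exists>\<delta>>0. \<forall>D. D division_of \<Union>D \<and> \<Union>D \<subseteq> I \<and> (\<Sum>K\<in>D. Sup K - Inf K) < \<delta> \<longrightarrow>
      (\<Sum>K\<in>D. cmod (f (Sup K) - f (Inf K))) < \<epsilon>"
    using assms unfolding absolutely_continuous_on_def by simp
  then obtain \<delta> where "\<delta> > 0" and \<delta>: "\<forall>D. D division_of \<Union>D \<and> \<Union>D \<subseteq> I \<and>
      (\<Sum>K\<in>D. Sup K - Inf K) < \<delta> \<longrightarrow> (\<Sum>K\<in>D. cmod (f (Sup K) - f (Inf K))) < \<epsilon>"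
    by (elim exE conjE)
  show thesis
    by (rule that[OF \<open>\<delta> > 0\<close>]) (simp add: \<delta>)
qed

text \<open>The increments of sums, products and conjugates are all controlled by increments of their
  arguments, so a single comparison principle gives every closure property of absolute continuity.\<close>

lemma absolutely_continuous_on_dominated:
  fixes f g h :: "real \<Rightarrow> complex"
  assumes f: "absolutely_continuous_on {a..b} f" and g: "absolutely_continuous_on {a..b} g"
    and h: "\<And>c d. a \<le> c \<Longrightarrow> c \<le> d \<Longrightarrow> d \<le> b \<Longrightarrow>
      cmod (h d - h c) \<le> M * (cmod (f d - f c) + cmod (g d - g c) + (d - c))"
  shows "absolutely_continuous_on {a..b} h"
  unfolding absolutely_continuous_on_def
proof (intro allI impI)
  fix \<epsilon> :: real assume "\<epsilon> > 0"
  define \<eta> where "\<eta> = \<epsilon> / (3 * (\<bar>M\<bar> + 1))"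
  have \<eta>: "\<eta> > 0"
    using \<open>\<epsilon> > 0\<close> by (simp add: \<eta>_def)
  obtain d1 where d1: "d1 > 0" "\<And>D. D division_of \<Union>D \<Longrightarrow> \<Union>D \<subseteq> {a..b} \<Longrightarrow> (\<Sum>K\<in>D. Sup K - Inf K) < d1 \<Longrightarrow>
      (\<Sum>K\<in>D. cmod (f (Sup K) - f (Inf K))) < \<eta>"
    by (rule absolutely_continuous_onE[OF f \<eta>]) (rule that, assumption, blast)
  obtain d2 where d2: "d2 > 0" "\<And>D. D division_of \<Union>D \<Longrightarrow> \<Union>D \<subseteq> {a..b} \<Longrightarrow> (\<Sum>K\<in>D. Sup K - Inf K) < d2 \<Longrightarrow>
      (\<Sum>K\<in>D. cmod (g (Sup K) - g (Inf K))) < \<eta>"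
    by (rule absolutely_continuous_onE[OF g \<eta>]) (rule that, assumption, blast)
  show "\<exists>\<delta>>0. \<forall>D. D division_of \<Union>D \<and> \<Union>D \<subseteq> {a..b} \<and> (\<Sum>K\<in>D. Sup K - Inf K) < \<delta> \<longrightarrow>
        (\<Sum>K\<in>D. cmod (h (Sup K) - h (Inf K))) < \<epsilon>"
  proof (intro exI[of _ "min (min d1 d2) \<eta>"] conjI allI impI; (elim conjE)?)
    fix D assume D: "D division_of \<Union>D" "\<Union>D \<subseteq> {a..b}" "(\<Sum>K\<in>D. Sup K - Inf K) < min (min d1 d2) \<eta>"
    let ?S = "(\<Sum>K\<in>D. cmod (f (Sup K) - f (Inf K))) + (\<Sum>K\<in>D. cmod (g (Sup K) - g (Inf K)))
      + (\<Sum>K\<in>D. Sup K - Inf K)"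
    have "(\<Sum>K\<in>D. cmod (h (Sup K) - h (Inf K)))
        \<le> (\<Sum>K\<in>D. \<bar>M\<bar> * (cmod (f (Sup K) - f (Inf K)) + cmod (g (Sup K) - g (Inf K)) + (Sup K - Inf K)))"
    proof (rule sum_mono)
      fix K assume "K \<in> D"
      then obtain c d where cd: "a \<le> c" "c \<le> d" "d \<le> b" "Inf K = c" "Sup K = d"
        using division_subinterval[OF D(1,2)] by metis
      have "cmod (h d - h c) \<le> M * (cmod (f d - f c) + cmod (g d - g c) + (d - c))"
        using h cd by blast
      also have "\<dots> \<le> \<bar>M\<bar> * (cmod (f d - f c) + cmod (g d - g c) + (d - c))"
        using cd by (intro mult_right_mono) auto
      finally show "cmod (h (Sup K) - h (Inf K))
          \<le> \<bar>M\<bar> * (cmod (f (Sup K) - f (Inf K)) + cmod (g (Sup K) - g (Inf K)) + (Sup K - Inf K))"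
        using cd by simp
    qed
    also have "\<dots> = \<bar>M\<bar> * ?S"
      by (simp only: sum.distrib flip: sum_distrib_left)
    also have "\<dots> \<le> \<bar>M\<bar> * (3 * \<eta>)"
      using d1(2)[OF D(1,2)] d2(2)[OF D(1,2)] D(3) by (intro mult_left_mono) auto
    also have "\<dots> < \<epsilon>"
      using \<open>\<epsilon> > 0\<close> by (simp add: \<eta>_def field_simps)
    finally show "(\<Sum>K\<in>D. cmod (h (Sup K) - h (Inf K))) < \<epsilon>" .
  qed (use d1 d2 \<eta> in auto)
qed

lemma absolutely_continuous_on_const: "absolutely_continuous_on I (\<lambda>x. c)"
  by (auto simp: absolutely_continuous_on_def intro: exI[of _ 1])

lemma lipschitz_imp_absolutely_continuous_on:
  fixes f :: "real \<Rightarrow> complex"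
  assumes "\<And>c d. a \<le> c \<Longrightarrow> c \<le> d \<Longrightarrow> d \<le> b \<Longrightarrow> cmod (f d - f c) \<le> M * (d - c)"
  shows "absolutely_continuous_on {a..b} f"
  by (rule absolutely_continuous_on_dominated[where f = "\<lambda>_. 0" and g = "\<lambda>_. 0" and M = M])
    (use assms in \<open>auto intro: absolutely_continuous_on_const\<close>)

lemma absolutely_continuous_on_imp_continuous_on:
  assumes "absolutely_continuous_on {a..b} f"
  shows "continuous_on {a..b} f"
  unfolding continuous_on_iff
proof (intro ballI allI impI)
  fix x e :: real assume x: "x \<in> {a..b}" and "e > 0"
  obtain d where d: "d > 0" "\<And>D. D division_of \<Union>D \<Longrightarrow> \<Union>D \<subseteq> {a..b} \<Longrightarrow> (\<Sum>K\<in>D. Sup K - Inf K) < d \<Longrightarrow>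
      (\<Sum>K\<in>D. cmod (f (Sup K) - f (Inf K))) < e"
    by (rule absolutely_continuous_onE[OF assms \<open>e > 0\<close>]) (rule that, assumption, blast)
  show "\<exists>d>0. \<forall>x'\<in>{a..b}. dist x' x < d \<longrightarrow> dist (f x') (f x) < e"
  proof (intro exI[of _ d] conjI ballI impI d(1))
    fix x' assume x': "x' \<in> {a..b}" "dist x' x < d"
    let ?K = "{min x x'..max x x'}"
    have "{?K} division_of \<Union>{?K}"
      using division_of_self[of "min x x'" "max x x'"] by simp
    moreover have "\<Union>{?K} \<subseteq> {a..b}"
      using x x' by auto
    moreover have "(\<Sum>K\<in>{?K}. Sup K - Inf K) < d"
      using x' by (auto simp: dist_real_def)
    ultimately have "(\<Sum>K\<in>{?K}. cmod (f (Sup K) - f (Inf K))) < e"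
      using d(2) by blast
    then show "dist (f x') (f x) < e"
      by (auto simp: dist_norm norm_minus_commute min_def max_def split: if_splits)
  qed
qed

lemma absolutely_continuous_on_add:
  assumes "absolutely_continuous_on {a..b} f" "absolutely_continuous_on {a..b} g"
  shows "absolutely_continuous_on {a..b} (\<lambda>x. f x + g x)"
proof (rule absolutely_continuous_on_dominated[OF assms, of _ 1])
  fix c d :: real assume "c \<le> d"
  then show "cmod (f d + g d - (f c + g c)) \<le> 1 * (cmod (f d - f c) + cmod (g d - g c) + (d - c))"
    using norm_triangle_ineq[of "f d - f c" "g d - g c"] by (simp add: algebra_simps)
qed

lemma absolutely_continuous_on_mult:
  assumes f: "absolutely_continuous_on {a..b} f" and g: "absolutely_continuous_on {a..b} g"
  shows "absolutely_continuous_on {a..b} (\<lambda>x. f x * g x)"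
proof -
  have "bounded (f ` {a..b})" "bounded (g ` {a..b})"
    using f g by (auto intro!: compact_imp_bounded compact_continuous_image
        absolutely_continuous_on_imp_continuous_on)
  then obtain A B where A: "\<And>x. x \<in> {a..b} \<Longrightarrow> cmod (f x) \<le> A" and B: "\<And>x. x \<in> {a..b} \<Longrightarrow> cmod (g x) \<le> B"
    by (force simp: bounded_iff)
  show ?thesis
  proof (rule absolutely_continuous_on_dominated[OF f g, of _ "\<bar>A\<bar> + \<bar>B\<bar>"])
    fix c d :: real assume cd: "a \<le> c" "c \<le> d" "d \<le> b"
    have "f d * g d - f c * g c = f d * (g d - g c) + g c * (f d - f c)"
      by (simp add: algebra_simps)
    also have "cmod \<dots> \<le> cmod (f d) * cmod (g d - g c) + cmod (g c) * cmod (f d - f c)"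
      by (metis norm_mult norm_triangle_ineq)
    also have "\<dots> \<le> (\<bar>A\<bar> + \<bar>B\<bar>) * cmod (g d - g c) + (\<bar>A\<bar> + \<bar>B\<bar>) * cmod (f d - f c)"
      using A[of d] B[of c] cd by (intro add_mono mult_right_mono) auto
    also have "\<dots> \<le> (\<bar>A\<bar> + \<bar>B\<bar>) * (cmod (f d - f c) + cmod (g d - g c) + (d - c))"
      using cd by (simp add: distrib_left)
    finally show "cmod (f d * g d - f c * g c)
        \<le> (\<bar>A\<bar> + \<bar>B\<bar>) * (cmod (f d - f c) + cmod (g d - g c) + (d - c))" .
  qed
qed

lemma absolutely_continuous_on_cnj:
  assumes "absolutely_continuous_on {a..b} f"
  shows "absolutely_continuous_on {a..b} (\<lambda>x. cnj (f x))"
proof (rule absolutely_continuous_on_dominated[OF assms assms, of _ 1])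
  fix c d :: real assume "c \<le> d"
  moreover have "cmod (cnj (f d) - cnj (f c)) = cmod (f d - f c)"
    by (metis complex_cnj_diff complex_mod_cnj)
  ultimately show "cmod (cnj (f d) - cnj (f c)) \<le> 1 * (cmod (f d - f c) + cmod (f d - f c) + (d - c))"
    by simp
qed

lemma absolutely_continuous_on_subset:
  "absolutely_continuous_on I f \<Longrightarrow> J \<subseteq> I \<Longrightarrow> absolutely_continuous_on J f"
  unfolding absolutely_continuous_on_def by (meson subset_trans)

lemma sum_content_division:
  fixes D :: "real set set"
  assumes D: "D division_of \<Union>D"
  shows "(\<Sum>K\<in>D. measure lborel K) = measure lebesgue (\<Union>D)"
proof -
  have "measure lebesgue (\<Union>D) = (\<Sum>K\<in>D. measure lebesgue K)"
  proof (rule measure_negligible_finite_Union)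
    show "finite D"
      using D by blast
    show "K \<in> lmeasurable" if "K \<in> D" for K
      using division_ofD(4)[OF D that] by auto
    show "pairwise (\<lambda>S T. negligible (S \<inter> T)) D"
    proof (rule pairwiseI)
      fix K L assume KL: "K \<in> D" "L \<in> D" "K \<noteq> L"
      then have "interior (K \<inter> L) = {}"
        using division_ofD(5)[OF D] by simp
      moreover have "convex (K \<inter> L)"
        using division_ofD(4)[OF D] KL by (metis convex_Int convex_box(1))
      ultimately show "negligible (K \<inter> L)"
        by (simp add: negligible_convex_interior)
    qed
  qed
  moreover have "measure lborel K = measure lebesgue K" if "K \<in> D" for K
    using division_ofD(4)[OF D that] by auto
  ultimately show ?thesis
    by simp
qed

text \<open>The gauge is the usual one at points of differentiability. At the tags in \<open>N\<close> it confines the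
  intervals to an open set of small measure, where absolute continuity makes the total increment
  of \<open>f\<close> small; there the integrand may be taken to be zero.\<close>

theorem absolutely_continuous_has_integral:
  fixes f :: "real \<Rightarrow> complex"
  assumes "a \<le> b" and ac: "absolutely_continuous_on {a..b} f" and N: "negligible N"
    and der: "\<And>x. x \<in> {a..b} - N \<Longrightarrow> (f has_vector_derivative f' x) (at x within {a..b})"
  shows "(f' has_integral (f b - f a)) {a..b}"
proof -
  define F where "F x = (if x \<in> N then 0 else f' x)" for x
  have "(F has_integral (f b - f a)) {a..b}"
    unfolding has_integral_real
  proof (intro allI impI)
    fix e :: real assume "e > 0"
    define l where "l = b - a + 1"
    define \<eta> where "\<eta> = e / (2 * l)"
    have "l > 0"
      using \<open>a \<le> b\<close> by (simp add: l_def)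
    then have "\<eta> * l = e / 2"
      by (simp add: \<eta>_def)
    then have "\<eta> * (b - a) + \<eta> = e / 2"
      by (simp add: l_def distrib_left)
    moreover have "\<eta> > 0"
      using \<open>e > 0\<close> \<open>l > 0\<close> by (simp add: \<eta>_def)
    ultimately have \<eta>: "\<eta> > 0" "\<eta> * (b - a) + \<eta> < e"
      using \<open>e > 0\<close> by linarith+
    obtain \<delta> where \<delta>: "\<delta> > 0" "\<And>D. D division_of \<Union>D \<Longrightarrow> \<Union>D \<subseteq> {a..b} \<Longrightarrow>
        (\<Sum>K\<in>D. Sup K - Inf K) < \<delta> \<Longrightarrow> (\<Sum>K\<in>D. cmod (f (Sup K) - f (Inf K))) < \<eta>"
      by (rule absolutely_continuous_onE[OF ac \<eta>(1)]) (rule that, assumption, blast)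
    \<comment> \<open>Outer regularity of Lebesgue measure.\<close>
    obtain U where U: "open U" "N \<subseteq> U" "U \<in> lmeasurable" "measure lebesgue U < \<delta>"
    proof -
      have "N \<in> sets lebesgue"
        using N by (simp add: negligible_imp_sets)
      then obtain U where U: "open U" "N \<subseteq> U" "(U - N) \<in> lmeasurable" "emeasure lebesgue (U - N) < ennreal \<delta>"
        by (rule sets_lebesgue_outer_open[OF _ \<delta>(1)])
      have "U = (U - N) \<union> N"
        using U(2) by blast
      then have lm: "U \<in> lmeasurable"
        using U(3) N by (metis fmeasurable.Un negligible_imp_measurable)
      have "measure lebesgue U = measure lebesgue (U - N)"
        using N lm by (simp add: measure_Diff_null_set negligible_iff_null_sets fmeasurableD)
      also have "\<dots> < \<delta>"
        using U(3,4) \<delta>(1) by (simp add: emeasure_eq_measure2 ennreal_less_iff)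
      finally show ?thesis
        using that U lm by blast
    qed
    have "\<exists>d>0. x \<in> {a..b} - N \<longrightarrow> (\<forall>y\<in>{a..b}. \<bar>y - x\<bar> < d \<longrightarrow>
        norm (f y - f x - (y - x) *\<^sub>R f' x) \<le> \<eta> * \<bar>y - x\<bar>)" for x
    proof (cases "x \<in> {a..b} - N")
      case True
      then show ?thesis
        using der[OF True] \<eta>(1) unfolding has_vector_derivative_def has_derivative_within_alt by auto
    qed (auto intro: exI[of _ 1])
    then obtain d where d: "\<And>x. d x > 0" "\<And>x y. x \<in> {a..b} - N \<Longrightarrow> y \<in> {a..b} \<Longrightarrow> \<bar>y - x\<bar> < d x \<Longrightarrow>
        norm (f y - f x - (y - x) *\<^sub>R f' x) \<le> \<eta> * \<bar>y - x\<bar>"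
      by metis
    define \<gamma> where "\<gamma> x = (if x \<in> N then U else ball x (d x))" for x
    have gauge: "gauge \<gamma>"
      using U d(1) by (auto simp: gauge_def \<gamma>_def)
    have main: "norm ((\<Sum>(x, K)\<in>p. measure lborel K *\<^sub>R F x) - (f b - f a)) < e"
      if p: "p tagged_division_of {a..b}" "\<gamma> fine p" for p
    proof -
      let ?T = "\<lambda>(x, K). measure lborel K *\<^sub>R F x - (f (Sup K) - f (Inf K))"
      define q where "q = {t \<in> p. fst t \<in> N}"
      have fin: "finite p"
        using p(1) by blast
      have sub: "\<exists>u v. K = {u..v} \<and> u \<le> x \<and> x \<le> v \<and> a \<le> u \<and> v \<le> b" if "(x, K) \<in> p" for x K
      proof -
        have "x \<in> K" "K \<subseteq> {a..b}" "\<exists>u v. K = cbox u v"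
          using tagged_division_ofD(2-4)[OF p(1) that] by auto
        then show ?thesis
          by (metis atLeastAtMost_iff atLeastatMost_subset_iff box_real(2) order_trans)
      qed
      have "(\<Sum>(x, K)\<in>p. measure lborel K *\<^sub>R F x) - (f b - f a) = (\<Sum>t\<in>p. ?T t)"
        using additive_tagged_division_1[OF \<open>a \<le> b\<close> p(1), of f]
        by (simp add: split_def sum_subtractf)
      also have "\<dots> = (\<Sum>t\<in>p - q. ?T t) + (\<Sum>t\<in>q. ?T t)"
        using fin by (intro sum.subset_diff) (auto simp: q_def)
      also have "norm \<dots> \<le> norm (\<Sum>t\<in>p - q. ?T t) + norm (\<Sum>t\<in>q. ?T t)"
        by (rule norm_triangle_ineq)
      also have "norm (\<Sum>t\<in>p - q. ?T t) \<le> \<eta> * (b - a)"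
      proof -
        have "norm (\<Sum>t\<in>p - q. ?T t) \<le> (\<Sum>t\<in>p - q. \<eta> * (case t of (x, K) \<Rightarrow> measure lborel K))"
        proof (rule sum_norm_le)
          fix t assume t: "t \<in> p - q"
          obtain x K where xK: "t = (x, K)"
            by force
          then have x: "(x, K) \<in> p" "x \<notin> N"
            using t by (auto simp: q_def)
          then obtain u v where uv: "K = {u..v}" "u \<le> x" "x \<le> v" "a \<le> u" "v \<le> b"
            using sub by blast
          have "K \<subseteq> ball x (d x)"
            using fineD[OF p(2) x(1)] x(2) by (simp add: \<gamma>_def)
          moreover have "u \<in> K" "v \<in> K"
            using uv by auto
          ultimately have "u \<in> ball x (d x)" "v \<in> ball x (d x)"
            by blast+
          then have uvx: "\<bar>u - x\<bar> < d x" "\<bar>v - x\<bar> < d x"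
            by (simp_all add: dist_real_def abs_minus_commute)
          have "norm (f u - f x - (u - x) *\<^sub>R f' x) \<le> \<eta> * (x - u)"
            "norm (f v - f x - (v - x) *\<^sub>R f' x) \<le> \<eta> * (v - x)"
            using d(2)[OF _ _ uvx(1)] d(2)[OF _ _ uvx(2)] uv x(2) by auto
          moreover have "?T t = (f u - f x - (u - x) *\<^sub>R f' x) - (f v - f x - (v - x) *\<^sub>R f' x)"
            using uv x(2) xK by (simp add: F_def algebra_simps)
          ultimately have "norm (?T t) \<le> \<eta> * (x - u) + \<eta> * (v - x)"
            using norm_triangle_ineq4[of "f u - f x - (u - x) *\<^sub>R f' x" "f v - f x - (v - x) *\<^sub>R f' x"]
            by simp
          then show "norm (?T t) \<le> \<eta> * (case t of (x, K) \<Rightarrow> measure lborel K)"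
            using uv xK by (simp add: algebra_simps)
        qed
        also have "\<dots> \<le> (\<Sum>t\<in>p. \<eta> * (case t of (x, K) \<Rightarrow> measure lborel K))"
          using fin \<eta>(1) by (intro sum_mono2) auto
        also have "\<dots> = \<eta> * (b - a)"
          using additive_content_tagged_division[of p a b] p(1) \<open>a \<le> b\<close>
          by (simp flip: sum_distrib_left)
        finally show ?thesis .
      qed
      also have "norm (\<Sum>t\<in>q. ?T t) < \<eta>"
      proof -
        let ?D = "snd ` q"
        have q: "q tagged_division_of \<Union>?D"
        proof (rule tagged_partial_division_of_Union_self)
          show "q tagged_partial_division_of {a..b}"
            using p(1) unfolding tagged_division_of_def
            by (rule tagged_partial_division_subset[OF conjunct1]) (simp add: q_def)
        qed
        have D: "?D division_of \<Union>?D"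
          by (rule division_of_tagged_division[OF q])
        have DK: "K \<subseteq> U" "K \<subseteq> {a..b}" if K: "K \<in> ?D" for K
        proof -
          obtain x where x: "(x, K) \<in> p" "x \<in> N"
            using K by (force simp: q_def)
          show "K \<subseteq> U"
            using fineD[OF p(2) x(1)] x(2) by (simp add: \<gamma>_def)
          show "K \<subseteq> {a..b}"
            by (rule tagged_division_ofD(3)[OF p(1) x(1)])
        qed
        then have D': "\<Union>?D \<subseteq> {a..b}"
          by blast
        have len: "Sup K - Inf K = measure lborel K" if "K \<in> ?D" for K
          by (rule division_subinterval[OF D D' that]) simp
        have "(\<Sum>K\<in>?D. Sup K - Inf K) = measure lebesgue (\<Union>?D)"
          using sum_content_division[OF D] len by simp
        also have "\<dots> \<le> measure lebesgue U"
        proof (rule measure_mono_fmeasurable[OF _ _ U(3)])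
          have "compact (\<Union>?D)"
            using division_ofD(1,4)[OF D] by (intro compact_Union) fastforce+
          then show "\<Union>?D \<in> sets lebesgue"
            by (simp add: fmeasurableD lmeasurable_compact)
        qed (use DK in blast)
        finally have "(\<Sum>K\<in>?D. Sup K - Inf K) < \<delta>"
          using U(4) by simp
        then have small: "(\<Sum>K\<in>?D. cmod (f (Sup K) - f (Inf K))) < \<eta>"
          by (rule \<delta>(2)[OF D D'])
        \<comment> \<open>\<open>Sup\<close> and \<open>Inf\<close> of the empty set are arbitrary, hence the case distinction.\<close>
        let ?n = "\<lambda>K. if K = {} then 0 else cmod (f (Sup K) - f (Inf K))"
        have "(x, {}) \<notin> p" for x
          using tagged_division_ofD(2)[OF p(1)] by blast
        then have "norm (\<Sum>t\<in>q. ?T t) \<le> (\<Sum>(x, K)\<in>q. ?n K)"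
          by (intro sum_norm_le) (auto simp: q_def F_def norm_minus_commute)
        also have "\<dots> = (\<Sum>K\<in>?D. ?n K)"
        proof (rule sum.over_tagged_division_lemma[OF q])
          fix u v :: real assume "box u v = {}"
          then show "?n (cbox u v) = 0"
            by (cases "u = v") auto
        qed
        also have "\<dots> = (\<Sum>K\<in>?D. cmod (f (Sup K) - f (Inf K)))"
          using division_ofD(3)[OF D] by (intro sum.cong) auto
        finally show ?thesis
          using small by simp
      qed
      finally show ?thesis
        using \<eta>(2) by simp
    qed
    show "\<exists>\<gamma>. gauge \<gamma> \<and> (\<forall>p. p tagged_division_of {a..b} \<and> \<gamma> fine p \<longrightarrow>
        norm ((\<Sum>(x, K)\<in>p. measure lborel K *\<^sub>R F x) - (f b - f a)) < e)"
      by (rule exI[of _ \<gamma>]) (simp add: gauge main)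
  qed
  then show ?thesis
    by (rule has_integral_spike[OF N, rotated]) (simp add: F_def)
qed

lemma AC_loc_absolutely_continuous_on:
  assumes "f \<in> AC_loc" "0 \<le> a"
  shows "absolutely_continuous_on {a..b} f"
proof (rule absolutely_continuous_on_subset)
  show "absolutely_continuous_on {0..max 1 b} f"
    using assms by (simp add: AC_loc_def)
qed (use assms in auto)

lemma AC_loc_continuous_on: "f \<in> AC_loc \<Longrightarrow> continuous_on {0..} f"
proof -
  assume f: "f \<in> AC_loc"
  have "continuous (at x within {0..}) f" if "x \<in> {0..}" for x
  proof -
    have "continuous_on {0..x + 1} f"
      using f by (intro absolutely_continuous_on_imp_continuous_on AC_loc_absolutely_continuous_on) auto
    then have "continuous (at x within {0..x + 1}) f"
      using that by (simp add: continuous_on_eq_continuous_within)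
    moreover have "at x within {0..x + 1} = at x within {0..}"
      using that by (intro at_within_nhd[of _ "{..<x + 1}"]) auto
    ultimately show ?thesis
      by (simp only:)
  qed
  then show ?thesis
    by (simp add: continuous_on_eq_continuous_within)
qed

lemma AC_loc_add: "f \<in> AC_loc \<Longrightarrow> g \<in> AC_loc \<Longrightarrow> (\<lambda>x. f x + g x) \<in> AC_loc"
  and AC_loc_mult: "f \<in> AC_loc \<Longrightarrow> g \<in> AC_loc \<Longrightarrow> (\<lambda>x. f x * g x) \<in> AC_loc"
  and AC_loc_cnj: "f \<in> AC_loc \<Longrightarrow> (\<lambda>x. cnj (f x)) \<in> AC_loc"
  and AC_loc_const: "(\<lambda>x. c) \<in> AC_loc"
  by (auto simp: AC_loc_def intro: absolutely_continuous_on_add absolutely_continuous_on_mult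
      absolutely_continuous_on_cnj absolutely_continuous_on_const)

text \<open>Off a locally finite set of kinks a locally bounded derivative suffices, as it makes the
  function locally Lipschitz.\<close>

lemma AC_locI:
  fixes f f' :: "real \<Rightarrow> complex"
  assumes cont: "continuous_on {0..} f"
    and fin: "\<And>R. finite (E \<inter> {0..R})"
    and der: "\<And>x. 0 < x \<Longrightarrow> x \<notin> E \<Longrightarrow> (f has_vector_derivative f' x) (at x)"
    and bound: "\<And>x. 0 \<le> x \<Longrightarrow> cmod (f' x) \<le> B x" and "mono_on {0..} B"
  shows "f \<in> AC_loc"
  unfolding AC_loc_def
proof (intro CollectI allI impI)
  fix R :: real assume "R > 0"
  show "absolutely_continuous_on {0..R} f"
  proof (rule lipschitz_imp_absolutely_continuous_on[where M = "B R"])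
    fix c d assume cd: "0 \<le> c" "c \<le> d" "d \<le> R"
    have "(f' has_integral (f d - f c)) {c..d}"
    proof (rule fundamental_theorem_of_calculus_interior_strong[of "E \<inter> {0..R}"])
      show "continuous_on {c..d} f"
        using cont cd by (auto intro: continuous_on_subset)
    qed (use fin der cd in auto)
    then have "norm (f d - f c) \<le> B R * measure lborel {c..d}"
    proof (rule has_integral_bound_real[rotated 2])
      show "0 \<le> B R"
        using bound[of R] norm_ge_zero[of "f' R"] \<open>R > 0\<close> by linarith
      show "\<And>x. x \<in> {c..d} - {} \<Longrightarrow> cmod (f' x) \<le> B R"
      proof -
        fix x assume "x \<in> {c..d} - {}"
        then have "cmod (f' x) \<le> B x" "B x \<le> B R"
          using bound[of x] mono_onD[OF \<open>mono_on {0..} B\<close>, of x R] cd by auto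
        then show "cmod (f' x) \<le> B R"
          by linarith
      qed
    qed simp
    then show "cmod (f d - f c) \<le> B R * (d - c)"
      using cd by simp
  qed
qed

section \<open>Square-integrable classes and integrals over the half-line\<close>

lemma cinner_abs_ltwo:
  assumes "square_integrable f" "square_integrable g"
  shows "cinner (abs_ltwo f) (abs_ltwo g) = (\<integral>x. f x * cnj (g x) \<partial>half_line)"
  using assms by (simp add: cinner.abs_eq)

lemma norm_abs_ltwo:
  assumes "square_integrable f"
  shows "(norm (abs_ltwo f))\<^sup>2 = (\<integral>x. (cmod (f x))\<^sup>2 \<partial>half_line)"
proof -
  have "(norm (abs_ltwo f))\<^sup>2 = Re (\<integral>x. f x * cnj (f x) \<partial>half_line)"
    using assms by (simp add: power2_norm_eq_inner inner_ltwo_def cinner_abs_ltwo)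
  also have "\<dots> = (\<integral>x. Re (f x * cnj (f x)) \<partial>half_line)"
    using assms by (intro integral_Re[symmetric] square_integrable_mult_cnj)
  finally show ?thesis
    by (simp add: complex_mult_cnj cmod_power2)
qed

lemma AE_half_line_negligibleE:
  assumes "AE x in half_line. P x"
  obtains N where "negligible N" "\<And>x. 0 \<le> x \<Longrightarrow> x \<notin> N \<Longrightarrow> P x"
proof -
  have "AE x in lebesgue. x \<in> {0..} \<longrightarrow> P x"
    using assms by (subst (asm) AE_restrict_space_iff) auto
  then obtain N where "N \<in> null_sets lebesgue" "{x \<in> space lebesgue. \<not> (x \<in> {0..} \<longrightarrow> P x)} \<subseteq> N"
    unfolding eventually_ae_filter by blast
  then show ?thesis
    using that[of N] by (auto simp: negligible_iff_null_sets)
qed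

lemma AE_half_lineI:
  assumes "negligible N" "\<And>x. 0 \<le> x \<Longrightarrow> x \<notin> N \<Longrightarrow> P x"
  shows "AE x in half_line. P x"
proof -
  have "AE x in lebesgue. x \<in> {0..} \<longrightarrow> P x"
    using assms by (intro AE_I'[of N]) (auto simp: negligible_iff_null_sets)
  then show ?thesis
    by (subst AE_restrict_space_iff) auto
qed

lemma AC_loc_has_integral:
  assumes "f \<in> AC_loc" "AE x in half_line. (f has_vector_derivative f' x) (at x)" "0 \<le> a" "a \<le> b"
  shows "(f' has_integral (f b - f a)) {a..b}"
proof -
  obtain N where N: "negligible N" "\<And>x. 0 \<le> x \<Longrightarrow> x \<notin> N \<Longrightarrow> (f has_vector_derivative f' x) (at x)"
    using assms(2) by (rule AE_half_line_negligibleE) (rule that, assumption, blast)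
  show ?thesis
    using N assms by (intro absolutely_continuous_has_integral[of _ _ _ N])
      (auto intro: AC_loc_absolutely_continuous_on has_vector_derivative_at_within)
qed

lemma has_integral_half_line:
  fixes f :: "real \<Rightarrow> 'b :: euclidean_space"
  assumes "integrable half_line f" "\<And>x. R \<le> x \<Longrightarrow> f x = 0" "0 \<le> R"
  shows "(f has_integral (\<integral>x. f x \<partial>half_line)) {0..R}"
proof -
  have "(f has_integral (\<integral>x. f x \<partial>half_line)) {0..}"
    using assms(1) by (rule has_integral_integral_lebesgue_on) auto
  then have "((\<lambda>x. if x \<in> {0..} then f x else 0) has_integral (\<integral>x. f x \<partial>half_line)) UNIV"
    by (simp only: has_integral_restrict_UNIV)
  also have "(\<lambda>x. if x \<in> {0..} then f x else 0) = (\<lambda>x. if x \<in> {0..R} then f x else 0)"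
    using assms(2) by (auto simp: fun_eq_iff)
  finally show ?thesis
    by (simp only: has_integral_restrict_UNIV)
qed

section \<open>The zigzag and its Riccati potential\<close>

definition kinks :: "real set" where
  "kinks = {x. sin ((x + 1) ^ 3) = 0}"

definition zigzag :: "real \<Rightarrow> real" where
  "zigzag x = arccos (cos ((x + 1) ^ 3))"

definition zigzag_slope :: "real \<Rightarrow> real" where
  "zigzag_slope x = (if 0 \<le> sin ((x + 1) ^ 3) then 1 else - 1) * (3 * (x + 1)\<^sup>2)"

text \<open>The last summand is a primitive of the square of the slope, so the distributional derivative of
  this function is \<open>r' + r\<^sup>2\<close> for \<open>r = zigzag_slope\<close>.\<close>

definition riccati_primitive :: "real \<Rightarrow> real" where
  "riccati_primitive x = zigzag_slope x + 9 / 5 * (x + 1) ^ 5"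

lemma zigzag_bounds: "0 \<le> zigzag x" "zigzag x \<le> pi"
  by (auto simp: zigzag_def intro: arccos_lbound arccos_ubound)

lemma continuous_on_zigzag: "continuous_on S zigzag"
  unfolding zigzag_def by (intro continuous_on_arccos' continuous_intros) auto

lemma zigzag_slope_squared: "(zigzag_slope x)\<^sup>2 = 9 * (x + 1) ^ 4"
  by (simp add: zigzag_slope_def power_mult_distrib flip: power_mult)

lemma zigzag_slope_measurable [measurable]: "zigzag_slope \<in> borel_measurable borel"
  unfolding zigzag_slope_def by measurable

lemma abs_zigzag_slope: "\<bar>zigzag_slope x\<bar> = 3 * (x + 1)\<^sup>2"
  by (simp add: zigzag_slope_def abs_mult)

lemma has_derivative_zigzag:
  assumes "x \<notin> kinks"
  shows "(zigzag has_real_derivative zigzag_slope x) (at x)"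
proof -
  let ?t = "(x + 1) ^ 3"
  have s: "sin ?t \<noteq> 0"
    using assms by (simp add: kinks_def)
  have "(cos ?t)\<^sup>2 < 1"
    using s by (simp add: cos_squared_eq)
  then have c: "- 1 < cos ?t" "cos ?t < 1"
    using abs_square_less_1[of "cos ?t"] by auto
  have "sqrt (1 - (cos ?t)\<^sup>2) = \<bar>sin ?t\<bar>"
    by (simp add: cos_squared_eq)
  then have "(arccos has_real_derivative - inverse \<bar>sin ?t\<bar>) (at (cos ?t))"
    using DERIV_arccos[OF c] by simp
  moreover have "((\<lambda>x. cos ((x + 1) ^ 3)) has_real_derivative - sin ?t * (3 * (x + 1)\<^sup>2)) (at x)"
    by (auto intro!: derivative_eq_intros simp: algebra_simps)
  ultimately have "((\<lambda>x. arccos (cos ((x + 1) ^ 3))) has_real_derivative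
      - inverse \<bar>sin ?t\<bar> * (- sin ?t * (3 * (x + 1)\<^sup>2))) (at x)"
    by (rule DERIV_chain2)
  moreover have "- inverse \<bar>sin ?t\<bar> * (- sin ?t * (3 * (x + 1)\<^sup>2)) = zigzag_slope x"
    using s by (simp add: zigzag_slope_def abs_if)
  ultimately show ?thesis
    by (simp add: zigzag_def[abs_def])
qed

lemma finite_kinks: "finite (kinks \<inter> {0..R})"
proof -
  let ?f = "\<lambda>n::int. root 3 (of_int n * pi) - 1"
  have "kinks \<inter> {0..R} \<subseteq> ?f ` {0..\<lfloor>(R + 1) ^ 3 / pi\<rfloor>}"
  proof
    fix x assume x: "x \<in> kinks \<inter> {0..R}"
    then obtain n :: int where n: "(x + 1) ^ 3 = of_int n * pi"
      by (auto simp: kinks_def sin_zero_iff_int2)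
    have np: "0 \<le> of_int n * pi" "of_int n * pi \<le> (R + 1) ^ 3"
      unfolding n[symmetric] using x by (auto intro!: power_mono)
    have "0 \<le> n"
    proof (rule ccontr)
      assume "\<not> 0 \<le> n"
      then have "real_of_int n * pi < 0"
        by (simp add: mult_less_0_iff)
      with np show False
        by linarith
    qed
    moreover have "real_of_int n \<le> (R + 1) ^ 3 / pi"
      using np by (simp add: pos_le_divide_eq)
    moreover have "x = ?f n"
      using x by (simp add: n[symmetric] real_root_power_cancel)
    ultimately show "x \<in> ?f ` {0..\<lfloor>(R + 1) ^ 3 / pi\<rfloor>}"
      by (intro image_eqI[of _ _ n]) (simp_all add: le_floor_iff)
  qed
  then show ?thesis
    by (rule finite_subset) simp
qed

lemma negligible_kinks: "negligible (kinks \<inter> {0..})"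
proof -
  have "kinks \<inter> {0..} = (\<Union>n::nat. kinks \<inter> {0..real n})"
    using real_arch_simple by auto
  moreover have "negligible (\<Union>n::nat. kinks \<inter> {0..real n})"
    by (intro negligible_Union_nat negligible_finite finite_kinks)
  ultimately show ?thesis
    by (simp only:)
qed

lemma riccati_primitive_L2_loc: "(\<lambda>x. t * riccati_primitive x) \<in> L2_loc"
  unfolding L2_loc_def
proof (intro CollectI allI impI conjI)
  fix R :: real assume "R > 0"
  have [measurable]: "riccati_primitive \<in> borel_measurable borel"
    unfolding riccati_primitive_def by measurable
  have "(\<lambda>x. t * riccati_primitive x) \<in> borel_measurable borel"
    by measurable
  then show meas: "(\<lambda>x. t * riccati_primitive x) \<in> borel_measurable (lebesgue_on {0..R})"
    by (intro measurable_restrict_space1 measurable_completion) simp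
  let ?B = "(\<bar>t\<bar> * (3 * (R + 1)\<^sup>2 + 9 / 5 * (R + 1) ^ 5))\<^sup>2"
  show "integrable (lebesgue_on {0..R}) (\<lambda>x. (t * riccati_primitive x)\<^sup>2)"
  proof (rule Bochner_Integration.integrable_bound)
    show "integrable (lebesgue_on {0..R}) (\<lambda>x. ?B)"
      by (intro finite_measure.integrable_const finite_measure_lebesgue_on) auto
    show "(\<lambda>x. (t * riccati_primitive x)\<^sup>2) \<in> borel_measurable (lebesgue_on {0..R})"
      using meas by measurable
    have "norm ((t * riccati_primitive x)\<^sup>2) \<le> norm ?B" if "x \<in> {0..R}" for x
    proof -
      have "\<bar>riccati_primitive x\<bar> \<le> \<bar>zigzag_slope x\<bar> + \<bar>9 / 5 * (x + 1) ^ 5\<bar>"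
        unfolding riccati_primitive_def by (rule abs_triangle_ineq)
      also have "\<dots> \<le> 3 * (R + 1)\<^sup>2 + 9 / 5 * (R + 1) ^ 5"
        unfolding abs_zigzag_slope using that by (auto intro!: add_mono power_mono)
      finally have "\<bar>t * riccati_primitive x\<bar> \<le> \<bar>\<bar>t\<bar> * (3 * (R + 1)\<^sup>2 + 9 / 5 * (R + 1) ^ 5)\<bar>"
        by (auto simp: abs_mult intro!: mult_left_mono)
      then show ?thesis
        by (simp add: abs_le_square_iff)
    qed
    then show "AE x in lebesgue_on {0..R}. norm ((t * riccati_primitive x)\<^sup>2) \<le> norm ?B"
      by (intro AE_I2) simp
  qed
qed

section \<open>Factorization and energy identity\<close>

text \<open>For the quasi-derivative \<open>u\<close> of \<open>y\<close> with respect to \<open>t * riccati_primitive\<close>, this is the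
  absolutely continuous representative of \<open>y' - t r y\<close>.\<close>

definition factor_part :: "real \<Rightarrow> (real \<Rightarrow> complex) \<Rightarrow> (real \<Rightarrow> complex) \<Rightarrow> real \<Rightarrow> complex" where
  "factor_part t y u x = u x + of_real (t * (9 / 5 * (x + 1) ^ 5)) * y x"

lemma AC_loc_power: "(\<lambda>x. of_real (c * (x + 1) ^ n)) \<in> AC_loc"
proof (rule AC_locI[where E = "{}" and f' = "\<lambda>x. of_real (c * (of_nat n * (x + 1) ^ (n - 1)))" and
      B = "\<lambda>x. \<bar>c\<bar> * (of_nat n * (x + 1) ^ (n - 1))"])
  show "((\<lambda>x. complex_of_real (c * (x + 1) ^ n)) has_vector_derivative
      of_real (c * (of_nat n * (x + 1) ^ (n - 1)))) (at x)" for x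
    by (intro has_vector_derivative_of_real) (auto intro!: derivative_eq_intros)
  show "mono_on {0..} (\<lambda>x. \<bar>c\<bar> * (of_nat n * (x + 1) ^ (n - 1)))"
    by (intro mono_onI mult_left_mono power_mono) auto
qed (auto intro!: continuous_intros simp: norm_mult norm_power abs_mult)

text \<open>In terms of \<open>v = y' - t r y\<close> the quasi-differential expression becomes
  \<open>l(y) = - v' - t r v + t (1 - t) r\<^sup>2 y\<close>, the factorized form of \<open>- y'' + t (r' + r\<^sup>2) y\<close>.\<close>

lemma quasi_expression_factorization:
  assumes "is_quasi_expression (\<lambda>x. t * riccati_primitive x) y u g"
  defines "v \<equiv> factor_part t y u"
  shows "y \<in> AC_loc" "v \<in> AC_loc"
    and "AE x in half_line. (y has_vector_derivative (v x + of_real (t * zigzag_slope x) * y x)) (at x)"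
    and "AE x in half_line. (v has_vector_derivative
      (of_real (t * (1 - t) * (9 * (x + 1) ^ 4)) * y x - of_real (t * zigzag_slope x) * v x - g x)) (at x)"
proof -
  let ?s = "\<lambda>x. t * riccati_primitive x"
  have qd: "is_quasi_derivative ?s y u" and
    g: "AE x in half_line. u differentiable (at x) \<and>
        g x = - vector_derivative u (at x) - of_real (?s x) * u x - of_real ((?s x)\<^sup>2) * y x"
    using assms by (auto simp: is_quasi_expression_def)
  then have y: "y \<in> AC_loc" and u: "u \<in> AC_loc" and
    ud: "AE x in half_line. y differentiable (at x) \<and>
        u x = vector_derivative y (at x) - of_real (?s x) * y x"
    by (auto simp: is_quasi_derivative_def)
  show "y \<in> AC_loc" by fact
  have "(\<lambda>x. complex_of_real ((t * (9 / 5)) * (x + 1) ^ 5)) \<in> AC_loc"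
    by (rule AC_loc_power)
  then have "(\<lambda>x. complex_of_real (t * (9 / 5 * (x + 1) ^ 5))) \<in> AC_loc"
    by (simp only: mult.assoc)
  then show "v \<in> AC_loc"
    unfolding v_def factor_part_def[abs_def] by (intro AC_loc_add AC_loc_mult u y)
  show dy: "AE x in half_line. (y has_vector_derivative (v x + of_real (t * zigzag_slope x) * y x)) (at x)"
    using ud
  proof eventually_elim
    case (elim x)
    then have "(y has_vector_derivative (u x + of_real (?s x) * y x)) (at x)"
      by (simp add: vector_derivative_works)
    moreover have "u x + of_real (?s x) * y x = v x + of_real (t * zigzag_slope x) * y x"
      by (simp add: v_def factor_part_def riccati_primitive_def algebra_simps)
    ultimately show ?case
      by simp
  qed
  show "AE x in half_line. (v has_vector_derivative
      (of_real (t * (1 - t) * (9 * (x + 1) ^ 4)) * y x - of_real (t * zigzag_slope x) * v x - g x)) (at x)"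
    using g dy
  proof eventually_elim
    case (elim x)
    define P Q r where "P = complex_of_real (t * (9 / 5 * (x + 1) ^ 5))"
      and "Q = complex_of_real (t * (9 * (x + 1) ^ 4))" and "r = complex_of_real (t * zigzag_slope x)"
    have "((\<lambda>x. complex_of_real (t * (9 / 5 * (x + 1) ^ 5))) has_vector_derivative Q) (at x)"
      unfolding Q_def
      by (intro has_vector_derivative_of_real) (auto intro!: derivative_eq_intros)
    moreover have "(u has_vector_derivative vector_derivative u (at x)) (at x)"
      using elim by (simp add: vector_derivative_works)
    moreover have "(y has_vector_derivative (v x + r * y x)) (at x)"
      using elim by (simp add: r_def)
    ultimately have "(v has_vector_derivative
        (vector_derivative u (at x) + (P * (v x + r * y x) + Q * y x))) (at x)"
      unfolding v_def factor_part_def[abs_def] P_def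
      by (intro has_vector_derivative_add has_vector_derivative_mult)
    moreover have "vector_derivative u (at x) + (P * (v x + r * y x) + Q * y x)
        = (Q - r\<^sup>2) * y x - r * v x - g x"
    proof -
      have s: "complex_of_real (?s x) = r + P"
        by (simp add: riccati_primitive_def r_def P_def distrib_left)
      have u_eq: "u x = v x - P * y x"
        by (simp add: v_def factor_part_def P_def)
      have "g x = - vector_derivative u (at x) - of_real (?s x) * u x - of_real ((?s x)\<^sup>2) * y x"
        using elim by blast
      then have "vector_derivative u (at x) = - g x - (r + P) * (v x - P * y x) - (r + P)\<^sup>2 * y x"
        unfolding of_real_power s u_eq by (simp add: algebra_simps)
      then show ?thesis
        by (simp add: algebra_simps power2_eq_square)
    qed
    moreover have "Q - r\<^sup>2 = of_real (t * (1 - t) * (9 * (x + 1) ^ 4))"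
    proof -
      have "r\<^sup>2 = complex_of_real (t\<^sup>2 * (9 * (x + 1) ^ 4))"
        by (simp only: r_def of_real_power[symmetric] power_mult_distrib zigzag_slope_squared)
      then show ?thesis
        unfolding Q_def by (simp only: of_real_diff[symmetric]) (simp add: power2_eq_square algebra_simps)
    qed
    ultimately show ?case
      by (simp add: r_def)
  qed
qed

text \<open>The integrand of the completed square, with \<open>r\<^sup>2 = 9 (x + 1)\<^sup>4\<close> substituted.\<close>

definition energy_density :: "real \<Rightarrow> (real \<Rightarrow> complex) \<Rightarrow> (real \<Rightarrow> complex) \<Rightarrow> real \<Rightarrow> real" where
  "energy_density t y v x = (cmod (v x))\<^sup>2 + t * (1 - t) * (9 * (x + 1) ^ 4) * (cmod (y x))\<^sup>2"

lemma continuous_on_energy_density: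
  assumes "y \<in> AC_loc" "v \<in> AC_loc"
  shows "continuous_on {0..} (energy_density t y v)"
  unfolding energy_density_def[abs_def]
  by (intro continuous_intros AC_loc_continuous_on assms)

lemma energy_density_integrable_on:
  assumes "y \<in> AC_loc" "v \<in> AC_loc" "0 \<le> a"
  shows "energy_density t y v integrable_on {a..b}"
  by (intro integrable_continuous_real continuous_on_subset[OF continuous_on_energy_density[OF assms(1,2)]])
    (use assms(3) in auto)

text \<open>By the factorization, \<open>v cnj y\<close> has the derivative \<open>energy_density - g cnj y\<close>, and it vanishes
  at \<open>0\<close> and at \<open>R\<close> because \<open>y\<close> does.\<close>

lemma energy_identity:
  assumes q: "is_quasi_expression (\<lambda>x. t * riccati_primitive x) y u g"
    and sq: "square_integrable y" "square_integrable g"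
    and y0: "y 0 = 0" and R: "0 \<le> R" "\<And>x. R \<le> x \<Longrightarrow> y x = 0"
  shows "cinner (abs_ltwo g) (abs_ltwo y) =
    of_real (integral {0..R} (energy_density t y (factor_part t y u)))"
proof -
  define v where "v = factor_part t y u"
  define e where "e = energy_density t y v"
  note fac = quasi_expression_factorization[OF q, folded v_def]
  have W: "(\<lambda>x. v x * cnj (y x)) \<in> AC_loc"
    by (intro AC_loc_mult AC_loc_cnj fac)
  have "AE x in half_line. ((\<lambda>x. v x * cnj (y x)) has_vector_derivative
      (of_real (e x) - g x * cnj (y x))) (at x)"
    using fac(3,4)
  proof eventually_elim
    case (elim x)
    define r where "r = complex_of_real (t * zigzag_slope x)"
    define k where "k = complex_of_real (t * (1 - t) * (9 * (x + 1) ^ 4))"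
    have "((\<lambda>x. v x * cnj (y x)) has_vector_derivative
       (v x * cnj (v x + r * y x) + (k * y x - r * v x - g x) * cnj (y x))) (at x)"
      using elim unfolding r_def k_def by (intro has_vector_derivative_mult has_vector_derivative_cnj)
    moreover have "cnj r = r"
      by (simp add: r_def)
    moreover have "of_real (e x) = v x * cnj (v x) + k * (y x * cnj (y x))"
      unfolding e_def energy_density_def k_def by (simp only: of_real_add of_real_mult complex_norm_square)
    ultimately show ?case
      by (simp add: algebra_simps)
  qed
  from AC_loc_has_integral[OF W this order_refl R(1)]
  have "((\<lambda>x. of_real (e x) - g x * cnj (y x)) has_integral 0) {0..R}"
    using y0 R by simp
  moreover have "((\<lambda>x. complex_of_real (e x)) has_integral of_real (integral {0..R} e)) {0..R}"
    using energy_density_integrable_on[OF fac(1,2), of 0 t R]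
    by (intro has_integral_of_real integrable_integral) (simp add: e_def)
  ultimately have "((\<lambda>x. of_real (e x) - (of_real (e x) - g x * cnj (y x)))
      has_integral (of_real (integral {0..R} e) - 0)) {0..R}"
    by (intro has_integral_diff)
  then have "((\<lambda>x. g x * cnj (y x)) has_integral of_real (integral {0..R} e)) {0..R}"
    by simp
  moreover have "((\<lambda>x. g x * cnj (y x)) has_integral (\<integral>x. g x * cnj (y x) \<partial>half_line)) {0..R}"
    using sq R by (intro has_integral_half_line square_integrable_mult_cnj) auto
  ultimately show ?thesis
    using sq by (simp add: cinner_abs_ltwo has_integral_unique e_def v_def)
qed

section \<open>Linearity of the minimal operator\<close>

lemma is_quasi_expression_linear:
  assumes "is_quasi_expression s y u g" "is_quasi_expression s y' u' g'"
  shows "is_quasi_expression s (\<lambda>x. a * y x + b * y' x) (\<lambda>x. a * u x + b * u' x) (\<lambda>x. a * g x + b * g' x)"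
proof -
  have lin: "(\<lambda>x. a * f x + b * h x) \<in> AC_loc" if "f \<in> AC_loc" "h \<in> AC_loc" for f h
    using that by (intro AC_loc_add AC_loc_mult AC_loc_const)
  have der: "(\<lambda>x. a * f x + b * h x) differentiable (at x) \<and>
      vector_derivative (\<lambda>x. a * f x + b * h x) (at x)
        = a * vector_derivative f (at x) + b * vector_derivative h (at x)"
    if "f differentiable (at x)" "h differentiable (at x)" for f h :: "real \<Rightarrow> complex" and x
  proof -
    have "((\<lambda>x. a * f x + b * h x) has_vector_derivative
        a * vector_derivative f (at x) + b * vector_derivative h (at x)) (at x)"
      using that by (intro has_vector_derivative_add has_vector_derivative_mult_right)
        (simp_all add: vector_derivative_works)
    then show ?thesis
      by (auto simp: vector_derivative_at intro: differentiableI_vector)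
  qed
  have qd: "AE x in half_line. y differentiable (at x) \<and> u x = vector_derivative y (at x) - of_real (s x) * y x"
    "AE x in half_line. y' differentiable (at x) \<and> u' x = vector_derivative y' (at x) - of_real (s x) * y' x"
    and AC: "y \<in> AC_loc" "u \<in> AC_loc" "y' \<in> AC_loc" "u' \<in> AC_loc"
    using assms by (auto simp: is_quasi_expression_def is_quasi_derivative_def)
  from qd have "AE x in half_line. (\<lambda>x. a * y x + b * y' x) differentiable (at x) \<and>
      a * u x + b * u' x = vector_derivative (\<lambda>x. a * y x + b * y' x) (at x)
        - of_real (s x) * (a * y x + b * y' x)"
  proof eventually_elim
    case (elim x)
    then have d: "y differentiable (at x)" "y' differentiable (at x)"
      and e: "u x = vector_derivative y (at x) - of_real (s x) * y x"
        "u' x = vector_derivative y' (at x) - of_real (s x) * y' x"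
      by blast+
    show ?case
      by (intro conjI conjunct1[OF der[OF d]]) (simp only: conjunct2[OF der[OF d]] e, simp add: algebra_simps)
  qed
  moreover have qe: "AE x in half_line. u differentiable (at x) \<and>
        g x = - vector_derivative u (at x) - of_real (s x) * u x - of_real ((s x)\<^sup>2) * y x"
    "AE x in half_line. u' differentiable (at x) \<and>
        g' x = - vector_derivative u' (at x) - of_real (s x) * u' x - of_real ((s x)\<^sup>2) * y' x"
    using assms by (auto simp: is_quasi_expression_def)
  from qe have "AE x in half_line. (\<lambda>x. a * u x + b * u' x) differentiable (at x) \<and>
      a * g x + b * g' x = - vector_derivative (\<lambda>x. a * u x + b * u' x) (at x)
        - of_real (s x) * (a * u x + b * u' x) - of_real ((s x)\<^sup>2) * (a * y x + b * y' x)"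
  proof eventually_elim
    case (elim x)
    then have d: "u differentiable (at x)" "u' differentiable (at x)"
      and e: "g x = - vector_derivative u (at x) - of_real (s x) * u x - of_real ((s x)\<^sup>2) * y x"
        "g' x = - vector_derivative u' (at x) - of_real (s x) * u' x - of_real ((s x)\<^sup>2) * y' x"
      by blast+
    show ?case
      by (intro conjI conjunct1[OF der[OF d]]) (simp only: conjunct2[OF der[OF d]] e, simp add: algebra_simps)
  qed
  ultimately show ?thesis
    using lin AC by (auto simp: is_quasi_expression_def is_quasi_derivative_def)
qed

lemma minimal_operatorE:
  assumes "(f, h) \<in> minimal_operator s"
  obtains y u g R where "f = abs_ltwo y" "h = abs_ltwo g" "is_quasi_expression s y u g"
    "square_integrable y" "square_integrable g" "y 0 = 0" "u 0 = 0" "R > 0" "\<And>x. R \<le> x \<Longrightarrow> y x = 0"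
proof -
  obtain y u g where *: "f = abs_ltwo y" "h = abs_ltwo g" "is_quasi_expression s y u g"
    "square_integrable y" "square_integrable g" "y 0 = 0" "u 0 = 0"
    "compact (closure {x. 0 \<le> x \<and> y x \<noteq> 0})"
    using assms by (auto simp: minimal_operator_def)
  then have "bounded {x. 0 \<le> x \<and> y x \<noteq> 0}"
    by (simp add: compact_closure)
  then obtain R where R: "\<And>x. 0 \<le> x \<Longrightarrow> y x \<noteq> 0 \<Longrightarrow> \<bar>x\<bar> \<le> R"
    by (auto simp: bounded_iff)
  have "y x = 0" if "\<bar>R\<bar> + 1 \<le> x" for x
  proof (rule ccontr)
    assume "y x \<noteq> 0"
    moreover have "0 \<le> x"
      using that by linarith
    ultimately have "\<bar>x\<bar> \<le> R"
      using R by blast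
    then show False
      using that by linarith
  qed
  then show ?thesis
    by (intro that[of y g u "\<bar>R\<bar> + 1"] *) auto
qed

lemma minimal_operatorI:
  assumes "is_quasi_expression s y u g" "square_integrable y" "square_integrable g" "y 0 = 0" "u 0 = 0"
    "\<And>x. R \<le> x \<Longrightarrow> y x = 0"
  shows "(abs_ltwo y, abs_ltwo g) \<in> minimal_operator s"
proof -
  have "{x. 0 \<le> x \<and> y x \<noteq> 0} \<subseteq> {0..R}"
  proof
    fix x assume x: "x \<in> {x. 0 \<le> x \<and> y x \<noteq> 0}"
    then have "\<not> R \<le> x"
      using assms(6)[of x] by auto
    then show "x \<in> {0..R}"
      using x by auto
  qed
  then have "bounded {x. 0 \<le> x \<and> y x \<noteq> 0}"
    by (rule bounded_subset[OF bounded_closed_interval])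
  then have "compact (closure {x. 0 \<le> x \<and> y x \<noteq> 0})"
    by (simp only: compact_closure)
  then show ?thesis
    unfolding minimal_operator_def
    by (intro CollectI exI[of _ y] exI[of _ u] exI[of _ g] conjI refl assms)
qed

lemma abs_ltwo_linear:
  assumes "square_integrable f" "square_integrable g"
  shows "abs_ltwo (\<lambda>x. a * f x + b * g x) = a *\<^sub>c abs_ltwo f + b *\<^sub>c abs_ltwo g"
  using assms square_integrable_cmult
  by (simp add: cscale.abs_eq plus_ltwo.abs_eq)

lemma square_integrable_linear:
  "square_integrable f \<Longrightarrow> square_integrable g \<Longrightarrow> square_integrable (\<lambda>x. a * f x + b * g x)"
  by (intro square_integrable_add square_integrable_cmult)

lemma minimal_operator_linear:
  assumes "(f, h) \<in> minimal_operator s" "(f', h') \<in> minimal_operator s"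
  shows "(a *\<^sub>c f + b *\<^sub>c f', a *\<^sub>c h + b *\<^sub>c h') \<in> minimal_operator s"
proof -
  from assms(1) obtain y u g R where 1: "f = abs_ltwo y" "h = abs_ltwo g" "is_quasi_expression s y u g"
    "square_integrable y" "square_integrable g" "y 0 = 0" "u 0 = 0" "R > 0" "\<And>x. R \<le> x \<Longrightarrow> y x = 0"
    by (rule minimal_operatorE) blast
  from assms(2) obtain y' u' g' R' where 2: "f' = abs_ltwo y'" "h' = abs_ltwo g'" "is_quasi_expression s y' u' g'"
    "square_integrable y'" "square_integrable g'" "y' 0 = 0" "u' 0 = 0" "R' > 0" "\<And>x. R' \<le> x \<Longrightarrow> y' x = 0"
    by (rule minimal_operatorE) blast
  have "(abs_ltwo (\<lambda>x. a * y x + b * y' x), abs_ltwo (\<lambda>x. a * g x + b * g' x)) \<in> minimal_operator s"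
    using 1 2 by (intro minimal_operatorI[OF is_quasi_expression_linear[OF 1(3) 2(3), of a b], of "max R R'"]
        square_integrable_linear) auto
  then show ?thesis
    using 1 2 by (simp add: abs_ltwo_linear)
qed

section \<open>Trial functions\<close>

lemma square_integrable_continuous:
  assumes cont: "continuous_on {0..} f" and zero: "\<And>x. R \<le> x \<Longrightarrow> f x = 0"
  shows "square_integrable f"
proof -
  have meas: "f \<in> borel_measurable half_line"
    by (rule continuous_imp_measurable_on_sets_lebesgue[OF cont]) auto
  have "compact ((\<lambda>x. cmod (f x)) ` {0..R})"
    by (intro compact_continuous_image continuous_intros continuous_on_subset[OF cont]) auto
  then obtain M where M: "\<And>x. x \<in> {0..R} \<Longrightarrow> cmod (f x) \<le> M"
    by (force dest!: compact_imp_bounded simp: bounded_iff)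
  have "integrable half_line (\<lambda>x. M\<^sup>2 * indicator {0..R} x :: real)"
  proof -
    have "integrable half_line (indicator {0..R} :: real \<Rightarrow> real)"
      by (subst integrable_restrict_space)
        (auto simp: indicator_inter_arith[symmetric] lmeasurable_iff_integrable[symmetric])
    then show ?thesis
      by (rule integrable_mult_right)
  qed
  then have "integrable half_line (\<lambda>x. (cmod (f x))\<^sup>2)"
  proof (rule Bochner_Integration.integrable_bound)
    show "(\<lambda>x. (cmod (f x))\<^sup>2) \<in> borel_measurable half_line"
      using meas by measurable
    have "(cmod (f x))\<^sup>2 \<le> M\<^sup>2 * indicator {0..R} x" if "x \<in> {0..}" for x
      using M[of x] zero[of x] that by (auto simp: indicator_def intro!: power_mono)
    then show "AE x in half_line. norm ((cmod (f x))\<^sup>2) \<le> norm (M\<^sup>2 * indicator {0..R} x :: real)"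
      by (intro AE_I2) simp
  qed
  then show ?thesis
    using meas by (simp add: square_integrable_def)
qed

text \<open>The new variable in which the first-order part of the trial functions loses its coefficients.\<close>

definition stretch :: "real \<Rightarrow> real \<Rightarrow> real" where
  "stretch t x = integral {0..x} (\<lambda>s. exp (- 2 * t * zigzag s))"

lemma stretch_0 [simp]: "stretch t 0 = 0"
  by (simp add: stretch_def)

lemma continuous_on_exp_zigzag: "continuous_on S (\<lambda>x. exp (c * zigzag x))"
  by (intro continuous_intros continuous_on_zigzag)

lemma has_derivative_stretch:
  assumes "0 \<le> x" "x \<le> R"
  shows "(stretch t has_real_derivative exp (- 2 * t * zigzag x)) (at x within {0..R})"
  unfolding stretch_def[abs_def]
  using assms by (intro integral_has_real_derivative continuous_on_exp_zigzag) auto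

lemma has_derivative_stretch_at:
  assumes "0 < x"
  shows "(stretch t has_real_derivative exp (- 2 * t * zigzag x)) (at x)"
proof -
  have "(stretch t has_real_derivative exp (- 2 * t * zigzag x)) (at x within {0..x + 1})"
    using assms by (intro has_derivative_stretch) auto
  moreover have "at x within {0..x + 1} = at x"
    using assms by (intro at_within_interior) auto
  ultimately show ?thesis
    by (simp only:)
qed

lemma continuous_on_stretch: "continuous_on {0..R} (stretch t)"
  by (rule DERIV_continuous_on) (auto intro: has_derivative_stretch)

lemma continuous_on_stretch_half_line: "continuous_on {0..} (stretch t)"
proof -
  have "continuous (at x within {0..}) (stretch t)" if "0 \<le> x" for x
  proof -
    have "continuous (at x within {0..x + 1}) (stretch t)"
      using continuous_on_stretch[of "x + 1" t] that by (simp add: continuous_on_eq_continuous_within)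
    moreover have "at x within {0..x + 1} = at x within {0..}"
      using that by (intro at_within_nhd[of _ "{..<x + 1}"]) auto
    ultimately show ?thesis
      by (simp only:)
  qed
  then show ?thesis
    by (simp add: continuous_on_eq_continuous_within)
qed

lemma exp_zigzag_bounds:
  assumes "0 \<le> c"
  shows "1 \<le> exp (c * zigzag x)" "exp (c * zigzag x) \<le> exp (c * pi)"
  using assms zigzag_bounds[of x] by (auto intro: mult_left_mono)

lemma stretch_bounds:
  assumes "0 \<le> t" "0 \<le> x"
  shows "exp (- 2 * t * pi) * x \<le> stretch t x" "stretch t x \<le> x"
proof -
  have int: "(\<lambda>s. exp (- 2 * t * zigzag s)) integrable_on {0..x}"
    by (intro integrable_continuous_real continuous_on_exp_zigzag)
  have "integral {0..x} (\<lambda>s. exp (- 2 * t * pi)) \<le> stretch t x"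
    unfolding stretch_def using assms zigzag_bounds int
    by (intro integral_le) (auto intro!: mult_left_mono)
  then show "exp (- 2 * t * pi) * x \<le> stretch t x"
    using assms by (simp add: mult.commute)
  have "stretch t x \<le> integral {0..x} (\<lambda>s. 1)"
    unfolding stretch_def using assms zigzag_bounds int
    by (intro integral_le) auto
  then show "stretch t x \<le> x"
    using assms by simp
qed

text \<open>Substitution along \<open>stretch\<close>: integrals of trial functions become integrals of profiles and
  do not change when a profile is translated.\<close>

lemma has_integral_stretch:
  fixes F :: "real \<Rightarrow> real"
  assumes "0 \<le> t" "0 \<le> R" and F: "continuous_on UNIV F" "\<And>s. q \<le> s \<Longrightarrow> F s = 0"
    and q: "0 \<le> q" "q \<le> stretch t R"
  shows "((\<lambda>x. exp (- 2 * t * zigzag x) * F (stretch t x)) has_integral integral {0..q} F) {0..R}"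
proof -
  have "((\<lambda>x. exp (- 2 * t * zigzag x) *\<^sub>R F (stretch t x)) has_integral
      integral {stretch t 0..stretch t R} F) {0..R}"
  proof (rule has_integral_substitution[where c = 0 and d = R])
    show "stretch t ` {0..R} \<subseteq> {0..R}"
    proof safe
      fix x assume x: "x \<in> {0..R}"
      have "0 \<le> exp (- 2 * t * pi) * x"
        using x by simp
      moreover have "0 \<le> x"
        using x by simp
      ultimately have "0 \<le> stretch t x" "stretch t x \<le> x"
        using stretch_bounds[OF assms(1) \<open>0 \<le> x\<close>] by linarith+
      then show "stretch t x \<in> {0..R}"
        using x by simp
    qed
    show "(stretch t has_real_derivative exp (- 2 * t * zigzag x)) (at x within {0..R})" if "x \<in> {0..R}" for x
      using that by (intro has_derivative_stretch) auto
  qed (use assms in \<open>auto intro: continuous_on_subset\<close>)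
  moreover have "integral {0..stretch t R} F = integral {0..q} F"
  proof -
    have "integral {0..q} F + integral {q..stretch t R} F = integral {0..stretch t R} F"
      using q by (intro Henstock_Kurzweil_Integration.integral_combine integrable_continuous_real
          continuous_on_subset[OF F(1)]) auto
    moreover have "integral {q..stretch t R} F = integral {q..stretch t R} (\<lambda>s. 0)"
      using F(2) by (intro integral_cong) auto
    ultimately show ?thesis
      by simp
  qed
  ultimately show ?thesis
    by simp
qed

text \<open>A trial function \<open>y = exp (t Z) b(\<Psi>)\<close> with \<open>Z = zigzag\<close> and \<open>\<Psi> = stretch t\<close>. Here \<open>b\<close> is a
  twice continuously differentiable profile supported in \<open>[p, q]\<close>, with derivatives \<open>b1\<close>
  and \<open>b2\<close>; \<open>v\<close> is \<open>y' - t r y\<close>, \<open>u\<close> the quasi-derivative and \<open>g\<close> the value of \<open>l(y)\<close>.\<close>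

locale trial =
  fixes t p q :: real and b b1 b2 :: "real \<Rightarrow> real"
  assumes t: "0 \<le> t" and pq: "0 \<le> p" "p \<le> q"
    and deriv_b: "\<And>s. (b has_real_derivative b1 s) (at s)"
    and deriv_b1: "\<And>s. (b1 has_real_derivative b2 s) (at s)"
    and cont_b2: "continuous_on UNIV b2"
    and vanish: "\<And>s. s \<le> p \<or> q \<le> s \<Longrightarrow> b s = 0 \<and> b1 s = 0 \<and> b2 s = 0"
begin

definition y :: "real \<Rightarrow> complex" where
  "y x = of_real (exp (t * zigzag x) * b (stretch t x))"

definition v :: "real \<Rightarrow> complex" where
  "v x = of_real (exp (- t * zigzag x) * b1 (stretch t x))"

definition u :: "real \<Rightarrow> complex" where
  "u x = v x - of_real (t * (9 / 5 * (x + 1) ^ 5)) * y x"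

definition g :: "real \<Rightarrow> complex" where
  "g x = of_real (t * (1 - t) * (9 * (x + 1) ^ 4)) * y x
     - of_real (exp (- 3 * t * zigzag x) * b2 (stretch t x))"

definition R :: real where
  "R = exp (2 * t * pi) * q"

lemma cont_b: "continuous_on S b" and cont_b1: "continuous_on S b1" and cont_b2': "continuous_on S b2"
  using deriv_b deriv_b1 cont_b2
  by (auto intro: continuous_at_imp_continuous_on DERIV_isCont continuous_on_subset)

lemma R_nonneg: "0 \<le> R"
  using pq by (simp add: R_def)

lemma stretch_R: "R \<le> x \<Longrightarrow> q \<le> stretch t x"
proof -
  assume "R \<le> x"
  then have "exp (- 2 * t * pi) * R \<le> exp (- 2 * t * pi) * x"
    by (intro mult_left_mono) auto
  also have "\<dots> \<le> stretch t x"
    using \<open>R \<le> x\<close> R_nonneg t by (intro stretch_bounds) auto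
  also have "exp (- 2 * t * pi) * R = q"
    by (simp add: R_def mult.assoc[symmetric] exp_add[symmetric])
  finally show ?thesis .
qed

lemma vanish_R: "R \<le> x \<Longrightarrow> y x = 0" "R \<le> x \<Longrightarrow> v x = 0" "R \<le> x \<Longrightarrow> g x = 0"
  using vanish stretch_R by (auto simp: y_def v_def g_def)

lemma vanish_0: "y 0 = 0" "u 0 = 0"
  using vanish[of 0] pq by (auto simp: y_def u_def v_def)

lemma y_vanish_p: "0 \<le> x \<Longrightarrow> x \<le> p \<Longrightarrow> y x = 0"
  using vanish[of "stretch t x"] stretch_bounds[OF t, of x] by (auto simp: y_def)

lemma deriv_y:
  assumes "0 < x" "x \<notin> kinks"
  shows "(y has_vector_derivative (of_real (t * zigzag_slope x) * y x + v x)) (at x)"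
proof -
  have "((\<lambda>x. exp (t * zigzag x) * b (stretch t x)) has_real_derivative
      t * zigzag_slope x * exp (t * zigzag x) * b (stretch t x)
        + b1 (stretch t x) * exp (- 2 * t * zigzag x) * exp (t * zigzag x)) (at x)"
    by (auto intro!: derivative_eq_intros has_derivative_zigzag assms has_derivative_stretch_at
        DERIV_chain2[OF deriv_b])
  moreover have "exp (- 2 * t * zigzag x) * exp (t * zigzag x) = exp (- t * zigzag x)"
    by (simp add: exp_add[symmetric])
  ultimately show ?thesis
    unfolding y_def[abs_def] v_def[abs_def]
    by (auto dest!: has_vector_derivative_of_real simp: mult_ac)
qed

lemma deriv_v:
  assumes "0 < x" "x \<notin> kinks"
  shows "(v has_vector_derivative
    (of_real (exp (- 3 * t * zigzag x) * b2 (stretch t x)) - of_real (t * zigzag_slope x) * v x)) (at x)"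
proof -
  have "((\<lambda>x. exp (- t * zigzag x) * b1 (stretch t x)) has_real_derivative
      - t * zigzag_slope x * exp (- t * zigzag x) * b1 (stretch t x)
        + b2 (stretch t x) * exp (- 2 * t * zigzag x) * exp (- t * zigzag x)) (at x)"
    by (auto intro!: derivative_eq_intros has_derivative_zigzag assms has_derivative_stretch_at
        DERIV_chain2[OF deriv_b1])
  moreover have "exp (- 2 * t * zigzag x) * exp (- t * zigzag x) = exp (- 3 * t * zigzag x)"
    by (simp add: exp_add[symmetric])
  ultimately show ?thesis
    unfolding v_def[abs_def]
    by (auto dest!: has_vector_derivative_of_real simp: mult_ac)
qed

lemma bounded_profile: "\<exists>M\<ge>0. \<forall>s. \<bar>b s\<bar> \<le> M \<and> \<bar>b1 s\<bar> \<le> M \<and> \<bar>b2 s\<bar> \<le> M"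
proof -
  have "\<exists>M. \<forall>s. \<bar>f s\<bar> \<le> M" if "continuous_on UNIV f" "\<And>s. s \<le> p \<or> q \<le> s \<Longrightarrow> f s = 0" for f :: "real \<Rightarrow> real"
  proof -
    have "bounded (f ` {p..q})"
      by (intro compact_imp_bounded compact_continuous_image continuous_on_subset[OF that(1)]) auto
    then obtain M where M: "\<And>s. s \<in> {p..q} \<Longrightarrow> \<bar>f s\<bar> \<le> M"
      by (force simp: bounded_iff)
    have "\<bar>f s\<bar> \<le> \<bar>M\<bar>" for s
      using M[of s] that(2)[of s] by (cases "s \<in> {p..q}") auto
    then show ?thesis
      by blast
  qed
  note bound = this
  obtain M0 where M0: "\<forall>s. \<bar>b s\<bar> \<le> M0"
    using bound[OF cont_b] vanish by blast
  obtain M1 where M1: "\<forall>s. \<bar>b1 s\<bar> \<le> M1"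
    using bound[OF cont_b1] vanish by blast
  obtain M2 where M2: "\<forall>s. \<bar>b2 s\<bar> \<le> M2"
    using bound[OF cont_b2'] vanish by blast
  have "\<bar>b s\<bar> \<le> \<bar>M0\<bar> + \<bar>M1\<bar> + \<bar>M2\<bar> \<and> \<bar>b1 s\<bar> \<le> \<bar>M0\<bar> + \<bar>M1\<bar> + \<bar>M2\<bar> \<and> \<bar>b2 s\<bar> \<le> \<bar>M0\<bar> + \<bar>M1\<bar> + \<bar>M2\<bar>" for s
    using M0[rule_format, of s] M1[rule_format, of s] M2[rule_format, of s] by linarith
  then show ?thesis
    by (intro exI[of _ "\<bar>M0\<bar> + \<bar>M1\<bar> + \<bar>M2\<bar>"]) simp
qed

lemma continuous_on_yvg: "continuous_on {0..} y" "continuous_on {0..} v" "continuous_on {0..} g"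
proof -
  have c: "continuous_on {0..} (\<lambda>x. f (stretch t x))" if "continuous_on UNIV f" for f :: "real \<Rightarrow> real"
    by (rule continuous_on_compose2[OF that continuous_on_stretch_half_line]) auto
  show y: "continuous_on {0..} y" and "continuous_on {0..} v"
    unfolding y_def[abs_def] v_def[abs_def]
    by (intro continuous_on_of_real continuous_on_mult continuous_on_exp_zigzag c[OF cont_b] c[OF cont_b1])+
  show "continuous_on {0..} g"
    unfolding g_def[abs_def]
    by (intro continuous_on_diff continuous_on_mult continuous_on_of_real continuous_on_exp_zigzag
        c[OF cont_b2'] y continuous_intros)
qed

lemma AC_y: "y \<in> AC_loc" and AC_v: "v \<in> AC_loc"
proof -
  obtain M where "0 \<le> M" and bM: "\<forall>s. \<bar>b s\<bar> \<le> M \<and> \<bar>b1 s\<bar> \<le> M \<and> \<bar>b2 s\<bar> \<le> M"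
    using bounded_profile by (elim exE conjE)
  then have M: "0 \<le> M" "\<And>s. \<bar>b s\<bar> \<le> M" "\<And>s. \<bar>b1 s\<bar> \<le> M" "\<And>s. \<bar>b2 s\<bar> \<le> M"
    by simp_all
  define E where "E = exp (t * pi)"
  have E1: "1 \<le> E"
    using t by (simp add: E_def)
  have y: "cmod (y x) \<le> E * M" for x
    using exp_zigzag_bounds(2)[OF t, of x] M(2)[of "stretch t x"] M(1)
    unfolding y_def norm_of_real abs_mult abs_exp_cancel E_def by (intro mult_mono) auto
  have small: "\<bar>exp (- c * t * zigzag x) * s\<bar> \<le> E * M" if "0 \<le> c" "\<bar>s\<bar> \<le> M" for c x s
  proof -
    have "0 \<le> c * t * zigzag x"
      using that t zigzag_bounds(1)[of x] by simp
    then have "exp (- c * t * zigzag x) \<le> 1"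
      by simp
    then have "exp (- c * t * zigzag x) \<le> E"
      using E1 by linarith
    then show ?thesis
      unfolding abs_mult abs_exp_cancel using that M(1) E1 by (intro mult_mono) auto
  qed
  have v: "cmod (v x) \<le> E * M" for x
    using small[of 1 "b1 (stretch t x)" x] M(3) unfolding v_def norm_of_real by simp
  have B: "t * (3 * (x + 1)\<^sup>2) * cmod z + w \<le> (t * (3 * (x + 1)\<^sup>2) + 1) * (E * M)"
    if "cmod z \<le> E * M" "w \<le> E * M" for x z w
    using mult_left_mono[OF that(1), of "t * (3 * (x + 1)\<^sup>2)"] that(2) t by (simp add: algebra_simps)
  have mono: "mono_on {0..} (\<lambda>x. (t * (3 * (x + 1)\<^sup>2) + 1) * (E * M))"
    using t M(1) E1 by (intro mono_onI mult_right_mono add_mono mult_left_mono power_mono) auto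
  show "y \<in> AC_loc"
  proof (rule AC_locI[OF continuous_on_yvg(1) finite_kinks deriv_y _ mono])
    fix x :: real assume "0 \<le> x"
    have "cmod (of_real (t * zigzag_slope x) * y x + v x)
        \<le> cmod (of_real (t * zigzag_slope x) * y x) + cmod (v x)"
      by (rule norm_triangle_ineq)
    also have "\<dots> \<le> (t * (3 * (x + 1)\<^sup>2) + 1) * (E * M)"
      using B[OF y v] t by (simp add: norm_mult abs_mult abs_zigzag_slope)
    finally show "cmod (of_real (t * zigzag_slope x) * y x + v x) \<le> (t * (3 * (x + 1)\<^sup>2) + 1) * (E * M)" .
  qed
  show "v \<in> AC_loc"
  proof (rule AC_locI[OF continuous_on_yvg(2) finite_kinks deriv_v _ mono])
    fix x :: real assume "0 \<le> x"
    let ?w = "exp (- 3 * t * zigzag x) * b2 (stretch t x)"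
    have "cmod (of_real ?w - of_real (t * zigzag_slope x) * v x)
        \<le> cmod (of_real ?w) + cmod (of_real (t * zigzag_slope x) * v x)"
      by (rule norm_triangle_ineq4)
    also have "\<dots> = t * (3 * (x + 1)\<^sup>2) * cmod (v x) + \<bar>?w\<bar>"
      using t by (simp only: norm_mult norm_of_real abs_mult abs_zigzag_slope abs_of_nonneg)
    also have "\<dots> \<le> (t * (3 * (x + 1)\<^sup>2) + 1) * (E * M)"
      using B[OF v small[of 3 "b2 (stretch t x)" x]] M(4) by simp
    finally show "cmod (of_real ?w - of_real (t * zigzag_slope x) * v x) \<le> (t * (3 * (x + 1)\<^sup>2) + 1) * (E * M)" .
  qed
qed

lemma is_quasi_expression_trial: "is_quasi_expression (\<lambda>x. t * riccati_primitive x) y u g"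
proof -
  have "(\<lambda>x. complex_of_real ((- (t * (9 / 5))) * (x + 1) ^ 5)) \<in> AC_loc"
    by (rule AC_loc_power)
  then have "(\<lambda>x. v x + complex_of_real ((- (t * (9 / 5))) * (x + 1) ^ 5) * y x) \<in> AC_loc"
    by (intro AC_loc_add AC_loc_mult AC_y AC_v)
  moreover have "v x + complex_of_real ((- (t * (9 / 5))) * (x + 1) ^ 5) * y x = u x" for x
    by (simp add: u_def)
  ultimately have "u \<in> AC_loc"
    by (simp only: eta_contract_eq)
  moreover have "y differentiable (at x) \<and> u x = vector_derivative y (at x) - of_real (t * riccati_primitive x) * y x \<and>
      u differentiable (at x) \<and>
      g x = - vector_derivative u (at x) - of_real (t * riccati_primitive x) * u x
        - of_real ((t * riccati_primitive x)\<^sup>2) * y x" if "0 < x" "x \<notin> kinks" for x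
  proof -
    define P Q r where "P = complex_of_real (t * (9 / 5 * (x + 1) ^ 5))"
      and "Q = complex_of_real (t * (9 * (x + 1) ^ 4))" and "r = complex_of_real (t * zigzag_slope x)"
    define B where "B = complex_of_real (exp (- 3 * t * zigzag x) * b2 (stretch t x))"
    have dy: "(y has_vector_derivative (r * y x + v x)) (at x)"
      using deriv_y[OF that] by (simp add: r_def)
    have dv: "(v has_vector_derivative (B - r * v x)) (at x)"
      using deriv_v[OF that] by (simp add: r_def B_def)
    have "((\<lambda>x. complex_of_real (t * (9 / 5 * (x + 1) ^ 5))) has_vector_derivative Q) (at x)"
      unfolding Q_def by (intro has_vector_derivative_of_real) (auto intro!: derivative_eq_intros)
    with dy dv have du: "(u has_vector_derivative (B - r * v x - (P * (r * y x + v x) + Q * y x))) (at x)"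
      unfolding u_def[abs_def] P_def by (intro has_vector_derivative_diff has_vector_derivative_mult)
    have s: "complex_of_real (t * riccati_primitive x) = r + P"
      by (simp add: riccati_primitive_def r_def P_def distrib_left)
    have "r\<^sup>2 = complex_of_real (t\<^sup>2 * (9 * (x + 1) ^ 4))"
      by (simp only: r_def of_real_power[symmetric] power_mult_distrib zigzag_slope_squared)
    then have "Q - r\<^sup>2 = of_real (t * (1 - t) * (9 * (x + 1) ^ 4))"
      unfolding Q_def by (simp only: of_real_diff[symmetric]) (simp add: power2_eq_square algebra_simps)
    then have g: "g x = (Q - r\<^sup>2) * y x - B"
      by (simp add: g_def B_def)
    have u: "u x = v x - P * y x"
      by (simp add: u_def P_def)
    show ?thesis
      using dy du unfolding vector_derivative_at[OF dy] vector_derivative_at[OF du] of_real_power s g u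
      by (auto intro: differentiableI_vector simp: algebra_simps power2_eq_square)
  qed
  note pointwise = this
  have neg: "negligible (insert 0 (kinks \<inter> {0..}))"
    by (simp add: negligible_kinks)
  have off: "0 < x \<and> x \<notin> kinks" if "0 \<le> x" "x \<notin> insert 0 (kinks \<inter> {0..})" for x
    using that by auto
  have "AE x in half_line. y differentiable (at x) \<and> u x = vector_derivative y (at x) - of_real (t * riccati_primitive x) * y x"
    by (rule AE_half_lineI[OF neg]) (use pointwise off in blast)
  moreover have "AE x in half_line. u differentiable (at x) \<and>
      g x = - vector_derivative u (at x) - of_real (t * riccati_primitive x) * u x
        - of_real ((t * riccati_primitive x)\<^sup>2) * y x"
    by (rule AE_half_lineI[OF neg]) (use pointwise off in blast)
  ultimately show ?thesis
    using AC_y by (simp add: is_quasi_expression_def is_quasi_derivative_def)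
qed

lemma square_integrable_y: "square_integrable y" and square_integrable_g: "square_integrable g"
  using continuous_on_yvg vanish_R by (auto intro: square_integrable_continuous)

lemma in_minimal_operator: "(abs_ltwo y, abs_ltwo g) \<in> minimal_operator (\<lambda>x. t * riccati_primitive x)"
  by (rule minimal_operatorI[OF is_quasi_expression_trial square_integrable_y square_integrable_g vanish_0 vanish_R(1)])

lemma factor_part_trial: "factor_part t y u = v"
  by (simp add: factor_part_def[abs_def] u_def fun_eq_iff)

lemma norm_squared_eq:
  assumes "square_integrable f" "\<And>x. R \<le> x \<Longrightarrow> f x = 0"
  shows "((\<lambda>x. (cmod (f x))\<^sup>2) has_integral (norm (abs_ltwo f))\<^sup>2) {0..R}"
  unfolding norm_abs_ltwo[OF assms(1)]
  using assms R_nonneg by (intro has_integral_half_line) (auto simp: square_integrable_def)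

lemma has_integral_profile:
  assumes "continuous_on UNIV F" "\<And>s. q \<le> s \<Longrightarrow> F s = 0"
  shows "((\<lambda>x. exp (- 2 * t * zigzag x) * F (stretch t x)) has_integral integral {0..q} F) {0..R}"
  using assms t pq R_nonneg stretch_R by (intro has_integral_stretch) auto

lemma cmod_y_squared: "(cmod (y x))\<^sup>2 = exp (4 * t * zigzag x) * (exp (- 2 * t * zigzag x) * (b (stretch t x))\<^sup>2)"
proof -
  have "(exp (t * zigzag x))\<^sup>2 = exp (4 * t * zigzag x) * exp (- 2 * t * zigzag x)"
    by (simp add: exp_add[symmetric] power2_eq_square)
  then show ?thesis
    by (simp add: y_def norm_mult power_mult_distrib del: of_real_mult)
qed

lemma norm_y_bounds:
  "integral {0..q} (\<lambda>s. (b s)\<^sup>2) \<le> (norm (abs_ltwo y))\<^sup>2"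
  "(norm (abs_ltwo y))\<^sup>2 \<le> exp (4 * t * pi) * integral {0..q} (\<lambda>s. (b s)\<^sup>2)"
proof -
  have n: "((\<lambda>x. (cmod (y x))\<^sup>2) has_integral (norm (abs_ltwo y))\<^sup>2) {0..R}"
    by (rule norm_squared_eq[OF square_integrable_y vanish_R(1)])
  have I: "((\<lambda>x. exp (- 2 * t * zigzag x) * (b (stretch t x))\<^sup>2) has_integral
      integral {0..q} (\<lambda>s. (b s)\<^sup>2)) {0..R}"
    using vanish by (intro has_integral_profile continuous_intros cont_b) auto
  have e: "1 \<le> exp (4 * t * zigzag x)" "exp (4 * t * zigzag x) \<le> exp (4 * t * pi)" for x
    using exp_zigzag_bounds[of "4 * t" x] t by auto
  show "integral {0..q} (\<lambda>s. (b s)\<^sup>2) \<le> (norm (abs_ltwo y))\<^sup>2"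
  proof (rule has_integral_le[OF I n])
    fix x
    let ?A = "exp (- 2 * t * zigzag x) * (b (stretch t x))\<^sup>2"
    have "1 * ?A \<le> exp (4 * t * zigzag x) * ?A"
      by (intro mult_right_mono e) simp
    then show "?A \<le> (cmod (y x))\<^sup>2"
      unfolding cmod_y_squared by (simp only: mult_1)
  qed
  show "(norm (abs_ltwo y))\<^sup>2 \<le> exp (4 * t * pi) * integral {0..q} (\<lambda>s. (b s)\<^sup>2)"
    by (rule has_integral_le[OF n has_integral_mult_right[OF I]])
      (unfold cmod_y_squared, intro mult_right_mono e, simp)
qed

lemma has_integral_v: "((\<lambda>x. (cmod (v x))\<^sup>2) has_integral integral {0..q} (\<lambda>s. (b1 s)\<^sup>2)) {0..R}"
proof -
  have "(cmod (v x))\<^sup>2 = exp (- 2 * t * zigzag x) * (b1 (stretch t x))\<^sup>2" for x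
    by (simp add: v_def norm_mult power_mult_distrib power2_eq_square exp_add[symmetric] del: of_real_mult)
  moreover have "((\<lambda>x. exp (- 2 * t * zigzag x) * (b1 (stretch t x))\<^sup>2) has_integral
      integral {0..q} (\<lambda>s. (b1 s)\<^sup>2)) {0..R}"
    using vanish by (intro has_integral_profile continuous_intros cont_b1) auto
  ultimately show ?thesis
    by simp
qed

text \<open>Since \<open>stretch t x \<le> x\<close>, the trial function lives on \<open>x \<ge> p\<close>, where \<open>r\<^sup>2 \<ge> 9 (p + 1)\<^sup>4\<close>.\<close>

lemma energy_upper_bound:
  assumes "1 \<le> t"
  shows "inner (abs_ltwo g) (abs_ltwo y) \<le>
    integral {0..q} (\<lambda>s. (b1 s)\<^sup>2) - t * (t - 1) * (9 * (p + 1) ^ 4) * (norm (abs_ltwo y))\<^sup>2"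
proof -
  let ?C = "t * (t - 1) * (9 * (p + 1) ^ 4)"
  have "inner (abs_ltwo g) (abs_ltwo y) = integral {0..R} (energy_density t y v)"
    using energy_identity[OF is_quasi_expression_trial square_integrable_y square_integrable_g
        vanish_0(1) R_nonneg vanish_R(1)]
    by (simp add: inner_ltwo_def factor_part_trial)
  also have "\<dots> \<le> integral {0..q} (\<lambda>s. (b1 s)\<^sup>2) - ?C * (norm (abs_ltwo y))\<^sup>2"
  proof (rule has_integral_le)
    show "(energy_density t y v has_integral integral {0..R} (energy_density t y v)) {0..R}"
      by (intro integrable_integral energy_density_integrable_on AC_y AC_v) simp
    show "((\<lambda>x. (cmod (v x))\<^sup>2 - ?C * (cmod (y x))\<^sup>2) has_integral
        integral {0..q} (\<lambda>s. (b1 s)\<^sup>2) - ?C * (norm (abs_ltwo y))\<^sup>2) {0..R}"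
      by (intro has_integral_diff has_integral_v has_integral_mult_right
          norm_squared_eq[OF square_integrable_y vanish_R(1)])
    fix x assume x: "x \<in> {0..R}"
    have "?C * (cmod (y x))\<^sup>2 \<le> t * (t - 1) * (9 * (x + 1) ^ 4) * (cmod (y x))\<^sup>2"
    proof (cases "p \<le> x")
      case True
      then show ?thesis
        using assms pq by (intro mult_right_mono mult_left_mono power_mono) auto
    qed (use x y_vanish_p[of x] in auto)
    then show "energy_density t y v x \<le> (cmod (v x))\<^sup>2 - ?C * (cmod (y x))\<^sup>2"
      by (simp add: energy_density_def algebra_simps)
  qed
  finally show ?thesis .
qed

text \<open>At \<open>t = 1\<close> the term of \<open>g\<close> that grows with \<open>x\<close> drops out.\<close>

lemma norm_g_bound:
  assumes "t = 1"
  shows "(norm (abs_ltwo g))\<^sup>2 \<le> integral {0..q} (\<lambda>s. (b2 s)\<^sup>2)"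
proof (rule has_integral_le[OF norm_squared_eq[OF square_integrable_g vanish_R(3)]])
  show "((\<lambda>x. exp (- 2 * t * zigzag x) * (b2 (stretch t x))\<^sup>2) has_integral
      integral {0..q} (\<lambda>s. (b2 s)\<^sup>2)) {0..R}"
    using vanish by (intro has_integral_profile continuous_intros cont_b2') auto
  fix x
  have "(exp (- 3 * t * zigzag x))\<^sup>2 = exp (- 6 * t * zigzag x)"
    by (simp add: power2_eq_square exp_add[symmetric])
  also have "\<dots> \<le> exp (- 2 * t * zigzag x)"
    using zigzag_bounds(1)[of x] assms by simp
  finally have "(exp (- 3 * t * zigzag x))\<^sup>2 * (b2 (stretch t x))\<^sup>2
      \<le> exp (- 2 * t * zigzag x) * (b2 (stretch t x))\<^sup>2"
    by (intro mult_right_mono) auto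
  moreover have "g x = - of_real (exp (- 3 * t * zigzag x) * b2 (stretch t x))"
    unfolding g_def using assms by simp
  ultimately show "(cmod (g x))\<^sup>2 \<le> exp (- 2 * t * zigzag x) * (b2 (stretch t x))\<^sup>2"
    by (simp add: norm_mult power_mult_distrib del: of_real_mult)
qed

end

section \<open>Bump profiles\<close>

lemma has_derivative_pos_part_power:
  "((\<lambda>s. max 0 s ^ Suc (Suc n)) has_real_derivative (real n + 2) * max 0 s ^ Suc n) (at s)"
proof -
  consider "s < 0" | "s = 0" | "s > 0"
    by linarith
  then show ?thesis
  proof cases
    case 1
    have "((\<lambda>s. 0) has_real_derivative 0) (at s)"
      by simp
    then have "((\<lambda>s. max 0 s ^ Suc (Suc n)) has_real_derivative 0) (at s)"
      by (rule has_field_derivative_transform_within_open[of _ _ _ "{..<0}"]) (use 1 in auto)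
    then show ?thesis
      using 1 by simp
  next
    case 2
    have "isCont (\<lambda>z. max 0 z ^ Suc n) s"
      by (intro continuous_intros)
    then have "\<exists>g. (\<forall>z. max 0 z ^ Suc (Suc n) - max 0 s ^ Suc (Suc n) = g z * (z - s)) \<and> isCont g s \<and> g s = 0"
      using 2 by (intro exI[of _ "\<lambda>z. max 0 z ^ Suc n"]) (auto simp: max_def)
    then have "((\<lambda>s. max 0 s ^ Suc (Suc n)) has_real_derivative 0) (at s)"
      by (simp only: CARAT_DERIV)
    then show ?thesis
      using 2 by simp
  next
    case 3
    have "((\<lambda>s. s ^ Suc (Suc n)) has_real_derivative (real n + 2) * s ^ Suc n) (at s)"
      using DERIV_pow[of "Suc (Suc n)" s] by (simp add: add.commute del: power_Suc)
    then have "((\<lambda>s. max 0 s ^ Suc (Suc n)) has_real_derivative (real n + 2) * s ^ Suc n) (at s)"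
      by (rule has_field_derivative_transform_within_open[of _ _ _ "{0<..}"]) (use 3 in auto)
    then show ?thesis
      using 3 by simp
  qed
qed

lemma has_derivative_pos_part_cube: "((\<lambda>s. max 0 s ^ 3) has_real_derivative 3 * max 0 s ^ 2) (at s)"
  and has_derivative_pos_part_square: "((\<lambda>s. max 0 s ^ 2) has_real_derivative 2 * max 0 s) (at s)"
  using has_derivative_pos_part_power[of 1 s] has_derivative_pos_part_power[of 0 s]
  by (simp_all add: eval_nat_numeral)

definition hat :: "real \<Rightarrow> real \<Rightarrow> real \<Rightarrow> real" where
  "hat p q s = max 0 (s - p) ^ 3 * max 0 (q - s) ^ 3"

definition hat1 :: "real \<Rightarrow> real \<Rightarrow> real \<Rightarrow> real" where
  "hat1 p q s = 3 * max 0 (s - p) ^ 2 * max 0 (q - s) ^ 3 - 3 * max 0 (s - p) ^ 3 * max 0 (q - s) ^ 2"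

definition hat2 :: "real \<Rightarrow> real \<Rightarrow> real \<Rightarrow> real" where
  "hat2 p q s = 6 * max 0 (s - p) * max 0 (q - s) ^ 3 - 18 * max 0 (s - p) ^ 2 * max 0 (q - s) ^ 2
     + 6 * max 0 (s - p) ^ 3 * max 0 (q - s)"

lemma has_derivative_hat: "(hat p q has_real_derivative hat1 p q s) (at s)"
  and has_derivative_hat1: "(hat1 p q has_real_derivative hat2 p q s) (at s)"
proof -
  have l: "((\<lambda>s. s - p) has_real_derivative 1) (at s)" and r: "((\<lambda>s. q - s) has_real_derivative - 1) (at s)"
    by (auto intro!: derivative_eq_intros)
  note d = DERIV_chain2[OF has_derivative_pos_part_cube l] DERIV_chain2[OF has_derivative_pos_part_square l]
    DERIV_chain2[OF has_derivative_pos_part_cube r] DERIV_chain2[OF has_derivative_pos_part_square r]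
  show "(hat p q has_real_derivative hat1 p q s) (at s)"
    unfolding hat_def[abs_def] hat1_def
    by (rule derivative_eq_intros d refl)+ (simp add: algebra_simps)
  show "(hat1 p q has_real_derivative hat2 p q s) (at s)"
    unfolding hat1_def[abs_def] hat2_def
    by (rule derivative_eq_intros d refl)+ (simp add: algebra_simps power2_eq_square power3_eq_cube)
qed

lemma hat_vanish: "s \<le> p \<or> q \<le> s \<Longrightarrow> hat p q s = 0 \<and> hat1 p q s = 0 \<and> hat2 p q s = 0"
  by (auto simp: hat_def hat1_def hat2_def)

lemma continuous_on_hat [continuous_intros]: "continuous_on S (hat p q)" "continuous_on S (hat1 p q)" "continuous_on S (hat2 p q)"
  unfolding hat_def[abs_def] hat1_def[abs_def] hat2_def[abs_def] by (intro continuous_intros)+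

lemma trial_hat:
  assumes "0 \<le> t" "0 \<le> p" "p \<le> q"
  shows "trial t p q (hat p q) (hat1 p q) (hat2 p q)"
  using assms hat_vanish by unfold_locales (auto intro: has_derivative_hat has_derivative_hat1 continuous_on_hat)

lemma hat_shift: "hat n (n + 1) s = hat 0 1 (s - n)" "hat1 n (n + 1) s = hat1 0 1 (s - n)"
    "hat2 n (n + 1) s = hat2 0 1 (s - n)"
  by (simp_all add: hat_def hat1_def hat2_def algebra_simps)

lemma integral_translate_profile:
  fixes F :: "real \<Rightarrow> real"
  assumes F: "continuous_on UNIV F" "\<And>s. s \<le> 0 \<Longrightarrow> F s = 0" and n: "0 \<le> n"
  shows "integral {0..n + 1} (\<lambda>s. F (s - n)) = integral {0..1} F"
proof -
  have "integral {0..n + 1} (\<lambda>s. F (s - n)) = integral {-n..1} F"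
    using integral_shift[of 0 "- n" "n + 1" F] F(1) by (auto simp: o_def intro: continuous_on_subset)
  also have "\<dots> = integral {-n..0} F + integral {0..1} F"
    using n by (intro Henstock_Kurzweil_Integration.integral_combine[symmetric] integrable_continuous_real
        continuous_on_subset[OF F(1)]) auto
  also have "integral {-n..0} F = integral {-n..0} (\<lambda>s. 0)"
    using F(2) by (intro integral_cong) auto
  finally show ?thesis
    by simp
qed

definition hat_mass :: real where "hat_mass = integral {0..1} (\<lambda>s. (hat 0 1 s)\<^sup>2)"
definition hat1_mass :: real where "hat1_mass = integral {0..1} (\<lambda>s. (hat1 0 1 s)\<^sup>2)"
definition hat2_mass :: real where "hat2_mass = integral {0..1} (\<lambda>s. (hat2 0 1 s)\<^sup>2)"

lemma integral_hat:
  assumes "0 \<le> n"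
  shows "integral {0..n + 1} (\<lambda>s. (hat n (n + 1) s)\<^sup>2) = hat_mass"
    "integral {0..n + 1} (\<lambda>s. (hat1 n (n + 1) s)\<^sup>2) = hat1_mass"
    "integral {0..n + 1} (\<lambda>s. (hat2 n (n + 1) s)\<^sup>2) = hat2_mass"
  unfolding hat_shift hat_mass_def hat1_mass_def hat2_mass_def using assms hat_vanish[of _ 0 1]
  by (auto intro!: integral_translate_profile continuous_intros)

lemma hat_mass_pos: "0 < hat_mass"
proof -
  have "hat_mass \<noteq> 0"
  proof
    assume "hat_mass = 0"
    then have "\<forall>s\<in>{0..1}. (hat 0 1 s)\<^sup>2 = 0"
      unfolding hat_mass_def by (subst (asm) integral_eq_0_iff) (auto intro!: continuous_intros)
    then have "hat 0 1 (1 / 2) = 0"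
      by auto
    then show False
      by (simp add: hat_def)
  qed
  moreover have "0 \<le> hat_mass"
    unfolding hat_mass_def by (intro Henstock_Kurzweil_Integration.integral_nonneg integrable_continuous_real continuous_intros) auto
  ultimately show ?thesis
    by simp
qed

section \<open>Semi-boundedness and its failure\<close>

text \<open>The lower bound uses only \<open>r\<^sup>2 \<ge> 9\<close> on the half-line.\<close>

lemma energy_minimal_operator:
  assumes "(f, h) \<in> minimal_operator (\<lambda>x. t * riccati_primitive x)" "0 \<le> t" "t \<le> 1"
  shows "Im (cinner h f) = 0" "9 * t * (1 - t) * (norm f)\<^sup>2 \<le> inner h f"
proof -
  obtain y u g R where *: "f = abs_ltwo y" "h = abs_ltwo g"
    and q: "is_quasi_expression (\<lambda>x. t * riccati_primitive x) y u g"
    and sq: "square_integrable y" "square_integrable g" and y0: "y 0 = 0" "R > 0" "\<And>x. R \<le> x \<Longrightarrow> y x = 0"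
    using assms(1) by (rule minimal_operatorE) (rule that; assumption)
  let ?e = "energy_density t y (factor_part t y u)"
  note AC = quasi_expression_factorization(1,2)[OF q]
  have E: "cinner h f = of_real (integral {0..R} ?e)"
    unfolding * using energy_identity[OF q sq y0(1) _ y0(3)] y0(2) by simp
  then show "Im (cinner h f) = 0"
    by simp
  have "9 * t * (1 - t) * (norm f)\<^sup>2 \<le> integral {0..R} ?e"
  proof (rule has_integral_le)
    have "((\<lambda>x. (cmod (y x))\<^sup>2) has_integral (norm f)\<^sup>2) {0..R}"
      unfolding * norm_abs_ltwo[OF sq(1)]
      using y0 sq by (intro has_integral_half_line) (auto simp: square_integrable_def)
    then show "((\<lambda>x. 9 * t * (1 - t) * (cmod (y x))\<^sup>2) has_integral 9 * t * (1 - t) * (norm f)\<^sup>2) {0..R}"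
      by (rule has_integral_mult_right)
    show "(?e has_integral integral {0..R} ?e) {0..R}"
      by (intro integrable_integral energy_density_integrable_on AC) simp
    fix x assume "x \<in> {0..R}"
    then have "1 \<le> (x + 1) ^ 4"
      by (intro one_le_power) simp
    then have "9 * t * (1 - t) * 1 * (cmod (y x))\<^sup>2 \<le> 9 * t * (1 - t) * (x + 1) ^ 4 * (cmod (y x))\<^sup>2"
      using assms by (intro mult_right_mono mult_left_mono) auto
    also have "\<dots> = t * (1 - t) * (9 * (x + 1) ^ 4) * (cmod (y x))\<^sup>2"
      by simp
    also have "\<dots> \<le> ?e x"
      by (simp add: energy_density_def)
    finally show "9 * t * (1 - t) * (cmod (y x))\<^sup>2 \<le> ?e x"
      by simp
  qed
  then show "9 * t * (1 - t) * (norm f)\<^sup>2 \<le> inner h f"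
    using E by (simp add: inner_ltwo_def)
qed

lemma semi_bounded_le_1:
  assumes "0 \<le> t" "t \<le> 1"
  shows "semi_bounded (minimal_operator (\<lambda>x. t * riccati_primitive x))"
  unfolding semi_bounded_def
proof (intro exI[of _ 0] ballI, clarify)
  fix f h assume "(f, h) \<in> minimal_operator (\<lambda>x. t * riccati_primitive x)"
  note e = energy_minimal_operator[OF this assms]
  have "0 \<le> 9 * t * (1 - t) * (norm f)\<^sup>2"
    using assms by simp
  then have "0 \<le> inner h f"
    using e(2) by linarith
  then show "cinner h f \<in> complex_of_real ` {0..}"
    using e(1) by (intro image_eqI[of _ _ "Re (cinner h f)"]) (auto simp: complex_eq_iff inner_ltwo_def)
qed

lemma semi_bounded_lower_bound:
  assumes "semi_bounded (minimal_operator s)"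
  obtains z where "\<And>f h. (f, h) \<in> minimal_operator s \<Longrightarrow> z * (norm f)\<^sup>2 \<le> inner h f"
proof -
  obtain z where z: "\<forall>(f, h)\<in>minimal_operator s. norm f = 1 \<longrightarrow> cinner h f \<in> complex_of_real ` {z..}"
    using assms by (auto simp: semi_bounded_def)
  have "z * (norm f)\<^sup>2 \<le> inner h f" if fh: "(f, h) \<in> minimal_operator s" for f h
  proof (cases "f = 0")
    case False
    let ?r = "inverse (norm f)"
    have "(?r *\<^sub>R f, ?r *\<^sub>R h) \<in> minimal_operator s"
      using minimal_operator_linear[OF fh fh, of "of_real ?r" 0]
      by (simp add: scaleR_eq_cscale cscale_zero)
    moreover have "norm (?r *\<^sub>R f) = 1"
      using False by simp
    ultimately have "cinner (?r *\<^sub>R h) (?r *\<^sub>R f) \<in> complex_of_real ` {z..}"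
      using z by blast
    then have "z \<le> inner (?r *\<^sub>R h) (?r *\<^sub>R f)"
      by (auto simp: inner_ltwo_def)
    then have "z * (norm f)\<^sup>2 \<le> ?r * ?r * inner h f * (norm f)\<^sup>2"
      by (intro mult_right_mono) auto
    then show ?thesis
      using False by (simp add: power2_eq_square field_simps)
  qed simp
  then show ?thesis
    by (rule that)
qed

text \<open>Translating the profile by \<open>n\<close> keeps \<open>\<integral> \<bar>v\<bar>\<^sup>2\<close> fixed and the norm bounded away from zero,
  while the negative part of the energy grows like \<open>n\<^sup>4\<close> times the squared norm.\<close>

lemma not_semi_bounded_gt_1:
  assumes "1 < t"
  shows "\<not> semi_bounded (minimal_operator (\<lambda>x. t * riccati_primitive x))"
proof
  assume "semi_bounded (minimal_operator (\<lambda>x. t * riccati_primitive x))"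
  then obtain z where z: "\<And>f h. (f, h) \<in> minimal_operator (\<lambda>x. t * riccati_primitive x) \<Longrightarrow> z * (norm f)\<^sup>2 \<le> inner h f"
    by (rule semi_bounded_lower_bound) (rule that, blast)
  have bound: "(t * (t - 1) * (9 * (n + 1) ^ 4) + z) * hat_mass \<le> hat1_mass"
    if n: "0 \<le> n" "0 \<le> t * (t - 1) * (9 * (n + 1) ^ 4) + z" for n
  proof -
    interpret trial t n "n + 1" "hat n (n + 1)" "hat1 n (n + 1)" "hat2 n (n + 1)"
      using assms n by (intro trial_hat) auto
    let ?N = "(norm (abs_ltwo y))\<^sup>2"
    have "z * ?N \<le> hat1_mass - t * (t - 1) * (9 * (n + 1) ^ 4) * ?N"
      using z[OF in_minimal_operator] energy_upper_bound assms n by (simp add: integral_hat)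
    then have "(t * (t - 1) * (9 * (n + 1) ^ 4) + z) * ?N \<le> hat1_mass"
      by (simp add: algebra_simps)
    moreover have "hat_mass \<le> ?N"
      using norm_y_bounds(1) n by (simp add: integral_hat)
    ultimately show ?thesis
      using mult_left_mono[of hat_mass ?N] n by fastforce
  qed
  \<comment> \<open>The translation \<open>n\<close> is chosen so large that the bound just proved would force
      \<open>\<bar>hat1_mass\<bar> + 1 \<le> hat1_mass\<close>.\<close>
  define C where "C = (\<bar>hat1_mass\<bar> + 1) / hat_mass + \<bar>z\<bar>"
  define n where "n = C / (t * (t - 1))"
  have C: "0 \<le> C"
    using hat_mass_pos by (simp add: C_def)
  have tt: "0 < t * (t - 1)"
    using assms by simp
  have n: "0 \<le> n"
    using C tt by (simp add: n_def)
  have "n + 1 \<le> 9 * (n + 1) ^ 4"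
    using n power_increasing[of 1 4 "n + 1"] by simp
  then have "t * (t - 1) * (n + 1) \<le> t * (t - 1) * (9 * (n + 1) ^ 4)"
    using tt by (intro mult_left_mono) auto
  moreover have "C \<le> t * (t - 1) * (n + 1)"
  proof -
    have "t * (t - 1) \<noteq> 0"
      using tt by linarith
    then have "t * (t - 1) * n = C"
      by (metis n_def nonzero_mult_div_cancel_left times_divide_eq_right)
    then show ?thesis
      using tt by (simp only: distrib_left mult_1_right)
  qed
  ultimately have ge: "(\<bar>hat1_mass\<bar> + 1) / hat_mass \<le> t * (t - 1) * (9 * (n + 1) ^ 4) + z"
    unfolding C_def by linarith
  moreover have "0 \<le> (\<bar>hat1_mass\<bar> + 1) / hat_mass"
    using hat_mass_pos by simp
  ultimately have "(t * (t - 1) * (9 * (n + 1) ^ 4) + z) * hat_mass \<le> hat1_mass"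
    using bound[OF n] by linarith
  moreover have "\<bar>hat1_mass\<bar> + 1 \<le> (t * (t - 1) * (9 * (n + 1) ^ 4) + z) * hat_mass"
    using ge hat_mass_pos by (simp add: pos_divide_le_eq)
  ultimately show False
    by linarith
qed

text \<open>Profiles supported in \<open>[n, n + 1]\<close> give orthogonal trial functions whose norms, as well as
  the norms of their images, are controlled independently of \<open>n\<close>.\<close>

lemma no_compact_extension_eq_1:
  "\<not> has_extension_with_compact_resolvent (minimal_operator (\<lambda>x. 1 * riccati_primitive x))"
proof -
  have tr: "trial 1 (real n) (real n + 1) (hat (real n) (real n + 1)) (hat1 (real n) (real n + 1))
      (hat2 (real n) (real n + 1))" for n
    by (intro trial_hat) auto
  define y g where "y n = trial.y 1 (hat (real n) (real n + 1))"
    and "g n = trial.g 1 (hat (real n) (real n + 1)) (hat2 (real n) (real n + 1))" for n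
  have sq: "square_integrable (y n)" for n
    unfolding y_def by (rule trial.square_integrable_y[OF tr])
  have ny: "hat_mass \<le> (norm (abs_ltwo (y n)))\<^sup>2" "(norm (abs_ltwo (y n)))\<^sup>2 \<le> exp (4 * pi) * hat_mass" for n
    using trial.norm_y_bounds[OF tr, of n] by (simp_all add: y_def integral_hat)
  have ng: "(norm (abs_ltwo (g n)))\<^sup>2 \<le> hat2_mass" for n
    using trial.norm_g_bound[OF tr refl, of n] by (simp add: g_def integral_hat)
  have orth: "inner (abs_ltwo (y m)) (abs_ltwo (y n)) = 0" if "m \<noteq> n" for m n
  proof -
    have prod: "y m x * cnj (y n x) = 0" for x
    proof -
      let ?s = "stretch 1 x"
      have "?s \<le> real m \<or> real m + 1 \<le> ?s \<or> ?s \<le> real n \<or> real n + 1 \<le> ?s"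
        using that by linarith
      then have "hat (real m) (real m + 1) ?s = 0 \<or> hat (real n) (real n + 1) ?s = 0"
        using hat_vanish by blast
      then show ?thesis
        by (auto simp: y_def trial.y_def[OF tr])
    qed
    show ?thesis
      by (simp only: inner_ltwo_def cinner_abs_ltwo[OF sq sq] prod) simp
  qed
  have le_square: "a \<le> 1 + B" if "a\<^sup>2 \<le> B" for a B :: real
  proof -
    have "2 * a \<le> 1 + a\<^sup>2"
      using sum_squares_bound[of 1 a] by simp
    then show ?thesis
      using that zero_le_power2[of a] by linarith
  qed
  show ?thesis
  proof (rule no_extension_with_compact_resolvent[where y = "\<lambda>n. abs_ltwo (y n)" and g = "\<lambda>n. abs_ltwo (g n)"
        and M = "1 + exp (4 * pi) * hat_mass + hat2_mass" and \<delta> = "sqrt hat_mass"])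
    fix n
    show "(abs_ltwo (y n), abs_ltwo (g n)) \<in> minimal_operator (\<lambda>x. 1 * riccati_primitive x)"
      unfolding y_def g_def by (rule trial.in_minimal_operator[OF tr])
    have "0 \<le> hat2_mass"
      by (rule order_trans[OF zero_le_power2 ng[of n]])
    moreover have "0 \<le> exp (4 * pi) * hat_mass"
      using hat_mass_pos by simp
    ultimately show "norm (abs_ltwo (y n)) \<le> 1 + exp (4 * pi) * hat_mass + hat2_mass"
      "norm (abs_ltwo (g n)) \<le> 1 + exp (4 * pi) * hat_mass + hat2_mass"
      using le_square[OF ny(2)[of n]] le_square[OF ng[of n]] by linarith+
  next
    fix m n :: nat assume "m \<noteq> n"
    have "(dist (abs_ltwo (y m)) (abs_ltwo (y n)))\<^sup>2 = (norm (abs_ltwo (y m)))\<^sup>2 + (norm (abs_ltwo (y n)))\<^sup>2"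
      using orth[OF \<open>m \<noteq> n\<close>]
      by (simp add: dist_norm power2_norm_eq_inner inner_diff_left inner_diff_right inner_commute)
    then have "hat_mass \<le> (dist (abs_ltwo (y m)) (abs_ltwo (y n)))\<^sup>2"
      using ny(1)[of m] by (simp add: add_increasing2)
    then show "sqrt hat_mass \<le> dist (abs_ltwo (y m)) (abs_ltwo (y n))"
      by (intro real_le_lsqrt) auto
  next
    show "0 < sqrt hat_mass"
      using hat_mass_pos by simp
  qed
qed

section \<open>Compactness of form-bounded sets\<close>

lemma integrable_inverse_square: "integrable half_line (\<lambda>x. 1 / (x + 1)\<^sup>2 :: real)"
proof -
  have lim: "((\<lambda>x::real. - 1 / (x + 1)) \<longlongrightarrow> 0) at_top"
    by (intro real_tendsto_divide_at_top[OF tendsto_const] filterlim_tendsto_add_at_top[OF tendsto_const])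
      (auto simp: add.commute[of _ 1] intro!: filterlim_tendsto_add_at_top[OF tendsto_const] filterlim_ident)
  have der: "((\<lambda>x::real. - 1 / (x + 1)) has_real_derivative 1 / (x + 1)\<^sup>2) (at x)" if "0 \<le> x" for x
    using that by (auto intro!: derivative_eq_intros simp: power2_eq_square)
  have "(\<integral>\<^sup>+x. ennreal (1 / (x + 1)\<^sup>2) * indicator {0..} x \<partial>lborel) = ennreal (0 - (- 1 / (0 + 1)))"
    by (rule nn_integral_FTC_atLeast[OF _ der _ lim]) auto
  moreover have "(\<integral>\<^sup>+x. ennreal (indicator {0..} x *\<^sub>R (1 / (x + 1)\<^sup>2)) \<partial>lborel)
      = (\<integral>\<^sup>+x. ennreal (1 / (x + 1)\<^sup>2) * indicator {0..} x \<partial>lborel)"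
    by (intro nn_integral_cong) (auto simp: indicator_def)
  ultimately have "integrable lborel (\<lambda>x::real. indicator {0..} x *\<^sub>R (1 / (x + 1)\<^sup>2))"
    by (intro integrableI_nonneg) auto
  then have "integrable lebesgue (\<lambda>x::real. indicator {0..} x *\<^sub>R (1 / (x + 1)\<^sup>2))"
    by (simp add: integrable_completion)
  then show ?thesis
    by (subst integrable_restrict_space) auto
qed

text \<open>The information about a domain element of energy at most \<open>C\<close> from which compactness is
  deduced; \<open>v\<close> stands for \<open>y' - t r y\<close>.\<close>

definition form_bounded :: "real \<Rightarrow> real \<Rightarrow> (real \<Rightarrow> complex) \<Rightarrow> (real \<Rightarrow> complex) \<Rightarrow> bool" where
  "form_bounded t C y v \<longleftrightarrow> y \<in> AC_loc \<and> v \<in> AC_loc \<and> y 0 = 0 \<and> square_integrable y \<and>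
     (AE x in half_line. (y has_vector_derivative (v x + of_real (t * zigzag_slope x) * y x)) (at x)) \<and>
     (\<forall>X\<ge>0. integral {0..X} (energy_density t y v) \<le> C)"

lemma energy_density_nonneg: "0 \<le> t \<Longrightarrow> t \<le> 1 \<Longrightarrow> 0 \<le> energy_density t y v x"
  by (simp add: energy_density_def)

text \<open>The upper end \<open>R\<close> in the energy identity may be any point beyond the support, so the energy up
  to an arbitrary \<open>X\<close> is bounded by the value of the form.\<close>

lemma form_bounded_representative:
  assumes "(f, h) \<in> minimal_operator (\<lambda>x. t * riccati_primitive x)" "inner h f \<le> C" "0 \<le> t" "t \<le> 1"
  shows "\<exists>y v. f = abs_ltwo y \<and> form_bounded t C y v"
proof -
  obtain y u g R where *: "f = abs_ltwo y" "h = abs_ltwo g"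
    and q: "is_quasi_expression (\<lambda>x. t * riccati_primitive x) y u g"
    and sq: "square_integrable y" "square_integrable g" and y0: "y 0 = 0" "R > 0" "\<And>x. R \<le> x \<Longrightarrow> y x = 0"
    using assms(1) by (rule minimal_operatorE) (rule that; assumption)
  define v where "v = factor_part t y u"
  note fac = quasi_expression_factorization[OF q, folded v_def]
  have "integral {0..X} (energy_density t y v) \<le> C" if "0 \<le> X" for X
  proof -
    have "integral {0..X} (energy_density t y v) \<le> integral {0..max R X} (energy_density t y v)"
      by (intro integral_subset_le energy_density_integrable_on fac)
        (use that in \<open>auto simp: energy_density_nonneg assms\<close>)
    also have "\<dots> = inner h f"
      unfolding * inner_ltwo_def v_def
      using y0 by (subst energy_identity[OF q sq y0(1), of "max R X"]) auto
    finally show ?thesis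
      using assms(2) by linarith
  qed
  then show ?thesis
    using fac y0 sq * by (intro exI[of _ y] exI[of _ v]) (simp add: form_bounded_def)
qed

lemma slope_derivative_bound:
  fixes y v :: complex
  assumes "0 \<le> t" "t \<le> 1"
  shows "(cmod (v + of_real (t * zigzag_slope x) * y))\<^sup>2 \<le> 2 * ((cmod v)\<^sup>2 + 9 * (x + 1) ^ 4 * (cmod y)\<^sup>2)"
proof -
  let ?w = "of_real (t * zigzag_slope x) * y"
  have "(cmod (v + ?w))\<^sup>2 \<le> (cmod v + cmod ?w)\<^sup>2"
    by (intro power_mono norm_triangle_ineq) simp
  also have "\<dots> \<le> 2 * ((cmod v)\<^sup>2 + (cmod ?w)\<^sup>2)"
    using sum_squares_bound[of "cmod v" "cmod ?w"] by (simp add: power2_sum)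
  also have "(cmod ?w)\<^sup>2 = t\<^sup>2 * (9 * (x + 1) ^ 4 * (cmod y)\<^sup>2)"
    by (simp add: norm_mult power_mult_distrib zigzag_slope_squared)
  also have "\<dots> \<le> 1 * (9 * (x + 1) ^ 4 * (cmod y)\<^sup>2)"
    using assms by (intro mult_right_mono power_le_one) auto
  finally show ?thesis
    by simp
qed

lemma energy_dominates:
  assumes "0 < t" "t < 1"
  shows "(cmod (v x))\<^sup>2 + 9 * (x + 1) ^ 4 * (cmod (y x))\<^sup>2 \<le> energy_density t y v x / (t * (1 - t))"
proof -
  let ?k = "t * (1 - t)"
  have k: "0 < ?k" "?k \<le> 1"
    using assms by (auto intro: mult_le_one)
  then have "?k * (cmod (v x))\<^sup>2 \<le> (cmod (v x))\<^sup>2"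
    by (intro mult_left_le_one_le) auto
  then have "?k * ((cmod (v x))\<^sup>2 + 9 * (x + 1) ^ 4 * (cmod (y x))\<^sup>2) \<le> energy_density t y v x"
    by (simp add: energy_density_def algebra_simps)
  then show ?thesis
    using k by (simp add: pos_le_divide_eq mult.commute)
qed

text \<open>The derivative of \<open>(x + 1)\<^sup>2 \<bar>y\<bar>\<^sup>2\<close> is dominated by a multiple of the energy density: the growth
  \<open>r\<^sup>2 = 9 (x + 1)\<^sup>4\<close> is what pays for the weight. Integrating from \<open>0\<close>, where \<open>y\<close> vanishes,
  gives a decay rate whose square is integrable.\<close>

lemma form_bounded_decay:
  assumes fb: "form_bounded t C y v" and t: "0 < t" "t < 1" and "0 \<le> x"
  shows "((x + 1) * cmod (y x))\<^sup>2 \<le> C / (t * (1 - t))"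
proof -
  let ?e = "energy_density t y v" and ?k = "t * (1 - t)"
  have k: "0 < ?k"
    using t by simp
  have AC: "y \<in> AC_loc" "v \<in> AC_loc" and y0: "y 0 = 0"
    and dy: "AE x in half_line. (y has_vector_derivative (v x + of_real (t * zigzag_slope x) * y x)) (at x)"
    and eC: "integral {0..x} ?e \<le> C"
    using fb \<open>0 \<le> x\<close> by (auto simp: form_bounded_def)
  define W where "W s = of_real (1 * (s + 1) ^ 2) * (y s * cnj (y s))" for s
  define W' where "W' s = of_real ((s + 1) ^ 2) * (y s * cnj (v s + of_real (t * zigzag_slope s) * y s)
      + (v s + of_real (t * zigzag_slope s) * y s) * cnj (y s)) + of_real (2 * (s + 1)) * (y s * cnj (y s))" for s
  have W: "W \<in> AC_loc"
    unfolding W_def[abs_def] by (intro AC_loc_mult AC_loc_power AC_loc_cnj AC)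
  have "AE s in half_line. (W has_vector_derivative W' s) (at s)"
    using dy
  proof eventually_elim
    case (elim s)
    have "((\<lambda>s. complex_of_real (1 * (s + 1) ^ 2)) has_vector_derivative of_real (2 * (s + 1))) (at s)"
      by (intro has_vector_derivative_of_real) (auto intro!: derivative_eq_intros)
    from has_vector_derivative_mult[OF this has_vector_derivative_mult[OF elim has_vector_derivative_cnj[OF elim]]]
    show ?case
      unfolding W_def[abs_def] W'_def by simp
  qed
  from AC_loc_has_integral[OF W this order_refl \<open>0 \<le> x\<close>]
  have int: "(W' has_integral W x) {0..x}"
    using y0 by (simp add: W_def)
  have bound: "cmod (W' s) \<le> ?e s / ?k" if s: "s \<in> {0..x}" for s
  proof -
    define a b d where "a = cmod (y s)" and "b = cmod (v s)" and "d = s + 1"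
    have d: "1 \<le> d"
      using s by (simp add: d_def)
    define z where "z = v s + of_real (t * zigzag_slope s) * y s"
    have "cmod z \<le> cmod (v s) + cmod (of_real (t * zigzag_slope s) * y s)"
      unfolding z_def by (rule norm_triangle_ineq)
    also have "\<dots> = b + t * (3 * d\<^sup>2) * a"
      using t by (simp add: norm_mult abs_mult abs_zigzag_slope a_def b_def d_def)
    also have "\<dots> \<le> b + 1 * (3 * d\<^sup>2) * a"
      using t by (intro add_left_mono mult_right_mono) (auto simp: a_def)
    finally have z: "cmod z \<le> b + 3 * d\<^sup>2 * a"
      by simp
    have "cmod (W' s) \<le> cmod (of_real (d\<^sup>2) * (y s * cnj z + z * cnj (y s))) + cmod (of_real (2 * d) * (y s * cnj (y s)))"
      unfolding W'_def d_def z_def by (rule norm_triangle_ineq)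
    also have "\<dots> = d\<^sup>2 * cmod (y s * cnj z + z * cnj (y s)) + 2 * d * (a * a)"
      using d by (simp add: norm_mult a_def norm_power del: of_real_mult of_real_add)
    also have "\<dots> \<le> d\<^sup>2 * (2 * (a * cmod z)) + 2 * d * (a * a)"
      using norm_triangle_ineq[of "y s * cnj z" "z * cnj (y s)"]
      by (intro add_right_mono mult_left_mono) (simp_all add: norm_mult a_def mult.commute)
    also have "\<dots> \<le> d\<^sup>2 * (2 * (a * (b + 3 * d\<^sup>2 * a))) + 2 * d ^ 4 * (a * a)"
    proof -
      have "d \<le> d ^ 4"
        using d power_increasing[of 1 4 d] by simp
      then have "2 * d * (a * a) \<le> 2 * d ^ 4 * (a * a)"
        by (intro mult_right_mono) auto
      then show ?thesis
        using z by (intro add_mono mult_left_mono) (auto simp: a_def)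
    qed
    also have "\<dots> = 2 * (d\<^sup>2 * a) * b + 8 * (d\<^sup>2 * a)\<^sup>2"
      by (simp add: power2_eq_square eval_nat_numeral algebra_simps)
    also have "\<dots> \<le> b\<^sup>2 + 9 * (d\<^sup>2 * a)\<^sup>2"
      using sum_squares_bound[of "d\<^sup>2 * a" b] by simp
    also have "\<dots> = (cmod (v s))\<^sup>2 + 9 * (s + 1) ^ 4 * (cmod (y s))\<^sup>2"
      by (simp add: a_def b_def d_def power_mult_distrib flip: power_mult)
    also have "\<dots> \<le> ?e s / ?k"
      by (rule energy_dominates[OF t])
    finally show ?thesis .
  qed
  have "cmod (W x) = cmod (integral {0..x} W')"
    using int by (simp add: integral_unique)
  also have "\<dots> \<le> integral {0..x} (\<lambda>s. ?e s / ?k)"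
  proof (rule integral_norm_bound_integral)
    show "W' integrable_on {0..x}"
      using int by blast
    show "(\<lambda>s. ?e s / ?k) integrable_on {0..x}"
      by (intro integrable_on_divide energy_density_integrable_on AC) simp
  qed (rule bound)
  also have "\<dots> = integral {0..x} ?e / ?k"
    by simp
  also have "\<dots> \<le> C / ?k"
    using eC k by (intro divide_right_mono) auto
  also have "cmod (W x) = ((x + 1) * cmod (y x))\<^sup>2"
    using \<open>0 \<le> x\<close> by (simp add: W_def norm_mult norm_power power2_eq_square del: of_real_add)
  finally show ?thesis .
qed

text \<open>An integral of \<open>\<bar>y'\<bar>\<close> is estimated by \<open>\<bar>y'\<bar> \<le> \<eta> + \<bar>y'\<bar>\<^sup>2 / \<eta>\<close>; choosing \<open>\<eta>\<close> large and then the
  interval short makes the bound small, uniformly in \<open>y\<close>.\<close>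

lemma form_bounded_equicontinuous:
  assumes fb: "form_bounded t C y v" and t: "0 < t" "t < 1" and ab: "0 \<le> a" "a \<le> b" and "0 < \<eta>"
  shows "cmod (y b - y a) \<le> \<eta> * (b - a) + 2 * C / (t * (1 - t)) / \<eta>"
proof -
  let ?e = "energy_density t y v" and ?k = "t * (1 - t)"
  let ?y' = "\<lambda>x. v x + of_real (t * zigzag_slope x) * y x"
  have k: "0 < ?k"
    using t by simp
  have AC: "y \<in> AC_loc" "v \<in> AC_loc"
    and dy: "AE x in half_line. (y has_vector_derivative ?y' x) (at x)"
    and eC: "integral {0..b} ?e \<le> C"
    using fb ab by (auto simp: form_bounded_def)
  have int: "(?y' has_integral (y b - y a)) {a..b}"
    by (rule AC_loc_has_integral[OF AC(1) dy ab])
  have ei: "?e integrable_on {a..b}" "?e integrable_on {0..b}"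
    using energy_density_integrable_on[OF AC] ab by auto
  have le: "integral {a..b} ?e \<le> integral {0..b} ?e"
    using ei ab t by (intro integral_subset_le) (auto simp: energy_density_nonneg)
  have bound: "cmod (?y' x) \<le> \<eta> + 2 / ?k / \<eta> * ?e x" for x
  proof -
    let ?n = "cmod (?y' x)"
    have "\<eta> * ?n \<le> 2 * \<eta> * ?n"
      using \<open>0 < \<eta>\<close> by (intro mult_right_mono) auto
    also have "\<dots> \<le> \<eta>\<^sup>2 + ?n\<^sup>2"
      by (rule sum_squares_bound)
    also have "?n\<^sup>2 \<le> 2 * (?e x / ?k)"
      using t by (intro order_trans[OF slope_derivative_bound mult_left_mono[OF energy_dominates]]) auto
    finally have "\<eta> * ?n \<le> \<eta>\<^sup>2 + 2 * (?e x / ?k)"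
      by simp
    then have "?n \<le> (\<eta>\<^sup>2 + 2 * (?e x / ?k)) / \<eta>"
      using \<open>0 < \<eta>\<close> by (simp add: pos_le_divide_eq mult.commute)
    also have "\<dots> = \<eta> + 2 / ?k / \<eta> * ?e x"
      using \<open>0 < \<eta>\<close> by (simp add: add_divide_distrib power2_eq_square)
    finally show ?thesis .
  qed
  have "((\<lambda>x. \<eta>) has_integral \<eta> * (b - a)) {a..b}"
    using has_integral_const_real[of \<eta> a b] ab by (simp add: mult.commute)
  then have major: "((\<lambda>x. \<eta> + 2 / ?k / \<eta> * ?e x) has_integral (\<eta> * (b - a) + 2 / ?k / \<eta> * integral {a..b} ?e)) {a..b}"
    by (intro has_integral_add has_integral_mult_right integrable_integral ei)
  have "cmod (y b - y a) = cmod (integral {a..b} ?y')"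
    using int by (simp add: integral_unique)
  also have "\<dots> \<le> integral {a..b} (\<lambda>x. \<eta> + 2 / ?k / \<eta> * ?e x)"
  proof (rule integral_norm_bound_integral)
    show "?y' integrable_on {a..b}"
      using int by blast
    show "(\<lambda>x. \<eta> + 2 / ?k / \<eta> * ?e x) integrable_on {a..b}"
      using major by blast
  qed (rule bound)
  also have "\<dots> = \<eta> * (b - a) + 2 / ?k / \<eta> * integral {a..b} ?e"
    using major by (rule integral_unique)
  also have "\<dots> \<le> \<eta> * (b - a) + 2 / ?k / \<eta> * C"
    using eC le k \<open>0 < \<eta>\<close> by (intro add_left_mono mult_left_mono) auto
  finally show ?thesis
    by simp
qed

text \<open>A diagonal subsequence converges at the rational points; equicontinuity extends the convergence
  to all points.\<close>

lemma pointwise_convergent_subsequence: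
  assumes fb: "\<And>n::nat. form_bounded t C (y n) (v n)" and t: "0 < t" "t < 1"
  shows "\<exists>k. strict_mono (k::nat \<Rightarrow> nat) \<and> (\<forall>x\<ge>0. convergent (\<lambda>n. y (k n) x))"
proof -
  define K where "K = C / (t * (1 - t))"
  have K: "((x + 1) * cmod (y n x))\<^sup>2 \<le> K" if "0 \<le> x" for n x
    unfolding K_def by (rule form_bounded_decay[OF fb t that])
  have K0: "0 \<le> K"
    by (rule order_trans[OF zero_le_power2 K[of 0 0]]) simp
  have "cmod (y n x) \<le> sqrt K" if "x \<in> \<rat> \<inter> {0..}" for n x
  proof -
    have "cmod (y n x) \<le> (x + 1) * cmod (y n x)"
      using that mult_right_mono[of 1 "x + 1" "cmod (y n x)"] by simp
    also have "\<dots> \<le> sqrt K"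
      using K[of x n] that by (intro real_le_rsqrt) auto
    finally show ?thesis .
  qed
  moreover have "countable (\<rat> \<inter> {0::real..})"
    by (intro countable_Int1 countable_rat)
  ultimately obtain k where k: "strict_mono k" "\<And>x. x \<in> \<rat> \<inter> {0..} \<Longrightarrow> \<exists>l. (\<lambda>n. y (k n) x) \<longlonglongrightarrow> l"
    using function_convergent_subsequence[of "\<rat> \<inter> {0..}" y "sqrt K"] by blast
  have "Cauchy (\<lambda>n. y (k n) x)" if "0 \<le> x" for x
  proof (rule metric_CauchyI)
    fix \<epsilon> :: real assume "0 < \<epsilon>"
    \<comment> \<open>This makes \<open>2 * K / \<eta>\<close> at most \<open>\<epsilon> / 4\<close>; the rational \<open>q\<close> is then taken so close to \<open>x\<close>
      that \<open>\<eta> * (q - x)\<close> is at most \<open>\<epsilon> / 8\<close>.\<close>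
    define \<eta> where "\<eta> = 8 * (K + 1) / \<epsilon>"
    have \<eta>: "0 < \<eta>"
      using K0 \<open>0 < \<epsilon>\<close> by (simp add: \<eta>_def)
    obtain q where q: "q \<in> \<rat>" "x < q" "q < x + \<epsilon> / (8 * \<eta>)"
      using Rats_dense_in_real[of x "x + \<epsilon> / (8 * \<eta>)"] \<eta> \<open>0 < \<epsilon>\<close> by auto
    have close: "dist (y n x) (y n q) < \<epsilon> * (3 / 8)" for n
    proof -
      have "cmod (y n q - y n x) \<le> \<eta> * (q - x) + 2 * K / \<eta>"
        using form_bounded_equicontinuous[OF fb t that less_imp_le[OF q(2)] \<eta>] by (simp add: K_def)
      moreover have "\<eta> * (q - x) < \<epsilon> / 8"
        using q(3) \<eta> by (simp add: field_simps)
      moreover have "2 * K / \<eta> \<le> \<epsilon> / 4"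
        using K0 \<open>0 < \<epsilon>\<close> by (simp add: \<eta>_def field_simps)
      ultimately show ?thesis
        by (simp add: dist_norm norm_minus_commute)
    qed
    have "convergent (\<lambda>n. y (k n) q)"
      using k(2)[of q] q that by (auto simp: convergent_def)
    then have "Cauchy (\<lambda>n. y (k n) q)"
      by (rule convergent_Cauchy)
    moreover have "0 < \<epsilon> / 4"
      using \<open>0 < \<epsilon>\<close> by simp
    ultimately obtain N where N: "\<And>m n. m \<ge> N \<Longrightarrow> n \<ge> N \<Longrightarrow> dist (y (k m) q) (y (k n) q) < \<epsilon> / 4"
      using metric_CauchyD by blast
    show "\<exists>N. \<forall>m\<ge>N. \<forall>n\<ge>N. dist (y (k m) x) (y (k n) x) < \<epsilon>"
    proof (intro exI[of _ N] allI impI)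
      fix m n assume "m \<ge> N" "n \<ge> N"
      have "dist (y (k m) x) (y (k n) x)
          \<le> dist (y (k m) x) (y (k m) q) + dist (y (k m) q) (y (k n) q) + dist (y (k n) q) (y (k n) x)"
        using dist_triangle[of "y (k m) x" "y (k n) x" "y (k m) q"]
          dist_triangle[of "y (k m) q" "y (k n) x" "y (k n) q"] by linarith
      also have "\<dots> < \<epsilon> * (3 / 8) + \<epsilon> / 4 + \<epsilon> * (3 / 8)"
        using close[of "k m"] close[of "k n"] N[OF \<open>m \<ge> N\<close> \<open>n \<ge> N\<close>] by (simp add: dist_commute)
      finally show "dist (y (k m) x) (y (k n) x) < \<epsilon>"
        by simp
    qed
  qed
  then have "\<forall>x\<ge>0. convergent (\<lambda>n. y (k n) x)"
    by (simp add: Cauchy_convergent_iff)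
  then show ?thesis
    using k(1) by (intro exI[of _ k] conjI)
qed

text \<open>The dominated convergence theorem, applied to the squared distances.\<close>

lemma dominated_ltwo_convergence:
  assumes sq: "\<And>n::nat. square_integrable (y n)"
    and lim: "\<And>x. 0 \<le> x \<Longrightarrow> (\<lambda>n. y n x) \<longlonglongrightarrow> f x"
    and bound: "\<And>n x. 0 \<le> x \<Longrightarrow> (cmod (y n x))\<^sup>2 \<le> w x" and w: "integrable half_line w"
  shows "square_integrable f" "(\<lambda>n. abs_ltwo (y n)) \<longlonglongrightarrow> abs_ltwo f"
proof -
  have meas: "y n \<in> borel_measurable half_line" for n
    using sq by (simp add: square_integrable_def)
  have f_meas: "f \<in> borel_measurable half_line"
  proof (rule borel_measurable_LIMSEQ_metric)
    show "y n \<in> borel_measurable half_line" for n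
      by (rule meas)
    show "(\<lambda>n. y n x) \<longlonglongrightarrow> f x" if "x \<in> space half_line" for x
      using that by (intro lim) simp
  qed
  have fw: "(cmod (f x))\<^sup>2 \<le> w x" if "0 \<le> x" for x
  proof (rule LIMSEQ_le_const2)
    show "(\<lambda>n. (cmod (y n x))\<^sup>2) \<longlonglongrightarrow> (cmod (f x))\<^sup>2"
      by (intro tendsto_intros lim that)
  qed (use bound that in auto)
  have "integrable half_line (\<lambda>x. (cmod (f x))\<^sup>2)"
  proof (rule Bochner_Integration.integrable_bound[OF w])
    show "(\<lambda>x. (cmod (f x))\<^sup>2) \<in> borel_measurable half_line"
      using f_meas by measurable
    show "AE x in half_line. norm ((cmod (f x))\<^sup>2) \<le> norm (w x)"
    proof (rule AE_I2)
      fix x assume "x \<in> space half_line"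
      then show "norm ((cmod (f x))\<^sup>2) \<le> norm (w x)"
        using fw[of x] by simp
    qed
  qed
  then show sf: "square_integrable f"
    using f_meas by (simp add: square_integrable_def)
  have "(\<lambda>n. \<integral>x. (cmod (y n x - f x))\<^sup>2 \<partial>half_line) \<longlonglongrightarrow> (\<integral>x. 0 \<partial>half_line)"
  proof (rule integral_dominated_convergence[where w = "\<lambda>x. 4 * w x"])
    show "(\<lambda>x. (cmod (y n x - f x))\<^sup>2) \<in> borel_measurable half_line" for n
      using f_meas meas[of n] by measurable
    show "integrable half_line (\<lambda>x. 4 * w x)"
      using w by simp
    show "AE x in half_line. (\<lambda>n. (cmod (y n x - f x))\<^sup>2) \<longlonglongrightarrow> 0"
    proof (rule AE_I2)
      fix x assume "x \<in> space half_line"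
      then have "(\<lambda>n. (cmod (y n x - f x))\<^sup>2) \<longlonglongrightarrow> (cmod (f x - f x))\<^sup>2"
        by (intro tendsto_intros lim) simp
      then show "(\<lambda>n. (cmod (y n x - f x))\<^sup>2) \<longlonglongrightarrow> 0"
        by simp
    qed
    show "AE x in half_line. norm ((cmod (y n x - f x))\<^sup>2) \<le> 4 * w x" for n
    proof (rule AE_I2)
      fix x assume x: "x \<in> space half_line"
      have "(cmod (y n x - f x))\<^sup>2 \<le> (cmod (y n x) + cmod (f x))\<^sup>2"
        by (intro power_mono norm_triangle_ineq4) simp
      also have "\<dots> \<le> 2 * (cmod (y n x))\<^sup>2 + 2 * (cmod (f x))\<^sup>2"
        using sum_squares_bound[of "cmod (y n x)" "cmod (f x)"] by (simp add: power2_sum)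
      also have "\<dots> \<le> 4 * w x"
        using bound[of x n] fw[of x] x by simp
      finally show "norm ((cmod (y n x - f x))\<^sup>2) \<le> 4 * w x"
        by simp
    qed
  qed simp
  moreover have "(norm (abs_ltwo (y n) - abs_ltwo f))\<^sup>2 = (\<integral>x. (cmod (y n x - f x))\<^sup>2 \<partial>half_line)" for n
  proof -
    have "abs_ltwo (y n) - abs_ltwo f = abs_ltwo (\<lambda>x. 1 * y n x + (- 1) * f x)"
      using abs_ltwo_linear[OF sq sf, of 1 n "- 1"] scaleR_eq_cscale[of "- 1" "abs_ltwo f"]
      by (simp add: cscale_one)
    then show ?thesis
      using norm_abs_ltwo[OF square_integrable_linear[OF sq[of n] sf, of 1 "- 1"]] by simp
  qed
  ultimately have "(\<lambda>n. (norm (abs_ltwo (y n) - abs_ltwo f))\<^sup>2) \<longlonglongrightarrow> 0"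
    by simp
  then have "(\<lambda>n. norm (abs_ltwo (y n) - abs_ltwo f)) \<longlonglongrightarrow> 0"
    by simp
  then show "(\<lambda>n. abs_ltwo (y n)) \<longlonglongrightarrow> abs_ltwo f"
    using tendsto_norm_zero_iff LIM_zero_iff by blast
qed

text \<open>The decay estimate supplies the square-integrable majorant for dominated convergence.\<close>

lemma form_bounded_sequence_compact:
  assumes G: "\<And>n::nat. (f n, h n) \<in> minimal_operator (\<lambda>x. t * riccati_primitive x)"
    and C: "\<And>n. inner (h n) (f n) \<le> C" and t: "0 < t" "t < 1"
  shows "\<exists>k l. strict_mono (k::nat \<Rightarrow> nat) \<and> (\<lambda>n. f (k n)) \<longlonglongrightarrow> l"
proof -
  have "\<forall>n. \<exists>y v. f n = abs_ltwo y \<and> form_bounded t C y v"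
    using t by (intro allI form_bounded_representative[OF G C]) auto
  from choice[OF this] obtain y where "\<forall>n. \<exists>v. f n = abs_ltwo (y n) \<and> form_bounded t C (y n) v" ..
  from choice[OF this] obtain v where "\<forall>n. f n = abs_ltwo (y n) \<and> form_bounded t C (y n) (v n)" ..
  then have f: "\<And>n. f n = abs_ltwo (y n)" and fb: "\<And>n. form_bounded t C (y n) (v n)"
    by simp_all
  obtain k where k: "strict_mono k" "\<And>x. 0 \<le> x \<Longrightarrow> convergent (\<lambda>n. y (k n) x)"
    using pointwise_convergent_subsequence[of t C y v, OF fb t] by blast
  have "(\<lambda>n. abs_ltwo (y (k n))) \<longlonglongrightarrow> abs_ltwo (\<lambda>x. lim (\<lambda>n. y (k n) x))"
  proof (rule dominated_ltwo_convergence(2))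
    show "square_integrable (y (k n))" for n
      using fb by (simp add: form_bounded_def)
    show "(\<lambda>n. y (k n) x) \<longlonglongrightarrow> lim (\<lambda>n. y (k n) x)" if "0 \<le> x" for x
      using k(2)[OF that] by (simp add: convergent_LIMSEQ_iff)
    show "integrable half_line (\<lambda>x. C / (t * (1 - t)) * (1 / (x + 1)\<^sup>2))"
      by (rule integrable_mult_right[OF integrable_inverse_square])
    show "(cmod (y (k n) x))\<^sup>2 \<le> C / (t * (1 - t)) * (1 / (x + 1)\<^sup>2)" if "0 \<le> x" for n x
    proof -
      have "(cmod (y (k n) x))\<^sup>2 * (x + 1)\<^sup>2 \<le> C / (t * (1 - t))"
        using form_bounded_decay[OF fb t that, of "k n"] by (simp only: power_mult_distrib mult.commute)
      moreover have "0 < (x + 1)\<^sup>2"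
        using that by simp
      ultimately have "(cmod (y (k n) x))\<^sup>2 \<le> C / (t * (1 - t)) / (x + 1)\<^sup>2"
        by (simp only: pos_le_divide_eq)
      then show ?thesis
        by simp
    qed
  qed
  then show ?thesis
    using k(1) f by auto
qed

section \<open>Density of the domain of the minimal operator\<close>

text \<open>By Henstock's lemma the Riemann sums of \<open>f\<close> approximate the integrals over the intervals of a
  fine division in total. As these integrals vanish, the Riemann sums of \<open>\<bar>f\<bar>\<close> are small.\<close>

lemma AE_zero_if_subinterval_integrals_zero:
  fixes f :: "real \<Rightarrow> complex"
  assumes f: "integrable (lebesgue_on {a..b}) f"
    and zero: "\<And>c d. a \<le> c \<Longrightarrow> c \<le> d \<Longrightarrow> d \<le> b \<Longrightarrow> (f has_integral 0) {c..d}"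
  shows "AE x in lebesgue_on {a..b}. f x = 0"
proof -
  have fint: "f integrable_on cbox a b"
    using integrable_on_lebesgue_on[OF f] by simp
  have "((\<lambda>x. cmod (f x)) has_integral 0) {a..b}"
    unfolding has_integral_real
  proof (intro allI impI)
    fix e :: real assume "e > 0"
    obtain \<gamma> where \<gamma>: "gauge \<gamma>"
      "\<And>p. p tagged_partial_division_of (cbox a b) \<Longrightarrow> \<gamma> fine p \<Longrightarrow>
        (\<Sum>(x, k)\<in>p. norm (measure lborel k *\<^sub>R f x - integral k f)) < e"
      by (rule Henstock_lemma[OF fint \<open>e > 0\<close>]) (rule that, assumption, blast)
    have "norm ((\<Sum>(x, k)\<in>p. measure lborel k *\<^sub>R cmod (f x)) - 0) < e"
      if p: "p tagged_division_of {a..b}" "\<gamma> fine p" for p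
    proof -
      have "(\<Sum>(x, k)\<in>p. measure lborel k *\<^sub>R cmod (f x))
          = (\<Sum>(x, k)\<in>p. norm (measure lborel k *\<^sub>R f x - integral k f))"
      proof (rule sum.cong, simp, clarify)
        fix x k assume xk: "(x, k) \<in> p"
        then obtain u w where k: "k = {u..w}"
          using tagged_division_ofD(4)[OF p(1)] by force
        have "x \<in> k" "k \<subseteq> {a..b}"
          using tagged_division_ofD(2,3)[OF p(1) xk] by auto
        then have "integral k f = 0"
          using k by (intro integral_unique) (auto intro!: zero)
        then show "measure lborel k *\<^sub>R cmod (f x) = norm (measure lborel k *\<^sub>R f x - integral k f)"
          by simp
      qed
      also have "\<dots> < e"
        using p by (intro \<gamma>(2)) (auto simp: tagged_division_of_def)
      finally show ?thesis
        by (simp add: sum_nonneg split_def)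
    qed
    then show "\<exists>\<gamma>. gauge \<gamma> \<and> (\<forall>p. p tagged_division_of {a..b} \<and> \<gamma> fine p \<longrightarrow>
        norm ((\<Sum>(x, k)\<in>p. measure lborel k *\<^sub>R cmod (f x)) - 0) < e)"
      using \<gamma>(1) by (intro exI[of _ \<gamma>]) simp
  qed
  moreover have "((\<lambda>x. cmod (f x)) has_integral (\<integral>x. cmod (f x) \<partial>lebesgue_on {a..b})) {a..b}"
    using f by (intro has_integral_integral_lebesgue_on integrable_norm) auto
  ultimately have "(\<integral>x. cmod (f x) \<partial>lebesgue_on {a..b}) = 0"
    using has_integral_unique by blast
  then have "AE x in lebesgue_on {a..b}. cmod (f x) = 0"
    using f by (subst (asm) integral_nonneg_eq_0_iff_AE) auto
  then show ?thesis
    by simp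
qed

text \<open>These profiles increase to the indicator of the open interval from \<open>p\<close> to \<open>q\<close> as \<open>n\<close> grows,
  and they are as smooth as \<open>hat\<close>.\<close>

definition plateau :: "real \<Rightarrow> real \<Rightarrow> real \<Rightarrow> real \<Rightarrow> real" where
  "plateau n p q s = n * hat p q s / (n * hat p q s + 1)"

definition plateau1 :: "real \<Rightarrow> real \<Rightarrow> real \<Rightarrow> real \<Rightarrow> real" where
  "plateau1 n p q s = n * hat1 p q s / (n * hat p q s + 1)\<^sup>2"

definition plateau2 :: "real \<Rightarrow> real \<Rightarrow> real \<Rightarrow> real \<Rightarrow> real" where
  "plateau2 n p q s = n * hat2 p q s / (n * hat p q s + 1)\<^sup>2 - 2 * (n * hat1 p q s)\<^sup>2 / (n * hat p q s + 1) ^ 3"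

lemma hat_nonneg: "0 \<le> hat p q s"
  by (simp add: hat_def)

lemma hat_pos_iff: "0 < hat p q s \<longleftrightarrow> p < s \<and> s < q"
  by (auto simp: hat_def zero_less_mult_iff max_def)

lemma trial_plateau:
  assumes "0 \<le> t" "0 \<le> p" "p \<le> q" "0 \<le> n"
  shows "trial t p q (plateau n p q) (plateau1 n p q) (plateau2 n p q)"
proof
  fix s
  have pos: "0 < n * hat p q s + 1" for s
    using hat_nonneg[of p q s] assms by (simp add: add_nonneg_pos)
  then have ne: "n * hat p q s + 1 \<noteq> 0" for s
    by (metis less_irrefl)
  note d = has_derivative_hat[of p q s] has_derivative_hat1[of p q s]
  show "(plateau n p q has_real_derivative plateau1 n p q s) (at s)"
    unfolding plateau_def[abs_def] plateau1_def
    by (rule derivative_eq_intros d refl ne)+ (simp add: field_simps power2_eq_square)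
  have D2: "((\<lambda>s. (n * hat p q s + 1)\<^sup>2) has_real_derivative 2 * (n * hat p q s + 1) * (n * hat1 p q s)) (at s)"
    by (rule derivative_eq_intros d refl)+ simp
  have D1: "((\<lambda>s. n * hat1 p q s / (n * hat p q s + 1)\<^sup>2) has_real_derivative
      (n * hat2 p q s * (n * hat p q s + 1)\<^sup>2 - n * hat1 p q s * (2 * (n * hat p q s + 1) * (n * hat1 p q s)))
        / ((n * hat p q s + 1)\<^sup>2 * (n * hat p q s + 1)\<^sup>2)) (at s)"
    using ne[of s] by (intro DERIV_divide D2 DERIV_cmult d) auto
  have eq: "(n * hat2 p q s * m\<^sup>2 - n * hat1 p q s * (2 * m * (n * hat1 p q s))) / (m\<^sup>2 * m\<^sup>2)
      = n * hat2 p q s / m\<^sup>2 - 2 * (n * hat1 p q s)\<^sup>2 / m ^ 3" if "m \<noteq> 0" for m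
    using that by (simp add: field_simps power2_eq_square power3_eq_cube)
  show "(plateau1 n p q has_real_derivative plateau2 n p q s) (at s)"
    unfolding plateau1_def[abs_def] plateau2_def using D1 by (simp only: eq[OF ne])
  show "continuous_on UNIV (plateau2 n p q)"
    unfolding plateau2_def[abs_def] using ne by (intro continuous_intros) auto
  show "plateau n p q s = 0 \<and> plateau1 n p q s = 0 \<and> plateau2 n p q s = 0" if "s \<le> p \<or> q \<le> s"
    using hat_vanish[OF that] by (simp add: plateau_def plateau1_def plateau2_def)
qed (use assms in auto)

lemma plateau_bounds:
  assumes "0 \<le> n"
  shows "0 \<le> plateau n p q s" "plateau n p q s \<le> 1"
proof -
  have "0 \<le> n * hat p q s"
    using assms hat_nonneg by simp
  then show "0 \<le> plateau n p q s" "plateau n p q s \<le> 1"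
    unfolding plateau_def by auto
qed

lemma plateau_tendsto: "(\<lambda>n. plateau (real n) p q s) \<longlonglongrightarrow> (if p < s \<and> s < q then 1 else 0)"
proof (cases "0 < hat p q s")
  case True
  then have "filterlim (\<lambda>n. hat p q s * real n) at_top sequentially"
    by (intro filterlim_tendsto_pos_mult_at_top[OF tendsto_const] filterlim_real_sequentially)
  then have "filterlim (\<lambda>n. 1 + hat p q s * real n) at_top sequentially"
    by (intro filterlim_tendsto_add_at_top[OF tendsto_const])
  then have "(\<lambda>n. 1 - inverse (1 + hat p q s * real n)) \<longlonglongrightarrow> 1 - 0"
    by (intro tendsto_diff tendsto_const tendsto_inverse_0_at_top)
  moreover have "1 - inverse (1 + hat p q s * real n) = plateau (real n) p q s" for n
  proof -
    have "0 < 1 + hat p q s * real n"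
      using True by (simp add: add_pos_nonneg)
    then show ?thesis
      by (simp add: plateau_def field_simps)
  qed
  ultimately show ?thesis
    using True by (simp add: hat_pos_iff)
next
  case False
  then have "hat p q s = 0"
    using hat_nonneg[of p q s] by simp
  moreover have "\<not> (p < s \<and> s < q)"
    using False hat_pos_iff by blast
  ultimately show ?thesis
    by (simp only: plateau_def) simp
qed

lemma stretch_strict_mono:
  assumes "0 \<le> x" "x < y"
  shows "stretch t x < stretch t y"
proof (rule DERIV_pos_imp_increasing_open[OF assms(2)])
  show "\<exists>d. (stretch t has_real_derivative d) (at z) \<and> 0 < d" if "x < z" "z < y" for z
    using has_derivative_stretch_at[of z t] that assms by (intro exI conjI) auto
  show "continuous_on {x..y} (stretch t)"
    using continuous_on_stretch[of y t] assms by (auto intro: continuous_on_subset)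
qed

lemma stretch_less_iff: "0 \<le> x \<Longrightarrow> 0 \<le> y \<Longrightarrow> stretch t x < stretch t y \<longleftrightarrow> x < y"
  using stretch_strict_mono[of x y t] stretch_strict_mono[of y x t] by (cases x y rule: linorder_cases) auto

text \<open>Orthogonality to the trial functions with plateau profiles passes to the limit, where the profile
  becomes the indicator of an interval.\<close>

lemma weighted_integral_zero:
  assumes \<phi>: "square_integrable \<phi>" and t: "0 \<le> t" and ab: "0 \<le> a" "a \<le> b"
    and orth: "\<And>f k. (f, k) \<in> minimal_operator (\<lambda>x. t * riccati_primitive x) \<Longrightarrow> cinner (abs_ltwo \<phi>) f = 0"
  shows "((\<lambda>x. \<phi> x * of_real (exp (t * zigzag x))) has_integral 0) {a..b}"
    and "integrable (lebesgue_on {a..b}) (\<lambda>x. \<phi> x * of_real (exp (t * zigzag x)))"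
proof -
  define p q where "p = stretch t a" and "q = stretch t b"
  define R where "R = exp (2 * t * pi) * q"
  define E where "E = exp (t * pi)"
  have pq: "0 \<le> p" "p \<le> q"
    using ab stretch_less_iff[of a 0 t] stretch_less_iff[of b a t] by (auto simp: p_def q_def not_less[symmetric])
  have tr: "trial t p q (plateau (real n) p q) (plateau1 (real n) p q) (plateau2 (real n) p q)" for n
    using t pq by (intro trial_plateau) auto
  define y where "y n = trial.y t (plateau (real n) p q)" for n
  have y: "y n x = of_real (exp (t * zigzag x) * plateau (real n) p q (stretch t x))" for n x
    unfolding y_def trial.y_def[OF tr] ..
  have sq: "square_integrable (y n)" for n
    unfolding y_def by (rule trial.square_integrable_y[OF tr])
  have y_R: "y n x = 0" if "R \<le> x" for n x
    unfolding y_def by (rule trial.vanish_R(1)[OF tr]) (use that in \<open>simp add: R_def trial.R_def[OF tr]\<close>)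
  have \<phi>_meas: "\<phi> \<in> borel_measurable half_line"
    using \<phi> by (simp add: square_integrable_def)
  have y_meas: "y n \<in> borel_measurable half_line" for n
    using sq by (simp add: square_integrable_def)
  have y_le: "cmod (y n x) \<le> E" for n x
  proof -
    have "cmod (y n x) = exp (t * zigzag x) * plateau (real n) p q (stretch t x)"
      using plateau_bounds(1)[of "real n" p q "stretch t x"] by (simp add: y norm_mult)
    also have "\<dots> \<le> E * 1"
      unfolding E_def using plateau_bounds[of "real n" p q "stretch t x"] exp_zigzag_bounds(2)[OF t, of x]
      by (intro mult_mono) auto
    finally show ?thesis
      by simp
  qed
  let ?F = "\<lambda>x. if a < x \<and> x < b then \<phi> x * of_real (exp (t * zigzag x)) else 0"
  \<comment> \<open>The common majorant: all trial functions are bounded by \<open>E\<close> and supported in \<open>[0, R]\<close>.\<close>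
  define w where "w x = E * ((cmod (\<phi> x))\<^sup>2 + indicator {0..R} x)" for x
  have w: "integrable half_line w"
  proof -
    have "integrable half_line (indicator {0..R} :: real \<Rightarrow> real)"
      by (subst integrable_restrict_space)
        (auto simp: indicator_inter_arith[symmetric] lmeasurable_iff_integrable[symmetric])
    then show ?thesis
      unfolding w_def using \<phi> by (auto simp: square_integrable_def)
  qed
  have lim: "(\<lambda>n. \<phi> x * cnj (y n x)) \<longlonglongrightarrow> ?F x" if "0 \<le> x" for x
  proof -
    have "(\<lambda>n. \<phi> x * cnj (y n x)) \<longlonglongrightarrow> \<phi> x * cnj (of_real (exp (t * zigzag x) *
        (if p < stretch t x \<and> stretch t x < q then 1 else 0)))"
      unfolding y by (intro tendsto_intros plateau_tendsto)
    also have "\<phi> x * cnj (of_real (exp (t * zigzag x) *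
        (if p < stretch t x \<and> stretch t x < q then 1 else 0))) = ?F x"
      using stretch_less_iff[OF _ that] stretch_less_iff[OF that] ab by (auto simp: p_def q_def)
    finally show ?thesis .
  qed
  have dom: "cmod (\<phi> x * cnj (y n x)) \<le> w x" if "0 \<le> x" for n x
  proof (cases "x < R")
    case True
    have "cmod (\<phi> x) \<le> (cmod (\<phi> x))\<^sup>2 + 1"
      using sum_squares_bound[of 1 "cmod (\<phi> x)"] norm_ge_zero[of "\<phi> x"]
      unfolding mult_1_right one_power2 by linarith
    then have "cmod (\<phi> x) * cmod (y n x) \<le> ((cmod (\<phi> x))\<^sup>2 + 1) * E"
      using y_le[of n x] by (intro mult_mono) auto
    then show ?thesis
      using True that by (simp add: w_def norm_mult mult.commute)
  next
    case False
    then show ?thesis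
      using y_R[of x n] by (simp add: w_def E_def)
  qed
  have s_meas: "(\<lambda>x. \<phi> x * cnj (y n x)) \<in> borel_measurable half_line" for n
    by (rule borel_measurable_integrable[OF square_integrable_mult_cnj[OF \<phi> sq]])
  have F_meas: "?F \<in> borel_measurable half_line"
  proof (rule borel_measurable_LIMSEQ_metric)
    show "(\<lambda>x. \<phi> x * cnj (y n x)) \<in> borel_measurable half_line" for n
      by (rule s_meas)
    show "(\<lambda>n. \<phi> x * cnj (y n x)) \<longlonglongrightarrow> ?F x" if "x \<in> space half_line" for x
      using that by (intro lim) simp
  qed
  have AE_lim: "AE x in half_line. (\<lambda>n. \<phi> x * cnj (y n x)) \<longlonglongrightarrow> ?F x"
    using lim by (intro AE_I2) simp
  have AE_dom: "AE x in half_line. cmod (\<phi> x * cnj (y n x)) \<le> w x" for n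
    using dom by (intro AE_I2) simp
  have conv: "integrable half_line ?F"
    "(\<lambda>n. \<integral>x. \<phi> x * cnj (y n x) \<partial>half_line) \<longlonglongrightarrow> (\<integral>x. ?F x \<partial>half_line)"
    by (rule integrable_dominated_convergence[OF F_meas s_meas w AE_lim AE_dom]
        integral_dominated_convergence[OF F_meas s_meas w AE_lim AE_dom])+
  have "(\<integral>x. \<phi> x * cnj (y n x) \<partial>half_line) = 0" for n
  proof -
    have "cinner (abs_ltwo \<phi>) (abs_ltwo (y n)) = 0"
      unfolding y_def by (rule orth[OF trial.in_minimal_operator[OF tr]])
    then show ?thesis
      using \<phi> sq by (simp add: cinner_abs_ltwo)
  qed
  with conv(2) have "(\<lambda>n::nat. 0) \<longlonglongrightarrow> (\<integral>x. ?F x \<partial>half_line)"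
    by (simp only:)
  then have "(\<integral>x. ?F x \<partial>half_line) = 0"
    by (rule LIMSEQ_unique[OF _ tendsto_const])
  then have "(?F has_integral 0) {0..b}"
    using has_integral_half_line[OF conv(1), of b] ab by simp
  then have "((\<lambda>x. if x \<in> {a<..<b} then \<phi> x * of_real (exp (t * zigzag x)) else 0) has_integral 0) {0..b}"
    by simp
  then have "((\<lambda>x. \<phi> x * of_real (exp (t * zigzag x))) has_integral 0) {a<..<b}"
    using ab by (subst (asm) has_integral_restrict) auto
  then show "((\<lambda>x. \<phi> x * of_real (exp (t * zigzag x))) has_integral 0) {a..b}"
    by (simp only: has_integral_Icc_iff_Ioo)
  have "integrable lebesgue (\<lambda>x. indicator {0..} x *\<^sub>R ?F x)"
    using conv(1) by (subst (asm) integrable_restrict_space) auto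
  then have "integrable lebesgue (\<lambda>x. indicator {a..b} x *\<^sub>R (\<phi> x * of_real (exp (t * zigzag x))))"
  proof (rule integrable_cong_AE_imp)
    have "negligible {a, b}"
      by simp
    then show "AE x in lebesgue. indicator {0..} x *\<^sub>R ?F x = indicator {a..b} x *\<^sub>R (\<phi> x * of_real (exp (t * zigzag x)))"
      using ab by (intro AE_I'[of "{a, b}"]) (auto simp: negligible_iff_null_sets indicator_def)
    have "(\<lambda>x. \<phi> x * of_real (exp (t * zigzag x))) \<in> borel_measurable half_line"
      using \<phi>_meas continuous_imp_measurable_on_sets_lebesgue[OF continuous_on_of_real[OF continuous_on_exp_zigzag[of "{0..}" t]]]
      by (intro borel_measurable_times) auto
    then have "(\<lambda>x. \<phi> x * of_real (exp (t * zigzag x))) \<in> borel_measurable (lebesgue_on {a..b})"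
      by (rule measurable_restrict_mono) (use ab in auto)
    then show "(\<lambda>x. indicator {a..b} x *\<^sub>R (\<phi> x * of_real (exp (t * zigzag x)))) \<in> borel_measurable lebesgue"
      by (subst (asm) borel_measurable_restrict_space_iff) auto
  qed
  then show "integrable (lebesgue_on {a..b}) (\<lambda>x. \<phi> x * of_real (exp (t * zigzag x)))"
    by (subst integrable_restrict_space) auto
qed

text \<open>An element orthogonal to the domain has vanishing weighted integrals over all intervals, and the
  weight \<open>exp (t * zigzag x)\<close> has no zeros.\<close>

lemma minimal_operator_domain_dense:
  assumes t: "0 \<le> t"
    and orth: "\<And>f k. (f, k) \<in> minimal_operator (\<lambda>x. t * riccati_primitive x) \<Longrightarrow> inner h f = 0"
  shows "h = 0"
proof -
  have c: "cinner h f = 0" if fk: "(f, k) \<in> minimal_operator (\<lambda>x. t * riccati_primitive x)" for f k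
  proof -
    have "inner h (\<i> *\<^sub>c f) = 0"
      using orth minimal_operator_linear[OF fk fk, of \<i> 0] by (simp add: cscale_zero)
    then show ?thesis
      using orth[OF fk] by (simp add: inner_ltwo_def cinner_scale_right complex_eq_iff)
  qed
  define \<phi> where "\<phi> = rep_ltwo h"
  have h: "h = abs_ltwo \<phi>" and \<phi>: "square_integrable \<phi>"
    using Quotient_abs_rep[OF Quotient_ltwo, of h] Quotient_rep_reflp[OF Quotient_ltwo, of h]
    by (auto simp: \<phi>_def)
  have "AE x in half_line. \<phi> x = 0"
  proof -
    have "AE x in lebesgue. \<forall>n::nat. x \<in> {0..real n} \<longrightarrow> \<phi> x = 0"
    proof (subst AE_all_countable, intro allI)
      fix n :: nat
      have "AE x in lebesgue_on {0..real n}. \<phi> x * of_real (exp (t * zigzag x)) = 0"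
        using c unfolding h
        by (intro AE_zero_if_subinterval_integrals_zero weighted_integral_zero[OF \<phi> t]) auto
      then show "AE x in lebesgue. x \<in> {0..real n} \<longrightarrow> \<phi> x = 0"
        by (subst (asm) AE_restrict_space_iff) auto
    qed
    then have "AE x in lebesgue. x \<in> {0..} \<longrightarrow> \<phi> x = 0"
    proof eventually_elim
      case (elim x)
      then show ?case
        using real_arch_simple[of x] by auto
    qed
    then show ?thesis
      by (subst AE_restrict_space_iff) auto
  qed
  then have "abs_ltwo \<phi> = abs_ltwo (\<lambda>x. 0)"
    using \<phi> square_integrable_zero by (intro Quotient_rel_abs[OF Quotient_ltwo]) auto
  then show ?thesis
    using h by (simp add: zero_ltwo.abs_eq)
qed

section \<open>The three regimes\<close>

lemma compact_extension_less_1: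
  assumes "0 < t" "t < 1"
  shows "has_extension_with_compact_resolvent (minimal_operator (\<lambda>x. t * riccati_primitive x))"
proof -
  let ?G = "minimal_operator (\<lambda>x. t * riccati_primitive x)"
  have tr: "trial t 0 1 (hat 0 1) (hat1 0 1) (hat2 0 1)"
    using assms by (intro trial_hat) auto
  interpret coercive_operator ?G "9 * t * (1 - t)"
  proof
    note elem = trial.in_minimal_operator[OF tr]
    show "(0, 0) \<in> ?G"
      using minimal_operator_linear[OF elem elem, of 0 0] by (simp add: cscale_zero)
    show "(f + f', g + g') \<in> ?G" if "(f, g) \<in> ?G" "(f', g') \<in> ?G" for f g f' g'
      using minimal_operator_linear[OF that, of 1 1] by (simp add: cscale_one)
    show "(a *\<^sub>c f, a *\<^sub>c g) \<in> ?G" if "(f, g) \<in> ?G" for f g a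
      using minimal_operator_linear[OF that that, of a 0] by (simp add: cscale_zero)
    show "0 < 9 * t * (1 - t)"
      using assms by simp
    show "\<exists>k l. strict_mono k \<and> (\<lambda>n. ys (k n)) \<longlonglongrightarrow> l"
      if "\<And>n. (ys n, gs n) \<in> ?G" "\<And>n. inner (gs n) (ys n) \<le> C" for ys gs :: "nat \<Rightarrow> ltwo" and C
      by (rule form_bounded_sequence_compact[OF that assms])
    show "h = 0" if "\<And>v k. (v, k) \<in> ?G \<Longrightarrow> inner h v = 0" for h
      using that assms by (intro minimal_operator_domain_dense[of t]) auto
  qed (use assms energy_minimal_operator in auto)
  show ?thesis
    by (rule has_extension)
qed

theorem theorem5:
  shows "\<exists>s1\<in>L2_loc. \<exists>s2\<in>L2_loc. \<exists>\<epsilon>>0::real.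
     (semi_bounded (minimal_operator s1) \<and>
      has_extension_with_compact_resolvent (minimal_operator s1) \<and>
      \<not> semi_bounded (minimal_operator (\<lambda>x. (1 + \<epsilon>) * s1 x))) \<and>
     (semi_bounded (minimal_operator s2) \<and>
      has_extension_with_compact_resolvent (minimal_operator s2) \<and>
      semi_bounded (minimal_operator (\<lambda>x. (1 + \<epsilon>) * s2 x)) \<and>
      \<not> has_extension_with_compact_resolvent (minimal_operator (\<lambda>x. (1 + \<epsilon>) * s2 x)))"
proof (intro bexI exI conjI)
  show "(0::real) < 1"
    by simp
  have s1: "(\<lambda>x. (1 + 1) * (3 / 4 * riccati_primitive x)) = (\<lambda>x. 3 / 2 * riccati_primitive x)"
    and s2: "(\<lambda>x. (1 + 1) * (1 / 2 * riccati_primitive x)) = (\<lambda>x. 1 * riccati_primitive x)"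
    by auto
  show "semi_bounded (minimal_operator (\<lambda>x. 3 / 4 * riccati_primitive x))"
    "semi_bounded (minimal_operator (\<lambda>x. 1 / 2 * riccati_primitive x))"
    by (rule semi_bounded_le_1; simp)+
  show "has_extension_with_compact_resolvent (minimal_operator (\<lambda>x. 3 / 4 * riccati_primitive x))"
    "has_extension_with_compact_resolvent (minimal_operator (\<lambda>x. 1 / 2 * riccati_primitive x))"
    by (rule compact_extension_less_1; simp)+
  show "\<not> semi_bounded (minimal_operator (\<lambda>x. (1 + 1) * (3 / 4 * riccati_primitive x)))"
    unfolding s1 by (rule not_semi_bounded_gt_1) simp
  show "semi_bounded (minimal_operator (\<lambda>x. (1 + 1) * (1 / 2 * riccati_primitive x)))"
    unfolding s2 by (rule semi_bounded_le_1) auto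
  show "\<not> has_extension_with_compact_resolvent (minimal_operator (\<lambda>x. (1 + 1) * (1 / 2 * riccati_primitive x)))"
    unfolding s2 by (rule no_compact_extension_eq_1)
qed (rule riccati_primitive_L2_loc)+

end
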